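(* Let $\gamma=i\to j$ be the longest edge in a fan triangulation $\Delta$ with $n$ internal diagonals, and let $x_\gamma$ be the associated cluster variable. (a) The Laurent expansion of $x_\gamma$ contains $(n+1)^2$ terms. (b) The minimal element of the expansion poset $\mathbb T_\gamma$ is the $T$-path consisting of $3$ edges that first goes along the boundary away from the fan vertex, then along the diagonal closest to $i$, and then along the boundary to $j$. (c) The maximal element is the $T$-path consisting of $3$ edges that first goes to the fan vertex, then along the diagonal furthest from $i$, and then along the boundary edge to $j$. (d) The poset $\mathbb T_\gamma$ is isomorphic to $L_\gamma$.
   Context: A fan triangulation of an $(n+3)$-gon has all $n$ internal diagonals sharing a common endpoint $k$ (the fan vertex). The longest edge $i\to j$ joins the two neighbours $i,j$ of $k$ on the polygon, crossing all internal diagonals; the polygon is drawn with $k$ on top, $i$ to the left and $j$ to the right (so $k$ lies to the left of the directed arc $i\to j$). The cluster algebra is that of configurations of affine flags for $\mathrm{SL}_3$ on the polygon (Fock–Goncharov). The initial seed of $\Delta$ has two variables $x_{ij},x_{ji}$ for each edge $\{i,j\}$ of $\Delta$ (attached to the directed edges $i\to j$, $j\to i$; those of boundary edges are frozen) and one variable $x_{ijk}$ for each triangle $ijk$ of $\Delta$. The quiver has, for each triangle and each vertex $p$ of it, with $p,t,b$ the vertices in clockwise order, the $3$-cycle $x_{pt}\to x_{ptb}\to x_{pb}\to x_{pt}$. Flipping the diagonal $kl$ to $ij$ in a quadrilateral with triangles $ikl,jkl$ means mutating at $x_{kl},x_{lk}$ and then at $x_{ikl},x_{jkl}$, giving $x_{kl}x_{ijk}=x_{ki}x_{jkl}+x_{kj}x_{ikl}$,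 $x_{lk}x_{ijl}=x_{li}x_{jkl}+x_{lj}x_{ikl}$, $x_{ikl}x_{ij}=x_{ik}x_{ijl}+x_{il}x_{ijk}$, $x_{jkl}x_{ji}=x_{jk}x_{ijl}+x_{jl}x_{ijk}$. Thus each directed edge of the polygon has a cluster variable. $\mathbb T_\gamma$ is the set of Laurent monomials in the expansion of $x_\gamma$ in the initial seed (represented by $T$-paths), partially ordered by the covering relations: $m'$ covers $m$ if $m'=\hat y\,m$ for some mutable node, where for a node $v$ of the quiver $\hat y_v=\prod_{u\to v}x_u/\prod_{v\to u}x_u$. A $3$-edge $T$-path from $i$ to $j$ traverses a first edge $i\to s$ forwards (blue), then an edge $t\to s$ backwards from $s$ to $t$ (red), then $t\to j$ forwards (blue), and represents the monomial $x_{is}x_{tj}/x_{ts}$. $L_\gamma$: let $L$ be the lattice path in $\mathbb Z^2$ starting at the origin with word $(ab^2)^n$ ($a$ = unit step right, $b$ = unit step up). $L_\gamma$ is the set of points of $\mathbb Z^2$ (with abscissa between $0$ and $n$) on or below $L$ and weakly above the horizontal axis, made into a poset by: $(x_2,y_2)$ covers $(x_1,y_1)$ iff either $x_2=x_1+1$ and $y_2=y_1$, or $y_2=y_1+1$ and $x_2=x_1$. *)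

theory Defs
  imports Complex_Main "HOL-Library.Poly_Mapping" "HOL-Combinatorics.Transposition"
begin

text \<open>
  The vertices of the \<open>N\<close>-gon are \<open>0, \<dots>, N - 1\<close>, numbered clockwise.  A triangulation is given
  by the set of all its edges (boundary edges included), each edge being a two-element set of
  vertices.
\<close>

definition cw :: "nat \<Rightarrow> nat \<Rightarrow> nat" where
  "cw N p = (p + 1) mod N"

definition ccw :: "nat \<Rightarrow> nat \<Rightarrow> nat" where
  "ccw N p = (p + N - 1) mod N"

definition polygon_edges :: "nat \<Rightarrow> nat set set" where
  "polygon_edges N = {{p, cw N p} | p. p < N}"

definition fan_triangulation :: "nat \<Rightarrow> nat \<Rightarrow> nat set set" where
  "fan_triangulation N k = polygon_edges N \<union> {{k, m} | m. m < N \<and> m \<noteq> k}"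

definition internal_diagonals :: "nat \<Rightarrow> nat set set \<Rightarrow> nat set set" where
  "internal_diagonals N \<Delta> = \<Delta> - polygon_edges N"

text \<open>In a triangulation of a convex polygon, three vertices that are pairwise joined by edges
  always bound one of its triangles.\<close>

definition triangles :: "nat set set \<Rightarrow> nat set set" where
  "triangles \<Delta> = {T. card T = 3 \<and> (\<forall>p\<in>T. \<forall>q\<in>T. p \<noteq> q \<longrightarrow> {p, q} \<in> \<Delta>)}"

definition clockwise :: "nat \<Rightarrow> nat \<Rightarrow> nat \<Rightarrow> bool" where
  "clockwise p t b \<longleftrightarrow> (p < t \<and> t < b) \<or> (t < b \<and> b < p) \<or> (b < p \<and> p < t)"

text \<open>\<open>Edge p q\<close> carries \<open>x\<^sub>p\<^sub>q\<close> (directed edge from \<open>p\<close> to \<open>q\<close>), and \<open>Tri {p, q, r}\<close> carries \<open>x\<^sub>p\<^sub>q\<^sub>r\<close>.\<close>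

datatype node = Edge nat nat | Tri "nat set"

definition nodes :: "nat set set \<Rightarrow> node set" where
  "nodes \<Delta> = {Edge p q | p q. {p, q} \<in> \<Delta>} \<union> Tri ` triangles \<Delta>"

definition mutable_nodes :: "nat \<Rightarrow> nat set set \<Rightarrow> node set" where
  "mutable_nodes N \<Delta> =
     {Edge p q | p q. {p, q} \<in> internal_diagonals N \<Delta>} \<union> Tri ` triangles \<Delta>"

definition arrows :: "nat set set \<Rightarrow> (node \<times> node) set" where
  "arrows \<Delta> = (\<Union>{{(Edge p t, Tri {p, t, b}), (Tri {p, t, b}, Edge p b), (Edge p b, Edge p t)} | p t b.
                  {p, t, b} \<in> triangles \<Delta> \<and> clockwise p t b})"

text \<open>A quiver is encoded by its skew-symmetric matrix: \<open>b u v\<close> is the number of arrows from \<open>u\<close> to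
  \<open>v\<close> minus the number of arrows from \<open>v\<close> to \<open>u\<close>.  The arrows of a triangulation are all simple, as
  an arrow determines the triangle and the vertex \<open>p\<close> it comes from.\<close>

definition quiver :: "nat set set \<Rightarrow> node \<Rightarrow> node \<Rightarrow> int" where
  "quiver \<Delta> u v = of_bool ((u, v) \<in> arrows \<Delta>) - of_bool ((v, u) \<in> arrows \<Delta>)"

type_synonym 'a seed = "(node \<Rightarrow> node \<Rightarrow> int) \<times> (node \<Rightarrow> 'a)"

definition mutate_quiver :: "node \<Rightarrow> (node \<Rightarrow> node \<Rightarrow> int) \<Rightarrow> node \<Rightarrow> node \<Rightarrow> int" where
  "mutate_quiver w b u v =
     (if u = w \<or> v = w then - b u v
      else b u v + max 0 (b u w) * max 0 (b w v) - max 0 (- b u w) * max 0 (- b w v))"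

definition exchange :: "node \<Rightarrow> (node \<Rightarrow> node \<Rightarrow> int) \<Rightarrow> (node \<Rightarrow> 'a::field) \<Rightarrow> 'a" where
  "exchange w b x =
     ((\<Prod>u | b u w > 0. x u ^ nat (b u w)) + (\<Prod>u | b w u > 0. x u ^ nat (b w u))) / x w"

definition mutate :: "node \<Rightarrow> 'a::field seed \<Rightarrow> 'a seed" where
  "mutate w S = (case S of (b, x) \<Rightarrow> (mutate_quiver w b, x(w := exchange w b x)))"

text \<open>
  Flip of \<open>kl\<close> to \<open>ij\<close>.  The mutated seed is relabelled: the variables produced at \<open>x\<^sub>k\<^sub>l\<close>, \<open>x\<^sub>l\<^sub>k\<close>,
  \<open>x\<^sub>i\<^sub>k\<^sub>l\<close>, \<open>x\<^sub>j\<^sub>k\<^sub>l\<close> are renamed to \<open>x\<^sub>i\<^sub>j\<^sub>k\<close>, \<open>x\<^sub>i\<^sub>j\<^sub>l\<close>, \<open>x\<^sub>i\<^sub>j\<close>, \<open>x\<^sub>j\<^sub>i\<close> respectively.  To have a permutation of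
  all labels, old and new labels are swapped; values of a seed at labels that are not nodes of its
  triangulation are meaningless.
\<close>

definition flip_relabel :: "nat \<Rightarrow> nat \<Rightarrow> nat \<Rightarrow> nat \<Rightarrow> node \<Rightarrow> node" where
  "flip_relabel i j k l =
     Transposition.transpose (Edge k l) (Tri {i, j, k}) \<circ>
     Transposition.transpose (Edge l k) (Tri {i, j, l}) \<circ>
     Transposition.transpose (Tri {i, k, l}) (Edge i j) \<circ>
     Transposition.transpose (Tri {j, k, l}) (Edge j i)"

definition relabel :: "(node \<Rightarrow> node) \<Rightarrow> 'a seed \<Rightarrow> 'a seed" where
  "relabel \<sigma> S = (case S of (b, x) \<Rightarrow> (\<lambda>u v. b (\<sigma> u) (\<sigma> v), \<lambda>u. x (\<sigma> u)))"

definition flip_seed :: "nat \<Rightarrow> nat \<Rightarrow> nat \<Rightarrow> nat \<Rightarrow> 'a::field seed \<Rightarrow> 'a seed" where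
  "flip_seed i j k l S =
     relabel (flip_relabel i j k l)
       (mutate (Tri {j, k, l}) (mutate (Tri {i, k, l}) (mutate (Edge l k) (mutate (Edge k l) S))))"

definition flip_triangulation :: "nat \<Rightarrow> nat \<Rightarrow> nat \<Rightarrow> nat \<Rightarrow> nat set set \<Rightarrow> nat set set" where
  "flip_triangulation i j k l \<Delta> = insert {i, j} (\<Delta> - {{k, l}})"

inductive flip_reachable ::
    "nat \<Rightarrow> nat set set \<Rightarrow> (node \<Rightarrow> 'a::field) \<Rightarrow> nat set set \<Rightarrow> 'a seed \<Rightarrow> bool"
  for N :: nat and \<Delta>\<^sub>0 :: "nat set set" and x\<^sub>0 :: "node \<Rightarrow> 'a" where
  initial: "flip_reachable N \<Delta>\<^sub>0 x\<^sub>0 \<Delta>\<^sub>0 (quiver \<Delta>\<^sub>0, x\<^sub>0)"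
| flip: "\<lbrakk>flip_reachable N \<Delta>\<^sub>0 x\<^sub>0 \<Delta> S; {k, l} \<in> internal_diagonals N \<Delta>;
          {i, k, l} \<in> triangles \<Delta>; {j, k, l} \<in> triangles \<Delta>; i \<noteq> j\<rbrakk>
    \<Longrightarrow> flip_reachable N \<Delta>\<^sub>0 x\<^sub>0 (flip_triangulation i j k l \<Delta>) (flip_seed i j k l S)"

text \<open>The cluster variable of the directed edge from \<open>p\<close> to \<open>q\<close>: the value it has in every seed that
  is reached by flips and whose triangulation contains the edge.\<close>

definition edge_variable ::
    "nat \<Rightarrow> nat set set \<Rightarrow> (node \<Rightarrow> 'a::field) \<Rightarrow> nat \<Rightarrow> nat \<Rightarrow> 'a" where
  "edge_variable N \<Delta>\<^sub>0 x\<^sub>0 p q =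
     (THE y. \<exists>\<Delta> b x. flip_reachable N \<Delta>\<^sub>0 x\<^sub>0 \<Delta> (b, x) \<and> {p, q} \<in> \<Delta> \<and> y = x (Edge p q))"

text \<open>The initial cluster lives in an arbitrary ambient field of characteristic 0, where it is only
  required to be algebraically independent over the rationals.\<close>

definition algebraically_independent_on :: "'v set \<Rightarrow> ('v \<Rightarrow> 'a::field_char_0) \<Rightarrow> bool" where
  "algebraically_independent_on V x \<longleftrightarrow>
     (\<forall>P :: ('v \<Rightarrow>\<^sub>0 nat) \<Rightarrow>\<^sub>0 rat.
        (\<forall>m \<in> Poly_Mapping.keys P. Poly_Mapping.keys m \<subseteq> V) \<longrightarrow>
        (\<Sum>m \<in> Poly_Mapping.keys P. of_rat (Poly_Mapping.lookup P m) *
           (\<Prod>v \<in> Poly_Mapping.keys m. x v ^ Poly_Mapping.lookup m v)) = 0 \<longrightarrow>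
        P = 0)"

text \<open>A Laurent monomial is represented by its exponent vector, so that multiplication of monomials
  is addition of type \<open>node \<Rightarrow>\<^sub>0 int\<close>.\<close>

type_synonym monomial = "node \<Rightarrow>\<^sub>0 int"

definition eval_laurent :: "(node \<Rightarrow> 'a::field) \<Rightarrow> (monomial \<Rightarrow>\<^sub>0 int) \<Rightarrow> 'a" where
  "eval_laurent x P =
     (\<Sum>m \<in> Poly_Mapping.keys P. of_int (Poly_Mapping.lookup P m) *
        (\<Prod>v \<in> Poly_Mapping.keys m. x v powi Poly_Mapping.lookup m v))"

definition laurent_expansion ::
    "node set \<Rightarrow> (node \<Rightarrow> 'a::field) \<Rightarrow> 'a \<Rightarrow> (monomial \<Rightarrow>\<^sub>0 int)" where
  "laurent_expansion V x y =
     (THE P. (\<forall>m \<in> Poly_Mapping.keys P. Poly_Mapping.keys m \<subseteq> V) \<and> eval_laurent x P = y)"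

definition expansion_monomials ::
    "nat \<Rightarrow> nat set set \<Rightarrow> (node \<Rightarrow> 'a::field) \<Rightarrow> nat \<Rightarrow> nat \<Rightarrow> monomial set" where
  "expansion_monomials N \<Delta> x p q =
     Poly_Mapping.keys (laurent_expansion (nodes \<Delta>) x (edge_variable N \<Delta> x p q))"

definition y_hat :: "nat set set \<Rightarrow> node \<Rightarrow> monomial" where
  "y_hat \<Delta> v = (\<Sum>u \<in> nodes \<Delta>. Poly_Mapping.single u (quiver \<Delta> u v))"

text \<open>The monomial of the 3-edge \<open>T\<close>-path from \<open>i\<close> via \<open>s\<close> and \<open>t\<close> to \<open>j\<close>, whose middle edge is
  traversed backwards from \<open>s\<close> to \<open>t\<close>.\<close>

definition tpath3 :: "nat \<Rightarrow> nat \<Rightarrow> nat \<Rightarrow> nat \<Rightarrow> monomial" where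
  "tpath3 i s t j =
     Poly_Mapping.single (Edge i s) 1 + Poly_Mapping.single (Edge t j) 1
     - Poly_Mapping.single (Edge t s) 1"

text \<open>Here \<open>(a, b) \<in> C\<close> means that \<open>b\<close> covers \<open>a\<close>, and \<open>(a, b) \<in> order_generated A C\<close> means \<open>a \<le> b\<close>.\<close>

definition order_generated :: "'a set \<Rightarrow> 'a rel \<Rightarrow> 'a rel" where
  "order_generated A C = (C \<inter> A \<times> A)\<^sup>* \<inter> A \<times> A"

definition minimal_elements :: "'a set \<Rightarrow> 'a rel \<Rightarrow> 'a set" where
  "minimal_elements A r = {a \<in> A. \<forall>b \<in> A. (b, a) \<in> r \<longrightarrow> b = a}"

definition maximal_elements :: "'a set \<Rightarrow> 'a rel \<Rightarrow> 'a set" where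
  "maximal_elements A r = {a \<in> A. \<forall>b \<in> A. (a, b) \<in> r \<longrightarrow> b = a}"

definition expansion_order ::
    "nat \<Rightarrow> nat set set \<Rightarrow> (node \<Rightarrow> 'a::field) \<Rightarrow> nat \<Rightarrow> nat \<Rightarrow> monomial rel" where
  "expansion_order N \<Delta> x p q =
     order_generated (expansion_monomials N \<Delta> x p q)
       {(m, m'). \<exists>v \<in> mutable_nodes N \<Delta>. m' = y_hat \<Delta> v + m}"

datatype step = Right_Step | Up_Step

fun path_points :: "int \<times> int \<Rightarrow> step list \<Rightarrow> (int \<times> int) set" where
  "path_points (a, b) [] = {(a, b)}"
| "path_points (a, b) (Right_Step # w) = insert (a, b) (path_points (a + 1, b) w)"
| "path_points (a, b) (Up_Step # w) = insert (a, b) (path_points (a, b + 1) w)"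

definition lattice_set :: "nat \<Rightarrow> (int \<times> int) set" where
  "lattice_set n =
     {(a, b). 0 \<le> a \<and> a \<le> int n \<and> 0 \<le> b \<and>
        (\<exists>c \<ge> b. (a, c) \<in> path_points (0, 0) (concat (replicate n [Right_Step, Up_Step, Up_Step])))}"

definition lattice_order :: "nat \<Rightarrow> (int \<times> int) rel" where
  "lattice_order n =
     order_generated (lattice_set n)
       {((a, b), (c, d)). (c = a + 1 \<and> d = b) \<or> (d = b + 1 \<and> c = a)}"

end

theory Submission
  imports Defs
begin

text \<open>The variable of the longest edge is read off from a configuration of affine flags instead of a sequence of flips; its terms
are then matched one by one with lattice points.

\<^item> \<^emph>\<open>The variable is well defined.\<close>  A configuration of vectors \<open>v\<^sub>p\<close> and covectors \<open>f\<^sub>p\<close> of a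
three-dimensional space with \<open>f\<^sub>p(v\<^sub>p) = 0\<close> gives numbers \<open>x\<^sub>p\<^sub>q = f\<^sub>p(v\<^sub>q)\<close> and, for \<open>p\<close>, \<open>q\<close>, \<open>r\<close>
clockwise, \<open>x\<^sub>p\<^sub>q\<^sub>r = det(v\<^sub>p, v\<^sub>q, v\<^sub>r)\<close>.  Cramer's rule for four vectors is exactly the exchange relation of
each of the four mutations of a flip (\<open>flag_function_ptolemaic\<close>).  As a flip turns the quiver of a noncrossing
set of edges into the quiver of the flipped set (\<open>flippable.flip_seed_quiver\<close>), a configuration that
reproduces the initial seed reproduces every seed that flips can reach, provided that no exchange divides by
zero.  It never does: every value is a subtraction-free expression in algebraically independent elements
(\<open>positive_values_nonzero\<close>).  So the variable of the longest edge is \<open>f\<^sub>i(v\<^sub>j)\<close>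
(\<open>edge_variable_eqI\<close>, \<open>longest_edge_reachable\<close>).

\<^item> \<^emph>\<open>The expansion.\<close>  Number the vertices clockwise from the fan vertex \<open>k\<close>, so that \<open>j\<close> is \<open>1\<close> and \<open>i\<close> is
\<open>M = n + 2\<close>, and put \<open>v\<^sub>k = (1, 0, 0)\<close> and \<open>f\<^sub>k = (0, 0, 1)\<close>.  The remaining vectors are then determined by
the initial seed up to three additive constants, each by one linear equation after the previous one
(locale \<open>fan_vectors\<close>).  With \<open>z\<^sub>m = x\<^sub>k\<^sub>m\<close>, \<open>c\<^sub>m = x\<^sub>m\<^sub>k\<close>, \<open>A\<^sub>m\<close> the variable of the \<open>m\<close>-th triangle, and
\<open>r\<^sub>m\<close>, \<open>l\<^sub>m\<close> the variables of the boundary edges from \<open>m\<close> to \<open>m + 1\<close> and to \<open>m - 1\<close>, the result is the sum of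
\<open>z\<^sub>1 c\<^sub>M A\<^sub>m / (z\<^sub>m z\<^sub>m\<^sub>+\<^sub>1) \<cdot> (z\<^sub>s / c\<^sub>s) \<cdot> t\<close> over \<open>m < s \<le> M\<close>, where \<open>t\<close> is \<open>l\<^sub>s / A\<^sub>s\<^sub>-\<^sub>1\<close> or, if \<open>s < M\<close>,
\<open>r\<^sub>s / A\<^sub>s\<close> (\<open>pairing_longest\<close>).

\<^item> \<^emph>\<open>The poset.\<close>  Let \<open>a = M - 1 - m\<close>, and let \<open>b\<close> count the choices of \<open>(s, t)\<close> in the order \<open>l\<^sub>M\<close>, \<open>r\<^sub>M\<^sub>-\<^sub>1\<close>,
\<open>l\<^sub>M\<^sub>-\<^sub>1\<close>, \<open>r\<^sub>M\<^sub>-\<^sub>2\<close>, and so on; then \<open>m < s\<close> reads \<open>b \<le> 2a\<close>, which describes the points below the path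
\<open>(ab\<^sup>2)\<^sup>n\<close>.  Multiplication by \<open>y_hat\<close> of the node \<open>z\<^sub>m\<close> raises \<open>a\<close> by one, and the nodes \<open>A\<^sub>m\<close> and \<open>c\<^sub>m\<close> raise \<open>b\<close> by
one.  Two gradings of the Laurent monomials recover \<open>a\<close> and \<open>b\<close>; they show that the monomials are distinct and
that there are no other covers (\<open>fan_monomial_degrees\<close>, \<open>fan_monomial_cover_iff\<close>).\<close>

section \<open>Laurent expansions in an algebraically independent family\<close>

definition monomial_value :: "('v \<Rightarrow> 'a::field) \<Rightarrow> ('v \<Rightarrow>\<^sub>0 int) \<Rightarrow> 'a" where
  "monomial_value x m = (\<Prod>v \<in> Poly_Mapping.keys m. x v powi Poly_Mapping.lookup m v)"

lemma monomial_value_superset: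
  assumes "finite W" "Poly_Mapping.keys m \<subseteq> W"
  shows "monomial_value x m = (\<Prod>v \<in> W. x v powi Poly_Mapping.lookup m v)"
  unfolding monomial_value_def
  by (rule prod.mono_neutral_left) (use assms in \<open>auto simp: in_keys_iff\<close>)

lemma monomial_value_zero [simp]: "monomial_value x 0 = 1"
  by (simp add: monomial_value_def)

lemma monomial_value_single [simp]: "monomial_value x (Poly_Mapping.single v e) = x v powi e"
  by (simp add: monomial_value_def)

lemma monomial_value_add:
  assumes "\<And>v. v \<in> Poly_Mapping.keys m \<union> Poly_Mapping.keys m' \<Longrightarrow> x v \<noteq> 0"
  shows "monomial_value x (m + m') = monomial_value x m * monomial_value x m'"
proof -
  define W where "W = Poly_Mapping.keys m \<union> Poly_Mapping.keys m'"
  have W: "finite W" "Poly_Mapping.keys (m + m') \<subseteq> W" "Poly_Mapping.keys m \<subseteq> W" "Poly_Mapping.keys m' \<subseteq> W"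
    using Poly_Mapping.keys_add[of m m'] by (auto simp: W_def)
  have "x v \<noteq> 0" if "v \<in> W" for v
    using assms that by (auto simp: W_def)
  then show ?thesis
    by (simp add: monomial_value_superset[OF W(1)] W(2-4) prod.distrib [symmetric] lookup_add
        power_int_add)
qed

lemma monomial_value_uminus: "monomial_value x (- m) = inverse (monomial_value x m)"
  by (simp add: monomial_value_def power_int_minus prod_inversef [symmetric] o_def)

lemma monomial_value_diff:
  assumes "\<And>v. v \<in> Poly_Mapping.keys m \<union> Poly_Mapping.keys m' \<Longrightarrow> x v \<noteq> 0"
  shows "monomial_value x (m - m') = monomial_value x m / monomial_value x m'"
proof -
  have "monomial_value x (m + - m') = monomial_value x m * monomial_value x (- m')"
    by (rule monomial_value_add) (use assms in auto)
  then show ?thesis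
    by (simp add: monomial_value_uminus field_simps)
qed

lemma eval_laurent_alt:
  "eval_laurent x P =
     (\<Sum>m \<in> Poly_Mapping.keys P. of_int (Poly_Mapping.lookup P m) * monomial_value x m)"
  by (simp add: eval_laurent_def monomial_value_def)

lemma eval_laurent_zero [simp]: "eval_laurent x 0 = 0"
  by (simp add: eval_laurent_def)

lemma eval_laurent_single [simp]:
  "eval_laurent x (Poly_Mapping.single m c) = of_int c * monomial_value x m"
  by (simp add: eval_laurent_alt)

lemma eval_laurent_add: "eval_laurent x (P + Q) = eval_laurent x P + eval_laurent x Q"
  unfolding eval_laurent_alt
  by (rule setsum_keys_plus_distrib) (auto simp: algebra_simps)

lemma eval_laurent_diff: "eval_laurent x (P - Q) = eval_laurent x P - eval_laurent x Q"
  using eval_laurent_add[of x "P - Q" Q] by (simp add: algebra_simps)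

lemma eval_laurent_sum: "eval_laurent x (\<Sum>s\<in>S. P s) = (\<Sum>s\<in>S. eval_laurent x (P s))"
  by (induction S rule: infinite_finite_induct) (auto simp: eval_laurent_add)

lemma algebraically_independent_nonzero:
  assumes "algebraically_independent_on V x" "v \<in> V"
  shows "x v \<noteq> 0"
proof
  assume "x v = 0"
  let ?P = "Poly_Mapping.single (Poly_Mapping.single v (1::nat)) (1::rat)"
  have "(\<forall>m \<in> Poly_Mapping.keys ?P. Poly_Mapping.keys m \<subseteq> V) \<longrightarrow>
        (\<Sum>m \<in> Poly_Mapping.keys ?P. of_rat (Poly_Mapping.lookup ?P m) *
           (\<Prod>v \<in> Poly_Mapping.keys m. x v ^ Poly_Mapping.lookup m v)) = 0 \<longrightarrow> ?P = 0"
    using assms(1) unfolding algebraically_independent_on_def by blast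
  then have "?P = 0"
    using \<open>x v = 0\<close> assms(2) by simp
  then have "Poly_Mapping.lookup ?P (Poly_Mapping.single v 1) = 0"
    by (metis lookup_zero)
  then show False
    by simp
qed

text \<open>Algebraic independence only speaks of polynomials, so denominators are cleared first: a bound \<open>B\<close> on the negative
exponents gives a monomial \<open>e\<close> whose product with each monomial of \<open>P\<close> has nonnegative exponents.  Multiplication
by \<open>e\<close> is injective on monomials, so no coefficients get merged.\<close>

lemma eval_laurent_eq_0D:
  fixes x :: "node \<Rightarrow> 'a::field_char_0"
  assumes ind: "algebraically_independent_on V x"
    and V: "\<And>m. m \<in> Poly_Mapping.keys P \<Longrightarrow> Poly_Mapping.keys m \<subseteq> V"
    and eval: "eval_laurent x P = 0"
  shows "P = 0"
proof -
  define W where "W = (\<Union>m \<in> Poly_Mapping.keys P. Poly_Mapping.keys m)"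
  have finW: "finite W" and WV: "W \<subseteq> V"
    using V by (auto simp: W_def)
  have nz: "x v \<noteq> 0" if "v \<in> W" for v
    using algebraically_independent_nonzero[OF ind] WV that by auto
  define E where "E = (\<lambda>(m, v). - Poly_Mapping.lookup m v) ` (Poly_Mapping.keys P \<times> W)"
  obtain B where B: "\<And>e. e \<in> E \<Longrightarrow> e \<le> B"
  proof -
    have "finite E" using finW by (simp add: E_def)
    then show ?thesis using that Max_ge by blast
  qed
  have B: "- Poly_Mapping.lookup m v \<le> B" if "m \<in> Poly_Mapping.keys P" "v \<in> W" for m v
    using that by (intro B) (force simp: E_def)
  \<comment> \<open>If \<open>B\<close> is negative, then every exponent on \<open>W\<close> is at least \<open>- B\<close>, and \<open>e\<close> lowers it without harm.\<close>
  define e where "e = (\<Sum>v\<in>W. Poly_Mapping.single v B)"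
  have lookup_e: "Poly_Mapping.lookup e v = (if v \<in> W then B else 0)" for v
    using finW by (auto simp: e_def lookup_sum lookup_single when_def)
  then have keys_e: "Poly_Mapping.keys e \<subseteq> W"
    by (auto simp: in_keys_iff split: if_splits)
  have keysW: "Poly_Mapping.keys m \<subseteq> W" if "m \<in> Poly_Mapping.keys P" for m
    using that by (auto simp: W_def)
  define f where "f m = Poly_Mapping.map nat (m + e)" for m
  have nonneg: "Poly_Mapping.lookup (m + e) v \<ge> 0" if "m \<in> Poly_Mapping.keys P" for m v
  proof (cases "v \<in> W")
    case True
    then show ?thesis using B[OF that True] by (simp add: lookup_add lookup_e)
  next
    case False
    then have "v \<notin> Poly_Mapping.keys m" using keysW[OF that] by auto
    then show ?thesis using False by (simp add: lookup_add lookup_e in_keys_iff)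
  qed
  have lookup_f: "int (Poly_Mapping.lookup (f m) v) = Poly_Mapping.lookup (m + e) v"
    if "m \<in> Poly_Mapping.keys P" for m v
    using nonneg[OF that, of v] by (auto simp: f_def map.rep_eq when_def)
  have keys_f: "Poly_Mapping.keys (f m) \<subseteq> W" if "m \<in> Poly_Mapping.keys P" for m
  proof
    fix v assume "v \<in> Poly_Mapping.keys (f m)"
    then have "v \<in> Poly_Mapping.keys (m + e)"
      using lookup_f[OF that, of v] by (auto simp: in_keys_iff)
    then show "v \<in> W"
      using Poly_Mapping.keys_add[of m e] keysW[OF that] keys_e by auto
  qed
  have inj: "inj_on f (Poly_Mapping.keys P)"
  proof (rule inj_onI)
    fix m m' assume m: "m \<in> Poly_Mapping.keys P" "m' \<in> Poly_Mapping.keys P" "f m = f m'"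
    have "m + e = m' + e"
      by (rule poly_mapping_eqI) (metis lookup_f m)
    then show "m = m'" by simp
  qed
  have value_f: "(\<Prod>v \<in> Poly_Mapping.keys (f m). x v ^ Poly_Mapping.lookup (f m) v)
      = monomial_value x m * monomial_value x e" if m: "m \<in> Poly_Mapping.keys P" for m
  proof -
    have "(\<Prod>v \<in> Poly_Mapping.keys (f m). x v ^ Poly_Mapping.lookup (f m) v)
        = (\<Prod>v \<in> W. x v ^ Poly_Mapping.lookup (f m) v)"
      by (rule prod.mono_neutral_left) (use finW keys_f[OF m] in \<open>auto simp: in_keys_iff\<close>)
    also have "\<dots> = (\<Prod>v \<in> W. x v powi Poly_Mapping.lookup (m + e) v)"
      by (rule prod.cong) (auto simp flip: lookup_f[OF m])
    also have "\<dots> = monomial_value x (m + e)"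
      by (rule monomial_value_superset [symmetric])
        (use finW Poly_Mapping.keys_add[of m e] keysW[OF m] keys_e in auto)
    also have "\<dots> = monomial_value x m * monomial_value x e"
      by (rule monomial_value_add) (use nz keysW[OF m] keys_e in auto)
    finally show ?thesis .
  qed
  define Q where
    "Q = (\<Sum>m \<in> Poly_Mapping.keys P. Poly_Mapping.single (f m) (of_int (Poly_Mapping.lookup P m) :: rat))"
  have lookup_Q: "Poly_Mapping.lookup Q (f m) = of_int (Poly_Mapping.lookup P m)"
    if m: "m \<in> Poly_Mapping.keys P" for m
  proof -
    have "Poly_Mapping.lookup Q (f m)
        = (\<Sum>m' \<in> Poly_Mapping.keys P. if m' = m then of_int (Poly_Mapping.lookup P m') else 0)"
      unfolding Q_def lookup_sum lookup_single when_def
      by (rule sum.cong) (use inj m in \<open>auto simp: inj_on_def\<close>)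
    then show ?thesis using m by simp
  qed
  have keys_Q: "Poly_Mapping.keys Q = f ` Poly_Mapping.keys P"
  proof
    show "Poly_Mapping.keys Q \<subseteq> f ` Poly_Mapping.keys P"
      unfolding Q_def by (rule order.trans[OF Poly_Mapping.keys_sum]) (auto split: if_splits)
    show "f ` Poly_Mapping.keys P \<subseteq> Poly_Mapping.keys Q"
      by (auto simp: in_keys_iff lookup_Q)
  qed
  have "(\<Sum>q \<in> Poly_Mapping.keys Q. of_rat (Poly_Mapping.lookup Q q) *
           (\<Prod>v \<in> Poly_Mapping.keys q. x v ^ Poly_Mapping.lookup q v))
      = (\<Sum>m \<in> Poly_Mapping.keys P. of_int (Poly_Mapping.lookup P m) *
           (monomial_value x m * monomial_value x e))"
    unfolding keys_Q by (subst sum.reindex[OF inj]) (auto simp: lookup_Q value_f)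
  also have "\<dots> = eval_laurent x P * monomial_value x e"
    by (simp add: eval_laurent_alt sum_distrib_right mult.assoc)
  finally have "(\<Sum>q \<in> Poly_Mapping.keys Q. of_rat (Poly_Mapping.lookup Q q) *
           (\<Prod>v \<in> Poly_Mapping.keys q. x v ^ Poly_Mapping.lookup q v)) = 0"
    using eval by simp
  moreover have "\<forall>q \<in> Poly_Mapping.keys Q. Poly_Mapping.keys q \<subseteq> V"
    using keys_f WV by (auto simp: keys_Q)
  ultimately have "Q = 0"
    using ind unfolding algebraically_independent_on_def by blast
  then have "Poly_Mapping.keys P = {}"
    using keys_Q by simp
  then show ?thesis by simp
qed

lemma laurent_expansion_eqI:
  fixes x :: "node \<Rightarrow> 'a::field_char_0"
  assumes ind: "algebraically_independent_on V x"
    and P: "\<And>m. m \<in> Poly_Mapping.keys P \<Longrightarrow> Poly_Mapping.keys m \<subseteq> V" "eval_laurent x P = y"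
  shows "laurent_expansion V x y = P"
  unfolding laurent_expansion_def
proof (rule the_equality)
  fix Q assume Q: "(\<forall>m \<in> Poly_Mapping.keys Q. Poly_Mapping.keys m \<subseteq> V) \<and> eval_laurent x Q = y"
  have "Q - P = 0"
  proof (rule eval_laurent_eq_0D[OF ind])
    show "Poly_Mapping.keys m \<subseteq> V" if "m \<in> Poly_Mapping.keys (Q - P)" for m
      using that Q P(1) keys_diff[of Q P] by auto
    show "eval_laurent x (Q - P) = 0"
      using Q P(2) by (simp add: eval_laurent_diff)
  qed
  then show "Q = P" by simp
qed (use P in auto)

section \<open>Subtraction-free expressions\<close>

text \<open>The values of subtraction-free rational expressions.  All variables of the reachable seeds lie in this set, because the
exchange relations only add, multiply and divide.\<close>

inductive_set positive_values :: "node set \<Rightarrow> (node \<Rightarrow> 'a::field) \<Rightarrow> 'a set"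
  for V x where
  variable: "v \<in> V \<Longrightarrow> x v \<in> positive_values V x"
| add: "\<lbrakk>a \<in> positive_values V x; b \<in> positive_values V x\<rbrakk> \<Longrightarrow> a + b \<in> positive_values V x"
| mult: "\<lbrakk>a \<in> positive_values V x; b \<in> positive_values V x\<rbrakk> \<Longrightarrow> a * b \<in> positive_values V x"
| divide: "\<lbrakk>a \<in> positive_values V x; b \<in> positive_values V x\<rbrakk> \<Longrightarrow> a / b \<in> positive_values V x"

text \<open>Sums of Laurent monomials over nonempty lists: the numerators and denominators of subtraction-free expressions.  Lists
instead of polynomials with positive coefficients make closure under products a matter of concatenation.\<close>

definition monomial_sums :: "node set \<Rightarrow> (node \<Rightarrow> 'a::field) \<Rightarrow> 'a set" where
  "monomial_sums V x =
     {\<Sum>m\<leftarrow>ms. monomial_value x m | ms. ms \<noteq> [] \<and> (\<forall>m \<in> set ms. Poly_Mapping.keys m \<subseteq> V)}"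

text \<open>Coefficients of such a sum count occurrences in the list, so nothing cancels.\<close>

lemma monomial_sums_nonzero:
  fixes x :: "node \<Rightarrow> 'a::field_char_0"
  assumes ind: "algebraically_independent_on V x" and a: "a \<in> monomial_sums V x"
  shows "a \<noteq> 0"
proof
  assume "a = 0"
  obtain ms where ms: "ms \<noteq> []" "\<forall>m \<in> set ms. Poly_Mapping.keys m \<subseteq> V"
    and a: "a = (\<Sum>m\<leftarrow>ms. monomial_value x m)"
    using a by (auto simp: monomial_sums_def)
  define P where "P ms = (\<Sum>m\<leftarrow>ms. Poly_Mapping.single m (1::int))" for ms :: "monomial list"
  have eval: "eval_laurent x (P ms) = (\<Sum>m\<leftarrow>ms. monomial_value x m)" for ms
    by (induction ms) (auto simp: P_def eval_laurent_add)
  have lookup: "Poly_Mapping.lookup (P ms) m = int (count_list ms m)" for ms m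
    by (induction ms) (auto simp: P_def lookup_add lookup_single)
  have "P ms = 0"
  proof (rule eval_laurent_eq_0D[OF ind])
    fix m assume "m \<in> Poly_Mapping.keys (P ms)"
    then have "m \<in> set ms"
      by (auto simp: in_keys_iff lookup count_list_0_iff)
    then show "Poly_Mapping.keys m \<subseteq> V" using ms(2) by auto
  qed (use eval \<open>a = 0\<close> a in simp)
  then have "count_list ms (hd ms) = 0"
    using lookup[of ms "hd ms"] by simp
  then show False
    using ms(1) by (simp add: count_list_0_iff)
qed

lemma monomial_sums_add:
  assumes "a \<in> monomial_sums V x" "b \<in> monomial_sums V x"
  shows "a + b \<in> monomial_sums V x"
proof -
  obtain ms ms' where "ms \<noteq> []" "\<forall>m \<in> set ms. Poly_Mapping.keys m \<subseteq> V"
    "a = (\<Sum>m\<leftarrow>ms. monomial_value x m)" "\<forall>m \<in> set ms'. Poly_Mapping.keys m \<subseteq> V"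
    "b = (\<Sum>m\<leftarrow>ms'. monomial_value x m)"
    using assms by (auto simp: monomial_sums_def)
  then show ?thesis
    unfolding monomial_sums_def by (intro CollectI exI[of _ "ms @ ms'"]) auto
qed

lemma monomial_sums_mult:
  assumes nz: "\<And>v. v \<in> V \<Longrightarrow> x v \<noteq> 0"
    and "a \<in> monomial_sums V x" "b \<in> monomial_sums V x"
  shows "a * b \<in> monomial_sums V x"
proof -
  obtain ms ms' where ms: "ms \<noteq> []" "\<forall>m \<in> set ms. Poly_Mapping.keys m \<subseteq> V"
    "a = (\<Sum>m\<leftarrow>ms. monomial_value x m)"
    and ms': "ms' \<noteq> []" "\<forall>m \<in> set ms'. Poly_Mapping.keys m \<subseteq> V"
    "b = (\<Sum>m\<leftarrow>ms'. monomial_value x m)"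
    using assms by (auto simp: monomial_sums_def)
  have single: "(\<Sum>m'\<leftarrow>ms'. monomial_value x (m + m')) = monomial_value x m * b"
    if "Poly_Mapping.keys m \<subseteq> V" for m
  proof -
    have "(\<Sum>m'\<leftarrow>ms'. monomial_value x (m + m')) = (\<Sum>m'\<leftarrow>ms'. monomial_value x m * monomial_value x m')"
      by (intro arg_cong[where f = sum_list] map_cong refl monomial_value_add)
        (use nz that ms'(2) in blast)
    then show ?thesis by (simp add: ms'(3) sum_list_const_mult)
  qed
  define ps where "ps = concat (map (\<lambda>m. map (\<lambda>m'. m + m') ms') ms)"
  have "(\<Sum>m\<leftarrow>concat (map (\<lambda>m. map (\<lambda>m'. m + m') ms') ns). monomial_value x m)
      = (\<Sum>m\<leftarrow>ns. monomial_value x m) * b"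
    if "\<forall>m \<in> set ns. Poly_Mapping.keys m \<subseteq> V" for ns
    using that by (induction ns) (auto simp: o_def single algebra_simps)
  then have "(\<Sum>m\<leftarrow>ps. monomial_value x m) = a * b"
    using ms by (simp add: ps_def)
  moreover have "ps \<noteq> []"
    using ms(1) ms'(1) by (cases ms; cases ms') (auto simp: ps_def)
  moreover have "\<forall>m \<in> set ps. Poly_Mapping.keys m \<subseteq> V"
  proof
    fix p assume "p \<in> set ps"
    then obtain m m' where "p = m + m'" "m \<in> set ms" "m' \<in> set ms'"
      by (auto simp: ps_def)
    then show "Poly_Mapping.keys p \<subseteq> V"
      using Poly_Mapping.keys_add[of m m'] ms(2) ms'(2) by blast
  qed
  ultimately show ?thesis
    unfolding monomial_sums_def by (intro CollectI exI[of _ ps]) simp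
qed

text \<open>Every subtraction-free expression is a quotient of two sums of Laurent monomials, neither of which vanishes.\<close>

lemma positive_values_nonzero:
  fixes x :: "node \<Rightarrow> 'a::field_char_0"
  assumes ind: "algebraically_independent_on V x" and a: "a \<in> positive_values V x"
  shows "a \<noteq> 0"
proof -
  let ?S = "monomial_sums V x"
  have nz: "c \<noteq> 0" if "c \<in> ?S" for c
    using monomial_sums_nonzero[OF ind that] .
  have mult: "c * d \<in> ?S" if "c \<in> ?S" "d \<in> ?S" for c d
    using monomial_sums_mult[OF algebraically_independent_nonzero[OF ind] that] .
  have add: "c + d \<in> ?S" if "c \<in> ?S" "d \<in> ?S" for c d
    using monomial_sums_add[OF that] .
  have one: "1 \<in> ?S"
    unfolding monomial_sums_def by (intro CollectI exI[of _ "[0]"]) simp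
  from a have "\<exists>p \<in> ?S. \<exists>q \<in> ?S. a = p / q"
  proof induction
    case (variable v)
    then have "x v \<in> ?S"
      unfolding monomial_sums_def by (intro CollectI exI[of _ "[Poly_Mapping.single v 1]"]) simp
    then show ?case using one by force
  next
    case (add a b)
    then obtain p q p' q' where "p \<in> ?S" "q \<in> ?S" "a = p / q" "p' \<in> ?S" "q' \<in> ?S" "b = p' / q'"
      by blast
    then show ?case
      by (intro bexI[of _ "p * q' + p' * q"] bexI[of _ "q * q'"])
        (auto simp: nz add_frac_eq intro!: mult \<open>\<And>c d. c \<in> ?S \<Longrightarrow> d \<in> ?S \<Longrightarrow> c + d \<in> ?S\<close>)
  next
    case (mult a b)
    then obtain p q p' q' where "p \<in> ?S" "q \<in> ?S" "a = p / q" "p' \<in> ?S" "q' \<in> ?S" "b = p' / q'"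
      by blast
    then show ?case
      by (intro bexI[of _ "p * p'"] bexI[of _ "q * q'"])
        (auto simp: nz intro!: \<open>\<And>c d. c \<in> ?S \<Longrightarrow> d \<in> ?S \<Longrightarrow> c * d \<in> ?S\<close>)
  next
    case (divide a b)
    then obtain p q p' q' where "p \<in> ?S" "q \<in> ?S" "a = p / q" "p' \<in> ?S" "q' \<in> ?S" "b = p' / q'"
      by blast
    then show ?case
      by (intro bexI[of _ "p * q'"] bexI[of _ "q * p'"])
        (auto simp: nz intro!: \<open>\<And>c d. c \<in> ?S \<Longrightarrow> d \<in> ?S \<Longrightarrow> c * d \<in> ?S\<close>)
  qed
  then show ?thesis using nz by auto
qed

section \<open>Cyclic order and noncrossing sets of edges\<close>

text \<open>The chords \<open>ac\<close> and \<open>bd\<close> cross: \<open>b\<close> and \<open>d\<close> lie strictly on different sides of \<open>ac\<close>.\<close>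

definition separates :: "nat \<Rightarrow> nat \<Rightarrow> nat \<Rightarrow> nat \<Rightarrow> bool" where
  "separates a c b d \<longleftrightarrow>
     (clockwise a b c \<and> clockwise a c d) \<or> (clockwise a d c \<and> clockwise a c b)"

definition noncrossing :: "nat set set \<Rightarrow> bool" where
  "noncrossing \<Delta> \<longleftrightarrow>
     (\<forall>a c b d. {a, c} \<in> \<Delta> \<longrightarrow> {b, d} \<in> \<Delta> \<longrightarrow> \<not> separates a c b d)"

lemma clockwise_rotate: "clockwise p t b \<longleftrightarrow> clockwise t b p"
  by (auto simp: clockwise_def)

lemma clockwise_distinct: "clockwise p t b \<Longrightarrow> p \<noteq> t \<and> t \<noteq> b \<and> b \<noteq> p"
  by (auto simp: clockwise_def)

lemma clockwise_total: "p \<noteq> t \<Longrightarrow> t \<noteq> b \<Longrightarrow> b \<noteq> p \<Longrightarrow> clockwise p t b \<or> clockwise p b t"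
  by (auto simp: clockwise_def)

lemma clockwise_antisym: "clockwise p t b \<Longrightarrow> \<not> clockwise p b t"
  by (auto simp: clockwise_def)

lemma clockwise_trans: "clockwise p t b \<Longrightarrow> clockwise p b c \<Longrightarrow> clockwise p t c"
  unfolding clockwise_def by (elim disjE conjE; simp)

text \<open>Two consecutive triangles of a fan with apex \<open>a\<close> determine the cyclic order of all four vertices.\<close>

lemma clockwise_quadrilateral:
  assumes "clockwise a b c" "clockwise a c d"
  shows "clockwise a b d" "clockwise b c d" "clockwise b d a" "clockwise c d b" "clockwise d b c"
    "clockwise d a b" "clockwise b c a" "clockwise c a b" "clockwise c d a" "clockwise d a c"
proof -
  show abd: "clockwise a b d" using clockwise_trans[OF assms] .
  show "clockwise b d a" "clockwise d a b" using abd clockwise_rotate by blast+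
  show "clockwise b c a" "clockwise c a b" using assms(1) clockwise_rotate by blast+
  show cda: "clockwise c d a" "clockwise d a c" using assms(2) clockwise_rotate by blast+
  have "clockwise c a b" using assms(1) clockwise_rotate by blast
  then show "clockwise c d b" using cda(1) clockwise_trans by blast
  then show "clockwise d b c" "clockwise b c d" using clockwise_rotate by blast+
qed

lemma separates_swap:
  shows "separates a c b d \<longleftrightarrow> separates c a b d" "separates a c b d \<longleftrightarrow> separates a c d b"
proof -
  show "separates a c b d \<longleftrightarrow> separates c a b d"
    using clockwise_rotate[of c a d] clockwise_rotate[of c a b] clockwise_rotate[of c d a]
      clockwise_rotate[of d a c] clockwise_rotate[of c b a] clockwise_rotate[of b a c]
    unfolding separates_def by argo
qed (auto simp: separates_def)

lemma separates_symD:
  assumes "separates a c b d"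
  shows "separates b d a c"
proof -
  have *: "separates b d a c" if "clockwise a b c" "clockwise a c d" for b d
    using clockwise_quadrilateral[OF that] by (simp add: separates_def)
  from assms consider "clockwise a b c" "clockwise a c d" | "clockwise a d c" "clockwise a c b"
    unfolding separates_def by blast
  then show ?thesis
    by cases (use *[of b d] *[of d b] separates_swap(1)[of d b] in \<open>simp_all\<close>)
qed

lemma separates_sym: "separates a c b d \<longleftrightarrow> separates b d a c"
  using separates_symD by blast

lemma separates_same_side_aux:
  assumes "clockwise k i l" "clockwise k j l" "i \<noteq> j"
  shows "separates i k j l \<or> separates i l j k"
proof -
  consider "clockwise k i j" | "clockwise k j i"
    using clockwise_total[of k i j] clockwise_distinct assms by blast
  then show ?thesis
  proof cases
    case 1
    then show ?thesis
      using clockwise_quadrilateral[OF 1 assms(2)] by (simp add: separates_def)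
  next
    case 2
    then show ?thesis
      using clockwise_quadrilateral[OF 2 assms(1)] by (simp add: separates_def)
  qed
qed

text \<open>If \<open>i\<close> and \<open>j\<close> lie on the same side of \<open>kl\<close>, then the triangles over \<open>kl\<close> with apex \<open>i\<close> and \<open>j\<close> cross each other.  This
is why a diagonal of a noncrossing set has at most one triangle on each side.\<close>

lemma separates_same_side:
  assumes "distinct [i, j, k, l]"
  shows "separates k l i j \<or> separates i k j l \<or> separates i l j k"
proof -
  have "clockwise k i l \<or> clockwise l i k" "clockwise k j l \<or> clockwise l j k"
    using clockwise_total[of k i l] clockwise_total[of k j l] assms
      clockwise_rotate[of l i k] clockwise_rotate[of l j k] clockwise_rotate[of i k l] clockwise_rotate[of j k l]
    by auto
  then show ?thesis
    using separates_same_side_aux[of k i l j] separates_same_side_aux[of l i k j] assms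
      clockwise_rotate[of l i k] clockwise_rotate[of l j k] clockwise_rotate[of i k l] clockwise_rotate[of j k l]
    unfolding separates_def[of k l] by auto
qed

lemma separates_side_of_diagonal:
  assumes "separates k l i j" "m \<noteq> k" "m \<noteq> l"
  shows "separates i m k l \<or> separates j m k l"
proof -
  have "clockwise k m l \<or> clockwise k l m"
    using clockwise_total[of k m l] clockwise_distinct assms unfolding separates_def by blast
  then have "separates k l i m \<or> separates k l j m"
    using assms(1) unfolding separates_def by auto
  then show ?thesis using separates_symD by blast
qed

lemma separates_quadrilateral_aux:
  assumes "clockwise k i l" "clockwise k l j" "clockwise i u j" "clockwise i j v"
  shows "separates u v i k \<or> separates u v i l \<or> separates u v j k \<or> separates u v j l
    \<or> u = l \<and> v = k"
proof -
  note kilj = clockwise_quadrilateral[OF assms(1,2)] and iujv = clockwise_quadrilateral[OF assms(3,4)]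
  have "u \<noteq> i" "u \<noteq> j" "v \<noteq> i" "v \<noteq> j" "k \<noteq> i" "k \<noteq> j" "l \<noteq> i" "l \<noteq> j"
    using clockwise_distinct[OF assms(1)] clockwise_distinct[OF assms(2)] clockwise_distinct[OF assms(3)]
      clockwise_distinct[OF assms(4)] by auto
  then have "clockwise i u l \<or> clockwise i l u \<or> u = l" "clockwise j v k \<or> clockwise j k v \<or> v = k"
    using clockwise_total[of i u l] clockwise_total[of j v k] by blast+
  then consider "clockwise i u l" | "clockwise i l u" | "u = l" "clockwise j v k"
    | "u = l" "clockwise j k v" | "u = l" "v = k"
    by blast
  then show ?thesis
  proof cases
    case 1
    have "clockwise i l v" using clockwise_trans[of i l j v] kilj assms by blast
    then have "separates i l u v" using 1 by (simp add: separates_def)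
    then show ?thesis using separates_symD by blast
  next
    case 2
    have "clockwise j i l" "clockwise j l u"
      using clockwise_quadrilateral[of i l u j] 2 assms(3) by blast+
    then have "clockwise j v l" "clockwise j l u"
      using clockwise_trans[of j v i l] iujv by blast+
    then have "separates j l u v" by (simp add: separates_def)
    then show ?thesis using separates_symD by blast
  next
    case 3
    then have "clockwise j k u" using kilj by blast
    then have "separates j k v u" using 3 by (simp add: separates_def)
    then show ?thesis using separates_symD[of j k v u] separates_swap(1)[of v u] by blast
  next
    case 4
    have "clockwise j v i" using iujv by blast
    then have "clockwise i k v" using clockwise_quadrilateral[of j k v i] 4 by blast
    then have "separates i k u v" using assms 4 kilj by (simp add: separates_def)
    then show ?thesis using separates_symD by blast
  qed simp
qed

lemma separates_cases:
  assumes "separates k l i j"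
  shows "clockwise k i l \<and> clockwise k l j \<or> clockwise l i k \<and> clockwise l k j"
  using assms clockwise_rotate[of l i k] clockwise_rotate[of i k l]
    clockwise_rotate[of k j l] clockwise_rotate[of j l k]
  unfolding separates_def by argo

text \<open>A chord that crosses the new diagonal \<open>ij\<close> of the quadrilateral \<open>ikjl\<close> leaves the quadrilateral through a side, unless
it is the old diagonal.  Hence flips preserve noncrossing sets.\<close>

lemma separates_quadrilateral:
  assumes "separates k l i j" "separates i j u v"
  shows "separates u v i k \<or> separates u v i l \<or> separates u v j k \<or> separates u v j l
    \<or> {u, v} = {k, l}"
proof -
  have "clockwise i u j \<and> clockwise i j v \<or> clockwise i v j \<and> clockwise i j u"
    using assms(2) unfolding separates_def by blast
  then show ?thesis
    using separates_quadrilateral_aux[of k i l j u v] separates_quadrilateral_aux[of l i k j u v]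
      separates_quadrilateral_aux[of k i l j v u] separates_quadrilateral_aux[of l i k j v u]
      separates_swap(1)[of u v] separates_cases[OF assms(1)] insert_commute[of u v] insert_commute[of k l]
    by metis
qed

lemma noncrossingD: "noncrossing \<Delta> \<Longrightarrow> {a, c} \<in> \<Delta> \<Longrightarrow> {b, d} \<in> \<Delta> \<Longrightarrow> \<not> separates a c b d"
  unfolding noncrossing_def by blast

lemma mem_triangles:
  "T \<in> triangles \<Delta> \<longleftrightarrow> (\<exists>p q r. T = {p, q, r} \<and> p \<noteq> q \<and> q \<noteq> r \<and> p \<noteq> r \<and>
     {p, q} \<in> \<Delta> \<and> {q, r} \<in> \<Delta> \<and> {p, r} \<in> \<Delta>)"
proof
  assume "T \<in> triangles \<Delta>"
  then have T: "card T = 3" "\<forall>p\<in>T. \<forall>q\<in>T. p \<noteq> q \<longrightarrow> {p, q} \<in> \<Delta>"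
    by (auto simp: triangles_def)
  then obtain p q r where "T = {p, q, r}" "p \<noteq> q" "q \<noteq> r" "p \<noteq> r"
    by (metis card_3_iff)
  then show "\<exists>p q r. T = {p, q, r} \<and> p \<noteq> q \<and> q \<noteq> r \<and> p \<noteq> r \<and>
     {p, q} \<in> \<Delta> \<and> {q, r} \<in> \<Delta> \<and> {p, r} \<in> \<Delta>"
    using T(2) by blast
qed (auto simp: triangles_def insert_commute)

lemma triangle_iff:
  "{p, q, r} \<in> triangles \<Delta> \<longleftrightarrow> p \<noteq> q \<and> q \<noteq> r \<and> p \<noteq> r \<and> {p, q} \<in> \<Delta> \<and> {q, r} \<in> \<Delta> \<and> {p, r} \<in> \<Delta>"
proof -
  have "card {p, q, r} = 3 \<longleftrightarrow> p \<noteq> q \<and> q \<noteq> r \<and> p \<noteq> r"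
    by (auto simp: card_insert_if)
  then show ?thesis
    unfolding triangles_def by (auto simp: insert_commute)
qed

lemma triangle_third:
  assumes "T \<in> triangles \<Delta>" "k \<in> T" "l \<in> T" "k \<noteq> l"
  obtains m where "T = {m, k, l}"
proof -
  have "card T = 3" using assms(1) by (simp add: triangles_def)
  then have "card (T - {k, l}) = 1"
    using assms by (subst card_Diff_subset) auto
  then obtain m where "T - {k, l} = {m}" by (auto simp: card_1_singleton_iff)
  then have "T = {m, k, l}" using assms by blast
  then show ?thesis by (rule that)
qed

text \<open>The situation of a flip of \<open>kl\<close> to \<open>ij\<close>.  Noncrossing is all that is kept of a triangulation: it already forces
the triangles at \<open>kl\<close> to be the two given ones.\<close>

locale flippable =
  fixes \<Delta> :: "nat set set" and i j k l :: nat
  assumes noncrossing: "noncrossing \<Delta>"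
    and ikl: "{i, k, l} \<in> triangles \<Delta>" and jkl: "{j, k, l} \<in> triangles \<Delta>"
    and ij: "i \<noteq> j"
begin

lemma dist: "distinct [i, j, k, l]"
  using ikl jkl ij by (auto simp: triangle_iff)

lemma edges: "{i, k} \<in> \<Delta>" "{i, l} \<in> \<Delta>" "{j, k} \<in> \<Delta>" "{j, l} \<in> \<Delta>" "{k, l} \<in> \<Delta>"
  using ikl jkl by (auto simp: triangle_iff)

lemma opposite_sides: "separates k l i j"
  using separates_same_side[OF dist] edges noncrossing unfolding noncrossing_def by blast

lemma new_diagonal: "{i, j} \<notin> \<Delta>"
  using opposite_sides edges noncrossing unfolding noncrossing_def by blast

lemma triangle_at_diagonal:
  assumes "T \<in> triangles \<Delta>" "k \<in> T" "l \<in> T"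
  shows "T = {i, k, l} \<or> T = {j, k, l}"
proof -
  obtain m where m: "T = {m, k, l}"
    using triangle_third[OF assms] dist by auto
  then have "m \<noteq> k" "m \<noteq> l" "{m, k} \<in> \<Delta>" "{m, l} \<in> \<Delta>"
    using assms(1) by (auto simp: triangle_iff)
  moreover have "m = i \<or> m = j"
  proof (rule ccontr)
    assume "\<not> (m = i \<or> m = j)"
    then have "distinct [m, i, k, l]" "distinct [m, j, k, l]"
      using dist \<open>m \<noteq> k\<close> \<open>m \<noteq> l\<close> by auto
    then have "separates k l m i" "separates k l m j"
      using separates_same_side[of m i k l] separates_same_side[of m j k l] calculation edges noncrossing
      unfolding noncrossing_def by blast+
    then show False
      using opposite_sides clockwise_antisym[of k m l] clockwise_antisym[of k i l] clockwise_antisym[of k j l]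
      unfolding separates_def by argo
  qed
  ultimately show ?thesis using m by blast
qed

lemma flip_iff: "{p, q} \<in> flip_triangulation i j k l \<Delta> \<longleftrightarrow>
    {p, q} = {i, j} \<or> {p, q} \<in> \<Delta> \<and> {p, q} \<noteq> {k, l}"
  by (auto simp: flip_triangulation_def)

lemma noncrossing_flip: "noncrossing (flip_triangulation i j k l \<Delta>)"
proof -
  have old: "\<not> separates i j u v" if uv: "{u, v} \<in> \<Delta>" "{u, v} \<noteq> {k, l}" for u v
    using separates_quadrilateral[OF opposite_sides, of u v] edges noncrossing uv
    unfolding noncrossing_def by blast
  have swap: "separates p q u v \<longleftrightarrow> separates i j u v" if "{p, q} = {i, j}" for p q u v
    using that separates_swap by (auto simp: doubleton_eq_iff)
  have self: "\<not> separates i j u v" if "{u, v} = {i, j}" for u v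
    using that clockwise_distinct unfolding separates_def doubleton_eq_iff by blast
  show ?thesis
    unfolding noncrossing_def flip_iff
  proof (intro allI impI)
    fix a c b d
    assume ac: "{a, c} = {i, j} \<or> {a, c} \<in> \<Delta> \<and> {a, c} \<noteq> {k, l}"
      and bd: "{b, d} = {i, j} \<or> {b, d} \<in> \<Delta> \<and> {b, d} \<noteq> {k, l}"
    show "\<not> separates a c b d"
    proof (cases "{a, c} = {i, j}")
      case True
      then show ?thesis using swap[OF True, of b d] old[of b d] self[of b d] bd by blast
    next
      case False
      show ?thesis
      proof (cases "{b, d} = {i, j}")
        case True
        then show ?thesis using swap[OF True, of a c] separates_sym[of a c b d] old[of a c] ac False by blast
      next
        case False
        then have "{a, c} \<in> \<Delta>" "{b, d} \<in> \<Delta>" using ac bd \<open>{a, c} \<noteq> {i, j}\<close> by blast+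
        then show ?thesis by (rule noncrossingD[OF noncrossing])
      qed
    qed
  qed
qed

text \<open>A triangle with sides \<open>im\<close> and \<open>jm\<close> has \<open>m = k\<close> or \<open>m = l\<close>, as one of these two sides would cross \<open>kl\<close> otherwise; and the
only triangles lost are the two at \<open>kl\<close>.\<close>

lemma triangles_flip:
  "triangles (flip_triangulation i j k l \<Delta>) =
     (triangles \<Delta> - {{i, k, l}, {j, k, l}}) \<union> {{i, j, k}, {i, j, l}}" (is "?L = ?R")
proof
  show "?R \<subseteq> ?L"
  proof
    fix T assume "T \<in> ?R"
    then consider "T = {i, j, k}" | "T = {i, j, l}"
      | "T \<in> triangles \<Delta>" "T \<noteq> {i, k, l}" "T \<noteq> {j, k, l}" by auto
    then show "T \<in> ?L"
    proof cases
      case 3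
      then have "\<not> (k \<in> T \<and> l \<in> T)" using triangle_at_diagonal by blast
      then show ?thesis
        using 3(1) by (auto simp: triangles_def flip_iff doubleton_eq_iff)
    qed (use dist edges in \<open>auto simp: triangle_iff flip_iff doubleton_eq_iff insert_commute\<close>)
  qed
  show "?L \<subseteq> ?R"
  proof
    fix T assume T: "T \<in> ?L"
    show "T \<in> ?R"
    proof (cases "i \<in> T \<and> j \<in> T")
      case True
      then obtain m where m: "T = {m, i, j}" using triangle_third[OF T] ij by auto
      then have "m \<noteq> i" "m \<noteq> j" "{i, m} \<in> \<Delta>" "{j, m} \<in> \<Delta>"
        using T dist by (auto simp: triangle_iff flip_iff doubleton_eq_iff insert_commute)
      then have "m = k \<or> m = l"
        using separates_side_of_diagonal[OF opposite_sides, of m] edges(5) noncrossingD[OF noncrossing]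
        by blast
      then show ?thesis using m by (auto simp: insert_commute)
    next
      case False
      then have "{p, q} \<noteq> {i, j}" if "p \<in> T" "q \<in> T" for p q
        using that by (auto simp: doubleton_eq_iff)
      then have pq: "{p, q} \<in> \<Delta>" "{p, q} \<noteq> {k, l}" if "p \<in> T" "q \<in> T" "p \<noteq> q" for p q
      proof -
        have "{p, q} \<in> flip_triangulation i j k l \<Delta>"
          using T that by (simp add: triangles_def)
        then show "{p, q} \<in> \<Delta>" "{p, q} \<noteq> {k, l}"
          using \<open>\<And>p q. p \<in> T \<Longrightarrow> q \<in> T \<Longrightarrow> {p, q} \<noteq> {i, j}\<close>[OF that(1,2)]
          unfolding flip_iff by blast+
      qed
      then have "T \<in> triangles \<Delta>" using T by (auto simp: triangles_def)
      moreover have "T \<noteq> {i, k, l}" "T \<noteq> {j, k, l}"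
        using pq(2)[of k l] dist by auto
      ultimately show ?thesis by blast
    qed
  qed
qed

end

section \<open>Mutation of skew-symmetric matrices\<close>

text \<open>The matrix of a quiver with the single arrow \<open>p \<rightarrow> q\<close>.  Writing quivers as sums of these matrices turns the cancellation
of opposite arrows into linear arithmetic.\<close>

definition arrow_matrix :: "node \<Rightarrow> node \<Rightarrow> node \<Rightarrow> node \<Rightarrow> int" where
  "arrow_matrix p q u v = of_bool (u = p \<and> v = q) - of_bool (u = q \<and> v = p)"

lemma arrow_matrix_swap: "arrow_matrix q p u v = - arrow_matrix p q u v"
  by (simp add: arrow_matrix_def)

lemma arrow_matrix_eq_0 [simp]:
  "u \<noteq> p \<Longrightarrow> u \<noteq> q \<Longrightarrow> arrow_matrix p q u v = 0"
  "v \<noteq> p \<Longrightarrow> v \<noteq> q \<Longrightarrow> arrow_matrix p q u v = 0"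
  "u \<noteq> p \<Longrightarrow> v \<noteq> p \<Longrightarrow> arrow_matrix p q u v = 0"
  "u \<noteq> q \<Longrightarrow> v \<noteq> q \<Longrightarrow> arrow_matrix p q u v = 0"
  unfolding arrow_matrix_def by simp_all

definition skew :: "(node \<Rightarrow> node \<Rightarrow> int) \<Rightarrow> bool" where
  "skew b \<longleftrightarrow> (\<forall>u v. b u v = - b v u)"

lemma skewD: "skew b \<Longrightarrow> b u v = - b v u"
  unfolding skew_def by blast

lemma skew_mutate_quiver:
  assumes "skew b"
  shows "skew (mutate_quiver w b)"
  unfolding skew_def
proof (intro allI)
  fix u v
  show "mutate_quiver w b u v = - mutate_quiver w b v u"
  proof (cases "u = w \<or> v = w")
    case True
    then show ?thesis
      using skewD[OF assms, of u v] unfolding mutate_quiver_def by presburger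
  next
    case False
    have "b w u = - b u w" "b v w = - b w v" "b v u = - b u v"
      using skewD[OF assms] by blast+
    then show ?thesis
      using False unfolding mutate_quiver_def by (simp only: if_False) simp
  qed
qed

lemma mutate_quiver_uminus: "mutate_quiver w (\<lambda>u v. - b u v) = (\<lambda>u v. - mutate_quiver w b u v)"
  by (auto simp: mutate_quiver_def fun_eq_iff)

lemma exchange_uminus:
  assumes "skew b"
  shows "exchange w (\<lambda>u v. - b u v) x = exchange w b x"
proof -
  have "(\<lambda>u v. - b u v) = (\<lambda>u v. b v u)"
  proof (intro ext)
    show "- b u v = b v u" for u v
      using skewD[OF assms, of v u] by (rule sym)
  qed
  then show ?thesis
    by (simp only: exchange_def add.commute)
qed

text \<open>Every mutation of a flip happens at a node with two incoming and two outgoing arrows, which is what makes the exchange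
relations three-term relations in products of two variables.  The summand \<open>R\<close> collects the arrows that avoid the node.\<close>

lemma mutate_four_arrows:
  assumes dist: "distinct [w, a\<^sub>1, a\<^sub>2, c\<^sub>1, c\<^sub>2]"
    and b: "b = (\<lambda>u v. R u v + arrow_matrix a\<^sub>1 w u v + arrow_matrix a\<^sub>2 w u v
        + arrow_matrix w c\<^sub>1 u v + arrow_matrix w c\<^sub>2 u v)"
    and R: "\<And>u. R u w = 0" "\<And>u. R w u = 0"
  shows "mutate w (b, x) =
     ((\<lambda>u v. R u v + arrow_matrix w a\<^sub>1 u v + arrow_matrix w a\<^sub>2 u v
        + arrow_matrix c\<^sub>1 w u v + arrow_matrix c\<^sub>2 w u v
        + arrow_matrix a\<^sub>1 c\<^sub>1 u v + arrow_matrix a\<^sub>1 c\<^sub>2 u v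
        + arrow_matrix a\<^sub>2 c\<^sub>1 u v + arrow_matrix a\<^sub>2 c\<^sub>2 u v),
      x(w := (x a\<^sub>1 * x a\<^sub>2 + x c\<^sub>1 * x c\<^sub>2) / x w))"
proof -
  have col: "b u w = of_bool (u = a\<^sub>1 \<or> u = a\<^sub>2) - of_bool (u = c\<^sub>1 \<or> u = c\<^sub>2)" for u
    using dist by (auto simp: b R arrow_matrix_def)
  have row: "b w u = of_bool (u = c\<^sub>1 \<or> u = c\<^sub>2) - of_bool (u = a\<^sub>1 \<or> u = a\<^sub>2)" for u
    using dist by (auto simp: b R arrow_matrix_def)
  have "mutate_quiver w b = (\<lambda>u v. R u v + arrow_matrix w a\<^sub>1 u v + arrow_matrix w a\<^sub>2 u v
        + arrow_matrix c\<^sub>1 w u v + arrow_matrix c\<^sub>2 w u v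
        + arrow_matrix a\<^sub>1 c\<^sub>1 u v + arrow_matrix a\<^sub>1 c\<^sub>2 u v
        + arrow_matrix a\<^sub>2 c\<^sub>1 u v + arrow_matrix a\<^sub>2 c\<^sub>2 u v)"
  proof (intro ext)
    fix u v
    show "mutate_quiver w b u v = R u v + arrow_matrix w a\<^sub>1 u v + arrow_matrix w a\<^sub>2 u v
        + arrow_matrix c\<^sub>1 w u v + arrow_matrix c\<^sub>2 w u v
        + arrow_matrix a\<^sub>1 c\<^sub>1 u v + arrow_matrix a\<^sub>1 c\<^sub>2 u v
        + arrow_matrix a\<^sub>2 c\<^sub>1 u v + arrow_matrix a\<^sub>2 c\<^sub>2 u v"
    proof (cases "u = w \<or> v = w")
      case True
      then have "R u v = 0"
        using R by blast
      have other: "arrow_matrix p q u v = 0" if "w \<noteq> p" "w \<noteq> q" for p q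
        using True that by (auto simp: arrow_matrix_def)
      show ?thesis
        using True dist \<open>R u v = 0\<close>
        by (simp add: other mutate_quiver_def b arrow_matrix_swap[of a\<^sub>1 w] arrow_matrix_swap[of a\<^sub>2 w]
            arrow_matrix_swap[of c\<^sub>1 w] arrow_matrix_swap[of c\<^sub>2 w])
    next
      case False
      then have "b u v = R u v"
        by (simp add: b)
      have disj: "(of_bool (z = p \<or> z = q) :: int) = of_bool (z = p) + of_bool (z = q)"
        if "p \<noteq> q" for z p q :: node
        using that by auto
      have max: "max 0 (of_bool P - of_bool Q) = (of_bool P :: int)" if "\<not> (P \<and> Q)" for P Q
        using that by auto
      have "max 0 (b u w) = of_bool (u = a\<^sub>1 \<or> u = a\<^sub>2)"
        "max 0 (b w v) = of_bool (v = c\<^sub>1 \<or> v = c\<^sub>2)"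
        "max 0 (- b u w) = of_bool (u = c\<^sub>1 \<or> u = c\<^sub>2)"
        "max 0 (- b w v) = of_bool (v = a\<^sub>1 \<or> v = a\<^sub>2)"
        unfolding col row minus_diff_eq by (rule max; use dist in auto)+
      then have "mutate_quiver w b u v = R u v
          + (of_bool (u = a\<^sub>1 \<or> u = a\<^sub>2) * of_bool (v = c\<^sub>1 \<or> v = c\<^sub>2)
          - of_bool (u = c\<^sub>1 \<or> u = c\<^sub>2) * of_bool (v = a\<^sub>1 \<or> v = a\<^sub>2))"
        using False \<open>b u v = R u v\<close> by (simp only: mutate_quiver_def if_False)
      also have "\<dots> = R u v + arrow_matrix a\<^sub>1 c\<^sub>1 u v + arrow_matrix a\<^sub>1 c\<^sub>2 u v
        + arrow_matrix a\<^sub>2 c\<^sub>1 u v + arrow_matrix a\<^sub>2 c\<^sub>2 u v"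
      proof -
        have "a\<^sub>1 \<noteq> a\<^sub>2" "c\<^sub>1 \<noteq> c\<^sub>2" using dist by auto
        show ?thesis
          unfolding disj[OF \<open>a\<^sub>1 \<noteq> a\<^sub>2\<close>] disj[OF \<open>c\<^sub>1 \<noteq> c\<^sub>2\<close>] arrow_matrix_def of_bool_conj by algebra
      qed
      finally show ?thesis using False by simp
    qed
  qed
  moreover have "exchange w b x = (x a\<^sub>1 * x a\<^sub>2 + x c\<^sub>1 * x c\<^sub>2) / x w"
  proof -
    have "b u w > 0 \<longleftrightarrow> u \<in> {a\<^sub>1, a\<^sub>2}" "b w u > 0 \<longleftrightarrow> u \<in> {c\<^sub>1, c\<^sub>2}" for u
      unfolding col row using dist by (cases "u = a\<^sub>1"; cases "u = a\<^sub>2"; cases "u = c\<^sub>1"; cases "u = c\<^sub>2"; simp)+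
    then have in_out: "{u. b u w > 0} = {a\<^sub>1, a\<^sub>2}" "{u. b w u > 0} = {c\<^sub>1, c\<^sub>2}"
      by blast+
    have "b a\<^sub>1 w = 1" "b a\<^sub>2 w = 1" "b w c\<^sub>1 = 1" "b w c\<^sub>2 = 1"
      using dist by (auto simp: col row)
    then show ?thesis
      using dist by (simp add: exchange_def in_out)
  qed
  ultimately show ?thesis by (simp add: mutate_def)
qed

text \<open>The nine arrows in a triangle with vertices \<open>p\<close>, \<open>t\<close>, \<open>b\<close> in clockwise order: \<open>T\<close> is its own node, and the other
arguments stand for its directed edges.\<close>

definition triangle_arrows :: "node \<Rightarrow> node \<Rightarrow> node \<Rightarrow> node \<Rightarrow> node \<Rightarrow> node \<Rightarrow> node \<Rightarrow> node \<Rightarrow> node \<Rightarrow> int" where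
  "triangle_arrows T pt pb tb tp bp bt u v =
     arrow_matrix pt T u v + arrow_matrix T pb u v + arrow_matrix pb pt u v +
     arrow_matrix tb T u v + arrow_matrix T tp u v + arrow_matrix tp tb u v +
     arrow_matrix bp T u v + arrow_matrix T bt u v + arrow_matrix bt bp u v"

text \<open>The four mutations of the flip in a quadrilateral with vertices \<open>i\<close>, \<open>k\<close>, \<open>j\<close>, \<open>l\<close> in clockwise order, before the nodes
are renamed.  \<open>R\<close> is the rest of the quiver.  The result is again the sum of \<open>R\<close> and two triangles, where \<open>kl\<close> and
\<open>lk\<close> have become the nodes of the triangles \<open>ijk\<close> and \<open>ijl\<close>, and \<open>T\<^sub>i\<close> and \<open>T\<^sub>j\<close> the nodes of \<open>i \<rightarrow> j\<close> and \<open>j \<rightarrow> i\<close>.\<close>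

lemma mutate_quadrilateral:
  fixes kl lk T\<^sub>i T\<^sub>j ik ki il li jk kj jl lj :: node and x :: "node \<Rightarrow> 'a::field"
  assumes dist: "distinct [kl, lk, T\<^sub>i, T\<^sub>j, ik, ki, il, li, jk, kj, jl, lj]"
    and R: "\<And>u v. u \<in> {kl, lk, T\<^sub>i, T\<^sub>j} \<Longrightarrow> R u v = 0" "\<And>u v. v \<in> {kl, lk, T\<^sub>i, T\<^sub>j} \<Longrightarrow> R u v = 0"
    and b: "b = (\<lambda>u v. R u v + triangle_arrows T\<^sub>i ik il kl ki li lk u v
                             + triangle_arrows T\<^sub>j kj kl jl jk lk lj u v)"
  defines "x\<^sub>1 \<equiv> x(kl := (x ki * x T\<^sub>j + x T\<^sub>i * x kj) / x kl)"
  defines "x\<^sub>2 \<equiv> x\<^sub>1(lk := (x\<^sub>1 T\<^sub>i * x\<^sub>1 lj + x\<^sub>1 li * x\<^sub>1 T\<^sub>j) / x\<^sub>1 lk)"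
  defines "x\<^sub>3 \<equiv> x\<^sub>2(T\<^sub>i := (x\<^sub>2 ik * x\<^sub>2 lk + x\<^sub>2 il * x\<^sub>2 kl) / x\<^sub>2 T\<^sub>i)"
  defines "x\<^sub>4 \<equiv> x\<^sub>3(T\<^sub>j := (x\<^sub>3 jl * x\<^sub>3 kl + x\<^sub>3 jk * x\<^sub>3 lk) / x\<^sub>3 T\<^sub>j)"
  shows "mutate T\<^sub>j (mutate T\<^sub>i (mutate lk (mutate kl (b, x)))) =
     ((\<lambda>u v. R u v + triangle_arrows kl ik T\<^sub>i kj ki T\<^sub>j jk u v
                     + triangle_arrows lk T\<^sub>i il jl T\<^sub>j li lj u v), x\<^sub>4)"
proof -
  have dist': "distinct [lj, jl, kj, jk, li, il, ki, ik, T\<^sub>j, T\<^sub>i, lk, kl]"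
    using dist by (simp only: distinct_rev[of "[kl, lk, T\<^sub>i, T\<^sub>j, ik, ki, il, li, jk, kj, jl, lj]", symmetric]
      rev.simps append.simps)
  \<comment> \<open>The next four definitions give, for each mutation in turn, the part of the quiver that avoids the mutated node.\<close>
  define R1 where "R1 = (\<lambda>u v. R u v
      + arrow_matrix ik T\<^sub>i u v
      + arrow_matrix T\<^sub>i il u v
      + arrow_matrix il ik u v
      + arrow_matrix T\<^sub>i ki u v
      + arrow_matrix li T\<^sub>i u v
      + arrow_matrix T\<^sub>i lk u v
      + arrow_matrix lk li u v
      + arrow_matrix kj T\<^sub>j u v
      + arrow_matrix jl T\<^sub>j u v
      + arrow_matrix T\<^sub>j jk u v
      + arrow_matrix jk jl u v
      + arrow_matrix lk T\<^sub>j u v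
      + arrow_matrix T\<^sub>j lj u v
      + arrow_matrix lj lk u v)"
  define R2 where "R2 = (\<lambda>u v. R u v
      + arrow_matrix ik T\<^sub>i u v
      + arrow_matrix T\<^sub>i il u v
      + arrow_matrix il ik u v
      + arrow_matrix li T\<^sub>i u v
      + arrow_matrix jl T\<^sub>j u v
      + arrow_matrix T\<^sub>j jk u v
      + arrow_matrix jk jl u v
      + arrow_matrix T\<^sub>j lj u v
      + arrow_matrix T\<^sub>i kl u v
      + arrow_matrix kl ki u v
      + arrow_matrix kl T\<^sub>j u v
      + arrow_matrix kj kl u v
      + arrow_matrix ki kj u v
      + arrow_matrix T\<^sub>j T\<^sub>i u v)"
  define R3 where "R3 = (\<lambda>u v. R u v
      + arrow_matrix il ik u v
      + arrow_matrix jl T\<^sub>j u v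
      + arrow_matrix T\<^sub>j jk u v
      + arrow_matrix jk jl u v
      + arrow_matrix kl ki u v
      + arrow_matrix kl T\<^sub>j u v
      + arrow_matrix kj kl u v
      + arrow_matrix ki kj u v
      + arrow_matrix li lk u v
      + arrow_matrix T\<^sub>j lk u v
      + arrow_matrix lk lj u v
      + arrow_matrix lj li u v)"
  define R4 where "R4 = (\<lambda>u v. R u v
      + arrow_matrix jk jl u v
      + arrow_matrix kl ki u v
      + arrow_matrix kj kl u v
      + arrow_matrix ki kj u v
      + arrow_matrix li lk u v
      + arrow_matrix lk lj u v
      + arrow_matrix lj li u v
      + arrow_matrix T\<^sub>i ik u v
      + arrow_matrix il T\<^sub>i u v
      + arrow_matrix kl T\<^sub>i u v
      + arrow_matrix T\<^sub>i lk u v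
      + arrow_matrix ik kl u v
      + arrow_matrix lk il u v
      + arrow_matrix lk kl u v)"

  have start: "b = (\<lambda>u v. R1 u v + arrow_matrix ki kl u v
      + arrow_matrix T\<^sub>j kl u v
      + arrow_matrix kl T\<^sub>i u v
      + arrow_matrix kl kj u v)"
    unfolding b R1_def triangle_arrows_def
  proof (intro ext, goal_cases)
    case (1 u v)
    then show ?case  by linarith
  qed
  have step1: "mutate kl ((\<lambda>u v. R1 u v + arrow_matrix ki kl u v
      + arrow_matrix T\<^sub>j kl u v
      + arrow_matrix kl T\<^sub>i u v
      + arrow_matrix kl kj u v), x) = ((\<lambda>u v. R1 u v + arrow_matrix kl ki u v
      + arrow_matrix kl T\<^sub>j u v
      + arrow_matrix T\<^sub>i kl u v
      + arrow_matrix kj kl u v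
      + arrow_matrix ki T\<^sub>i u v
      + arrow_matrix ki kj u v
      + arrow_matrix T\<^sub>j T\<^sub>i u v
      + arrow_matrix T\<^sub>j kj u v), x\<^sub>1)"
    unfolding x\<^sub>1_def by (rule mutate_four_arrows[OF _ refl]) (use dist dist' in \<open>simp_all add: R1_def R\<close>)
  have link1: "(\<lambda>u v. R1 u v + arrow_matrix kl ki u v
      + arrow_matrix kl T\<^sub>j u v
      + arrow_matrix T\<^sub>i kl u v
      + arrow_matrix kj kl u v
      + arrow_matrix ki T\<^sub>i u v
      + arrow_matrix ki kj u v
      + arrow_matrix T\<^sub>j T\<^sub>i u v
      + arrow_matrix T\<^sub>j kj u v) = (\<lambda>u v. R2 u v + arrow_matrix T\<^sub>i lk u v
      + arrow_matrix lj lk u v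
      + arrow_matrix lk li u v
      + arrow_matrix lk T\<^sub>j u v)"
    unfolding R1_def R2_def
  proof (intro ext, goal_cases)
    case (1 u v)
    then show ?case using arrow_matrix_swap[of ki T\<^sub>i u v] arrow_matrix_swap[of T\<^sub>j kj u v] by linarith
  qed
  have step2: "mutate lk ((\<lambda>u v. R2 u v + arrow_matrix T\<^sub>i lk u v
      + arrow_matrix lj lk u v
      + arrow_matrix lk li u v
      + arrow_matrix lk T\<^sub>j u v), x\<^sub>1) = ((\<lambda>u v. R2 u v + arrow_matrix lk T\<^sub>i u v
      + arrow_matrix lk lj u v
      + arrow_matrix li lk u v
      + arrow_matrix T\<^sub>j lk u v
      + arrow_matrix T\<^sub>i li u v
      + arrow_matrix T\<^sub>i T\<^sub>j u v
      + arrow_matrix lj li u v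
      + arrow_matrix lj T\<^sub>j u v), x\<^sub>2)"
    unfolding x\<^sub>2_def by (rule mutate_four_arrows[OF _ refl]) (use dist dist' in \<open>simp_all add: R2_def R\<close>)
  have link2: "(\<lambda>u v. R2 u v + arrow_matrix lk T\<^sub>i u v
      + arrow_matrix lk lj u v
      + arrow_matrix li lk u v
      + arrow_matrix T\<^sub>j lk u v
      + arrow_matrix T\<^sub>i li u v
      + arrow_matrix T\<^sub>i T\<^sub>j u v
      + arrow_matrix lj li u v
      + arrow_matrix lj T\<^sub>j u v) = (\<lambda>u v. R3 u v + arrow_matrix ik T\<^sub>i u v
      + arrow_matrix lk T\<^sub>i u v
      + arrow_matrix T\<^sub>i il u v
      + arrow_matrix T\<^sub>i kl u v)"
    unfolding R2_def R3_def
  proof (intro ext, goal_cases)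
    case (1 u v)
    then show ?case using arrow_matrix_swap[of T\<^sub>i li u v] arrow_matrix_swap[of lj T\<^sub>j u v] arrow_matrix_swap[of T\<^sub>i T\<^sub>j u v] by linarith
  qed
  have step3: "mutate T\<^sub>i ((\<lambda>u v. R3 u v + arrow_matrix ik T\<^sub>i u v
      + arrow_matrix lk T\<^sub>i u v
      + arrow_matrix T\<^sub>i il u v
      + arrow_matrix T\<^sub>i kl u v), x\<^sub>2) = ((\<lambda>u v. R3 u v + arrow_matrix T\<^sub>i ik u v
      + arrow_matrix T\<^sub>i lk u v
      + arrow_matrix il T\<^sub>i u v
      + arrow_matrix kl T\<^sub>i u v
      + arrow_matrix ik il u v
      + arrow_matrix ik kl u v
      + arrow_matrix lk il u v
      + arrow_matrix lk kl u v), x\<^sub>3)"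
    unfolding x\<^sub>3_def by (rule mutate_four_arrows[OF _ refl]) (use dist dist' in \<open>simp_all add: R3_def R\<close>)
  have link3: "(\<lambda>u v. R3 u v + arrow_matrix T\<^sub>i ik u v
      + arrow_matrix T\<^sub>i lk u v
      + arrow_matrix il T\<^sub>i u v
      + arrow_matrix kl T\<^sub>i u v
      + arrow_matrix ik il u v
      + arrow_matrix ik kl u v
      + arrow_matrix lk il u v
      + arrow_matrix lk kl u v) = (\<lambda>u v. R4 u v + arrow_matrix jl T\<^sub>j u v
      + arrow_matrix kl T\<^sub>j u v
      + arrow_matrix T\<^sub>j jk u v
      + arrow_matrix T\<^sub>j lk u v)"
    unfolding R3_def R4_def
  proof (intro ext, goal_cases)
    case (1 u v)
    then show ?case using arrow_matrix_swap[of ik il u v] by linarith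
  qed
  have step4: "mutate T\<^sub>j ((\<lambda>u v. R4 u v + arrow_matrix jl T\<^sub>j u v
      + arrow_matrix kl T\<^sub>j u v
      + arrow_matrix T\<^sub>j jk u v
      + arrow_matrix T\<^sub>j lk u v), x\<^sub>3) = ((\<lambda>u v. R4 u v + arrow_matrix T\<^sub>j jl u v
      + arrow_matrix T\<^sub>j kl u v
      + arrow_matrix jk T\<^sub>j u v
      + arrow_matrix lk T\<^sub>j u v
      + arrow_matrix jl jk u v
      + arrow_matrix jl lk u v
      + arrow_matrix kl jk u v
      + arrow_matrix kl lk u v), x\<^sub>4)"
    unfolding x\<^sub>4_def by (rule mutate_four_arrows[OF _ refl]) (use dist dist' in \<open>simp_all add: R4_def R\<close>)
  have finish: "(\<lambda>u v. R4 u v + arrow_matrix T\<^sub>j jl u v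
      + arrow_matrix T\<^sub>j kl u v
      + arrow_matrix jk T\<^sub>j u v
      + arrow_matrix lk T\<^sub>j u v
      + arrow_matrix jl jk u v
      + arrow_matrix jl lk u v
      + arrow_matrix kl jk u v
      + arrow_matrix kl lk u v) = (\<lambda>u v. R u v + triangle_arrows kl ik T\<^sub>i kj ki T\<^sub>j jk u v
                     + triangle_arrows lk T\<^sub>i il jl T\<^sub>j li lj u v)"
    unfolding R4_def triangle_arrows_def
  proof (intro ext, goal_cases)
    case (1 u v)
    then show ?case using arrow_matrix_swap[of jl jk u v] arrow_matrix_swap[of kl lk u v] by linarith
  qed
  show ?thesis
    unfolding start step1 link1 step2 link2 step3 link3 step4 finish ..
qed

section \<open>The quiver of a triangulation under a flip\<close>

definition triangle_list :: "nat \<Rightarrow> nat \<Rightarrow> nat \<Rightarrow> (node \<times> node) list" where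
  "triangle_list p t b =
     [(Edge p t, Tri {p, t, b}), (Tri {p, t, b}, Edge p b), (Edge p b, Edge p t),
      (Edge t b, Tri {p, t, b}), (Tri {p, t, b}, Edge t p), (Edge t p, Edge t b),
      (Edge b p, Tri {p, t, b}), (Tri {p, t, b}, Edge b t), (Edge b t, Edge b p)]"

definition arrows_in :: "nat set set \<Rightarrow> (node \<times> node) set" where
  "arrows_in S = (\<Union>{set (triangle_list p t b) | p t b. {p, t, b} \<in> S \<and> clockwise p t b})"

text \<open>The quiver built from a set of triangles.  Only this generality allows triangles to be removed and inserted one at a time.\<close>

definition triangle_quiver :: "nat set set \<Rightarrow> node \<Rightarrow> node \<Rightarrow> int" where
  "triangle_quiver S u v = of_bool ((u, v) \<in> arrows_in S) - of_bool ((v, u) \<in> arrows_in S)"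

lemma triangle_set_rotate:
  fixes p t b :: 'v
  shows "{t, b, p} = {p, t, b}" "{b, p, t} = {p, t, b}"
  by auto

lemma quiver_eq_triangle_quiver: "quiver \<Delta> = triangle_quiver (triangles \<Delta>)"
proof -
  have "arrows \<Delta> = arrows_in (triangles \<Delta>)"
  proof
    have "{(Edge p t, Tri {p, t, b}), (Tri {p, t, b}, Edge p b), (Edge p b, Edge p t)} \<subseteq> set (triangle_list p t b)"
      for p t b
      unfolding triangle_list_def by simp
    then show "arrows \<Delta> \<subseteq> arrows_in (triangles \<Delta>)"
      unfolding arrows_def arrows_in_def by blast
    show "arrows_in (triangles \<Delta>) \<subseteq> arrows \<Delta>"
    proof
      fix e assume "e \<in> arrows_in (triangles \<Delta>)"
      then obtain p t b where ptb: "{p, t, b} \<in> triangles \<Delta>" "clockwise p t b"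
        and e: "e \<in> set (triangle_list p t b)"
        unfolding arrows_in_def by blast
      have "{(Edge p t, Tri {p, t, b}), (Tri {p, t, b}, Edge p b), (Edge p b, Edge p t)} \<subseteq> arrows \<Delta>"
        if "{p, t, b} \<in> triangles \<Delta>" "clockwise p t b" for p t b
        using that unfolding arrows_def by blast
      note * = this[of p t b] this[of t b p] this[of b p t]
      have "clockwise t b p" "clockwise b p t"
        using ptb(2) clockwise_rotate[of p t b] clockwise_rotate[of t b p] by simp_all
      with ptb * e show "e \<in> arrows \<Delta>"
        unfolding triangle_list_def triangle_set_rotate[where p = p and t = t and b = b] by auto
    qed
  qed
  then show ?thesis
    by (intro ext) (simp add: quiver_def triangle_quiver_def)
qed

lemma clockwise_triple:
  assumes "{p, t, b} = {p', t', b'}" "clockwise p t b" "clockwise p' t' b'"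
  shows "(p', t', b') \<in> {(p, t, b), (t, b, p), (b, p, t)}"
proof -
  have neq: "p \<noteq> t" "t \<noteq> b" "b \<noteq> p" "p' \<noteq> t'" "t' \<noteq> b'" "b' \<noteq> p'"
    using assms clockwise_distinct by metis+
  have "p' \<in> {p, t, b}" "t' \<in> {p, t, b}" "b' \<in> {p, t, b}" using assms(1) by auto
  moreover have "\<not> clockwise p b t" "\<not> clockwise b t p" "\<not> clockwise t p b"
    using assms(2) clockwise_antisym clockwise_rotate by metis+
  ultimately show ?thesis using neq assms(3) by (elim insertE emptyE) simp_all
qed

text \<open>The triangle that an arrow comes from; values at pairs of nodes that never occur as arrows are irrelevant.\<close>

fun arrow_triangle :: "node \<times> node \<Rightarrow> nat set" where
  "arrow_triangle (Tri T, _) = T"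
| "arrow_triangle (_, Tri T) = T"
| "arrow_triangle (Edge p t, Edge q b) = {p, t, q, b}"

lemma arrow_triangle:
  assumes "e \<in> set (triangle_list p t b)"
  shows "arrow_triangle e = {p, t, b}"
  using assms unfolding triangle_list_def by auto

lemma arrows_in_insert:
  assumes "clockwise p t b"
  shows "arrows_in (insert {p, t, b} S) = set (triangle_list p t b) \<union> arrows_in S"
proof -
  have "set (triangle_list p' t' b') = set (triangle_list p t b)"
    if "{p, t, b} = {p', t', b'}" "clockwise p' t' b'" for p' t' b'
    using clockwise_triple[OF that(1) assms that(2)] unfolding triangle_list_def
    by (auto simp: triangle_set_rotate[where p = p and t = t and b = b])
  note same = this
  have mem: "e \<in> arrows_in S \<longleftrightarrow>
      (\<exists>p t b. {p, t, b} \<in> S \<and> clockwise p t b \<and> e \<in> set (triangle_list p t b))" for e S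
    unfolding arrows_in_def by blast
  show ?thesis
  proof (intro equalityI subsetI)
    fix e assume "e \<in> arrows_in (insert {p, t, b} S)"
    then obtain p' t' b' where "{p', t', b'} \<in> insert {p, t, b} S" "clockwise p' t' b'"
      and e: "e \<in> set (triangle_list p' t' b')"
      unfolding mem by blast
    then show "e \<in> set (triangle_list p t b) \<union> arrows_in S"
    proof (cases "{p, t, b} = {p', t', b'}")
      case True
      then show ?thesis using same \<open>clockwise p' t' b'\<close> e by blast
    next
      case False
      then have "{p', t', b'} \<in> S" using \<open>{p', t', b'} \<in> insert {p, t, b} S\<close> by (metis insert_iff)
      then have "e \<in> arrows_in S" using \<open>clockwise p' t' b'\<close> e unfolding mem by blast
      then show ?thesis by blast
    qed
  next
    fix e assume "e \<in> set (triangle_list p t b) \<union> arrows_in S"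
    then show "e \<in> arrows_in (insert {p, t, b} S)"
    proof
      assume "e \<in> set (triangle_list p t b)"
      then show ?thesis using assms unfolding mem by blast
    next
      assume "e \<in> arrows_in S"
      then show ?thesis unfolding mem by blast
    qed
  qed
qed

lemma of_bool_mem_distinct:
  "distinct xs \<Longrightarrow> (of_bool (e \<in> set xs) :: int) = (\<Sum>e'\<leftarrow>xs. of_bool (e = e'))"
proof (induction xs)
  case (Cons a xs)
  then show ?case by (cases "e = a") simp_all
qed simp

lemma triangle_quiver_insert:
  assumes cw: "clockwise p t b" and new: "{p, t, b} \<notin> S"
  shows "triangle_quiver (insert {p, t, b} S) u v = triangle_quiver S u v +
     triangle_arrows (Tri {p, t, b}) (Edge p t) (Edge p b) (Edge t b) (Edge t p) (Edge b p) (Edge b t) u v"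
proof -
  let ?L = "triangle_list p t b"
  have disjoint: "set ?L \<inter> arrows_in S = {}"
  proof (rule ccontr)
    assume "\<not> ?thesis"
    then obtain e p' t' b' where "e \<in> set ?L" "{p', t', b'} \<in> S" "e \<in> set (triangle_list p' t' b')"
      unfolding arrows_in_def by blast
    then show False
      using new arrow_triangle by metis
  qed
  have add: "(of_bool (e \<in> A \<union> B) :: int) = of_bool (e \<in> A) + of_bool (e \<in> B)" if "A \<inter> B = {}"
    for e and A B :: "(node \<times> node) set"
    using that by auto
  have "distinct ?L"
    using clockwise_distinct[OF cw] unfolding triangle_list_def by auto
  note list = of_bool_mem_distinct[OF this]
  have "of_bool ((u, v) \<in> set ?L) - of_bool ((v, u) \<in> set ?L) =
     triangle_arrows (Tri {p, t, b}) (Edge p t) (Edge p b) (Edge t b) (Edge t p) (Edge b p) (Edge b t) u v"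
    unfolding list
    unfolding triangle_arrows_def arrow_matrix_def triangle_list_def list.map sum_list.Cons
      sum_list.Nil prod.inject conj_commute[of "v = _" "u = _"]
    by linarith
  then show ?thesis
    unfolding triangle_quiver_def arrows_in_insert[OF cw] add[OF disjoint] by linarith
qed

text \<open>Reflecting the triangle reverses all its arrows.\<close>

lemma triangle_arrows_reverse:
  "triangle_arrows T pb pt bt bp tp tb u v = - triangle_arrows T pt pb tb tp bp bt u v"
  unfolding triangle_arrows_def
  using arrow_matrix_swap[of pb T u v] arrow_matrix_swap[of T pt u v] arrow_matrix_swap[of pt pb u v]
    arrow_matrix_swap[of bt T u v] arrow_matrix_swap[of T bp u v] arrow_matrix_swap[of bp bt u v]
    arrow_matrix_swap[of tp T u v] arrow_matrix_swap[of T tb u v] arrow_matrix_swap[of tb tp u v]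
  by linarith

lemma skew_triangle_quiver: "skew (triangle_quiver S)"
  unfolding skew_def triangle_quiver_def by simp

lemma triangle_quiver_eq_0:
  assumes "\<And>p t b. {p, t, b} \<in> S \<Longrightarrow> u \<notin> fst ` set (triangle_list p t b) \<union> snd ` set (triangle_list p t b)"
  shows "triangle_quiver S u v = 0" "triangle_quiver S v u = 0"
proof -
  have "u \<noteq> fst e" "u \<noteq> snd e" if "e \<in> arrows_in S" for e
    using that assms unfolding arrows_in_def by blast+
  then have "(u, v) \<notin> arrows_in S" "(v, u) \<notin> arrows_in S"
    by force+
  then show "triangle_quiver S u v = 0" "triangle_quiver S v u = 0"
    by (simp_all add: triangle_quiver_def)
qed

lemma triangle_quiver_Edge_eq_0:
  assumes "\<And>T. T \<in> S \<Longrightarrow> \<not> (p \<in> T \<and> q \<in> T)"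
  shows "triangle_quiver S (Edge p q) v = 0" "triangle_quiver S v (Edge p q) = 0"
proof -
  have "Edge p q \<notin> fst ` set (triangle_list p' t' b') \<union> snd ` set (triangle_list p' t' b')"
    if "{p', t', b'} \<in> S" for p' t' b'
    using assms[OF that] unfolding triangle_list_def by simp blast
  then show "triangle_quiver S (Edge p q) v = 0" "triangle_quiver S v (Edge p q) = 0"
    using triangle_quiver_eq_0 by blast+
qed

lemma triangle_quiver_Tri_eq_0:
  assumes "T \<notin> S"
  shows "triangle_quiver S (Tri T) v = 0" "triangle_quiver S v (Tri T) = 0"
proof -
  have "Tri T \<notin> fst ` set (triangle_list p' t' b') \<union> snd ` set (triangle_list p' t' b')"
    if "{p', t', b'} \<in> S" for p' t' b'
    using assms that unfolding triangle_list_def by auto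
  then show "triangle_quiver S (Tri T) v = 0" "triangle_quiver S v (Tri T) = 0"
    using triangle_quiver_eq_0 by blast+
qed

text \<open>Mutation commutes with reversing all arrows.  This reduces a quadrilateral whose vertices \<open>i\<close>, \<open>k\<close>, \<open>j\<close>, \<open>l\<close> are in
counterclockwise order to the clockwise case, without exchanging the order of the mutations.\<close>

definition opposite_seed :: "'a seed \<Rightarrow> 'a seed" where
  "opposite_seed S = (\<lambda>u v. - fst S u v, snd S)"

lemma mutate_opposite:
  assumes "skew (fst S)"
  shows "mutate w (opposite_seed S) = opposite_seed (mutate w S)"
  using assms by (cases S) (simp add: mutate_def opposite_seed_def mutate_quiver_uminus exchange_uminus)

lemma skew_mutate: "skew (fst S) \<Longrightarrow> skew (fst (mutate w S))"
  by (cases S) (simp add: mutate_def skew_mutate_quiver)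

context flippable
begin

abbreviation "ikl \<equiv> {i, k, l}"
abbreviation "jkl \<equiv> {j, k, l}"
abbreviation "ijk \<equiv> {i, j, k}"
abbreviation "ijl \<equiv> {i, j, l}"

abbreviation "\<sigma> \<equiv> flip_relabel i j k l"

text \<open>The part of the quiver away from the two triangles of the quadrilateral.\<close>

definition rest :: "node \<Rightarrow> node \<Rightarrow> int" where
  "rest = triangle_quiver (triangles \<Delta> - {ikl, jkl})"

lemma triangles_distinct: "distinct [ikl, jkl, ijk, ijl]"
  using dist by auto

abbreviation "moved \<equiv> {Edge k l, Edge l k, Tri ikl, Tri jkl, Tri ijk, Tri ijl, Edge i j, Edge j i}"

lemma relabel_simps:
  "\<sigma> (Edge k l) = Tri ijk" "\<sigma> (Edge l k) = Tri ijl" "\<sigma> (Tri ikl) = Edge i j" "\<sigma> (Tri jkl) = Edge j i"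
  "\<sigma> (Tri ijk) = Edge k l" "\<sigma> (Tri ijl) = Edge l k" "\<sigma> (Edge i j) = Tri ikl" "\<sigma> (Edge j i) = Tri jkl"
  "u \<notin> moved \<Longrightarrow> \<sigma> u = u"
proof -
  have neq: "ikl \<noteq> jkl" "ikl \<noteq> ijk" "ikl \<noteq> ijl" "jkl \<noteq> ijk" "jkl \<noteq> ijl" "ijk \<noteq> ijl"
    "i \<noteq> j" "i \<noteq> k" "i \<noteq> l" "j \<noteq> k" "j \<noteq> l" "k \<noteq> l"
    using triangles_distinct dist by simp_all
  show "\<sigma> (Edge k l) = Tri ijk" "\<sigma> (Edge l k) = Tri ijl" "\<sigma> (Tri ikl) = Edge i j" "\<sigma> (Tri jkl) = Edge j i"
    "\<sigma> (Tri ijk) = Edge k l" "\<sigma> (Tri ijl) = Edge l k" "\<sigma> (Edge i j) = Tri ikl" "\<sigma> (Edge j i) = Tri jkl"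
    "u \<notin> moved \<Longrightarrow> \<sigma> u = u"
    by (simp_all only: flip_relabel_def o_apply Transposition.transpose_def node.inject node.distinct neq neq [symmetric]
        simp_thms if_True if_False insert_iff empty_iff de_Morgan_disj)
qed

lemma relabel_moved: "u \<in> moved \<Longrightarrow> \<sigma> u \<in> moved"
  by (elim insertE emptyE) (simp_all only: relabel_simps(1-8) insert_iff simp_thms)

lemma relabel_involution: "\<sigma> (\<sigma> u) = u"
proof (cases "u \<in> moved")
  case True
  then show ?thesis by (elim insertE emptyE) (simp_all only: relabel_simps(1-8))
next
  case False
  then show ?thesis by (simp only: relabel_simps(9) not_False_eq_True)
qed

text \<open>The mutated nodes belong to the two removed triangles only, and the new labels do not occur at all, since \<open>ij\<close> is not yet
an edge.\<close>

lemma rest_eq_0: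
  assumes "u \<in> moved"
  shows "rest u v = 0" "rest v u = 0"
proof -
  let ?S = "triangles \<Delta> - {ikl, jkl}"
  have kl: "\<not> (k \<in> T \<and> l \<in> T)" if "T \<in> ?S" for T
    using that triangle_at_diagonal by blast
  have no_ij: "\<not> (i \<in> T \<and> j \<in> T)" if "T \<in> ?S" for T
    using that new_diagonal ij unfolding triangles_def by blast
  have Edge: "rest (Edge p q) v = 0" "rest v (Edge p q) = 0" if "{p, q} = {k, l} \<or> {p, q} = {i, j}" for p q
  proof -
    have "\<not> (p \<in> T \<and> q \<in> T)" if "T \<in> ?S" for T
      using kl[OF that] no_ij[OF that] \<open>{p, q} = {k, l} \<or> {p, q} = {i, j}\<close>
      by (auto simp only: doubleton_eq_iff)
    then show "rest (Edge p q) v = 0" "rest v (Edge p q) = 0"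
      unfolding rest_def by (rule triangle_quiver_Edge_eq_0; blast)+
  qed
  have Tri: "rest (Tri T) v = 0" "rest v (Tri T) = 0" if "T \<in> {ikl, jkl, ijk, ijl}" for T
  proof -
    have "T \<notin> ?S" using that no_ij by auto
    then show "rest (Tri T) v = 0" "rest v (Tri T) = 0"
      unfolding rest_def by (rule triangle_quiver_Tri_eq_0)+
  qed
  have "\<exists>p q. u = Edge p q \<and> ({p, q} = {k, l} \<or> {p, q} = {i, j}) \<or> (\<exists>T \<in> {ikl, jkl, ijk, ijl}. u = Tri T)"
    using assms by (elim insertE emptyE) auto
  then show "rest u v = 0" "rest v u = 0"
    using Edge Tri by metis+
qed

lemma rest_relabel: "rest (\<sigma> u) (\<sigma> v) = rest u v"
proof -
  show ?thesis
  proof (cases "u \<in> moved \<or> v \<in> moved")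
    case True
    then show ?thesis
      using rest_eq_0(1)[of u] rest_eq_0(2)[of v] rest_eq_0(1)[of "\<sigma> u"] rest_eq_0(2)[of "\<sigma> v"] relabel_moved
      by metis
  next
    case False
    then have "u \<notin> moved" "v \<notin> moved" by (simp_all only: de_Morgan_disj not_False_eq_True)
    then show ?thesis by (simp only: relabel_simps(9) not_False_eq_True)
  qed
qed

lemma arrow_matrix_relabel: "arrow_matrix p q (\<sigma> u) (\<sigma> v) = arrow_matrix (\<sigma> p) (\<sigma> q) u v"
proof -
  have "\<sigma> u = p \<longleftrightarrow> u = \<sigma> p" for u p
    using relabel_involution by metis
  then show ?thesis by (simp only: arrow_matrix_def)
qed

lemma triangles_split:
  "triangles \<Delta> = insert ikl (insert jkl (triangles \<Delta> - {ikl, jkl}))"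
  "triangles (flip_triangulation i j k l \<Delta>) = insert ijk (insert ijl (triangles \<Delta> - {ikl, jkl}))"
  "ikl \<notin> insert jkl (triangles \<Delta> - {ikl, jkl})" "jkl \<notin> triangles \<Delta> - {ikl, jkl}"
  "ijk \<notin> insert ijl (triangles \<Delta> - {ikl, jkl})" "ijl \<notin> triangles \<Delta> - {ikl, jkl}"
proof -
  show "triangles \<Delta> = insert ikl (insert jkl (triangles \<Delta> - {ikl, jkl}))"
    using ikl jkl by blast
  show "triangles (flip_triangulation i j k l \<Delta>) = insert ijk (insert ijl (triangles \<Delta> - {ikl, jkl}))"
    unfolding triangles_flip by blast
  have "ijk \<notin> triangles \<Delta>" "ijl \<notin> triangles \<Delta>"
    using new_diagonal by (simp_all add: triangle_iff)
  then show "ikl \<notin> insert jkl (triangles \<Delta> - {ikl, jkl})" "jkl \<notin> triangles \<Delta> - {ikl, jkl}"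
    "ijk \<notin> insert ijl (triangles \<Delta> - {ikl, jkl})" "ijl \<notin> triangles \<Delta> - {ikl, jkl}"
    using triangles_distinct by simp_all
qed

definition old_part :: "node \<Rightarrow> node \<Rightarrow> int" where
  "old_part u v =
     triangle_arrows (Tri ikl) (Edge i k) (Edge i l) (Edge k l) (Edge k i) (Edge l i) (Edge l k) u v +
     triangle_arrows (Tri jkl) (Edge k j) (Edge k l) (Edge j l) (Edge j k) (Edge l k) (Edge l j) u v"

definition new_part :: "node \<Rightarrow> node \<Rightarrow> int" where
  "new_part u v =
     triangle_arrows (Tri ijk) (Edge i k) (Edge i j) (Edge k j) (Edge k i) (Edge j i) (Edge j k) u v +
     triangle_arrows (Tri ijl) (Edge i j) (Edge i l) (Edge j l) (Edge j i) (Edge l i) (Edge l j) u v"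

lemma quiver_positive:
  assumes "clockwise k l i" "clockwise k j l"
  shows "quiver \<Delta> = (\<lambda>u v. rest u v + old_part u v)"
    "quiver (flip_triangulation i j k l \<Delta>) = (\<lambda>u v. rest u v + new_part u v)"
proof -
  have cw: "clockwise i k l" "clockwise k j l" "clockwise i k j" "clockwise i j l"
    using clockwise_quadrilateral[OF assms(2,1)] assms by blast+
  have sets: "{k, j, l} = jkl" "{i, k, j} = ijk"
    by auto
  note insert = triangle_quiver_insert[OF cw(1)] triangle_quiver_insert[OF cw(2)]
    triangle_quiver_insert[OF cw(3)] triangle_quiver_insert[OF cw(4)]
  note insert = insert[unfolded sets]
  have old: "triangle_quiver (triangles \<Delta>) u v = rest u v + old_part u v" for u v
  proof -
    have "triangle_quiver (triangles \<Delta>) u v = triangle_quiver (insert ikl (insert jkl (triangles \<Delta> - {ikl, jkl}))) u v"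
      by (simp only: triangles_split(1) [symmetric])
    then show ?thesis
      unfolding insert(1)[OF triangles_split(3)] insert(2)[OF triangles_split(4)] rest_def old_part_def
        by linarith
  qed
  have new: "triangle_quiver (triangles (flip_triangulation i j k l \<Delta>)) u v = rest u v + new_part u v" for u v
    unfolding triangles_split(2) insert(3)[OF triangles_split(5)] insert(4)[OF triangles_split(6)] rest_def new_part_def
    by linarith
  show "quiver \<Delta> = (\<lambda>u v. rest u v + old_part u v)"
    "quiver (flip_triangulation i j k l \<Delta>) = (\<lambda>u v. rest u v + new_part u v)"
    unfolding quiver_eq_triangle_quiver by (intro ext, rule old, intro ext, rule new)
qed

lemma quiver_negative:
  assumes "clockwise k i l" "clockwise k l j"
  shows "quiver \<Delta> = (\<lambda>u v. rest u v - old_part u v)"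
    "quiver (flip_triangulation i j k l \<Delta>) = (\<lambda>u v. rest u v - new_part u v)"
proof -
  have cw: "clockwise i l k" "clockwise k l j" "clockwise i j k" "clockwise i l j"
    using clockwise_quadrilateral[OF assms(1,2)] assms by blast+
  have sets: "{i, l, k} = ikl" "{k, l, j} = jkl" "{i, l, j} = ijl"
    by auto
  note insert = triangle_quiver_insert[OF cw(1)] triangle_quiver_insert[OF cw(2)]
    triangle_quiver_insert[OF cw(3)] triangle_quiver_insert[OF cw(4)]
  note insert = insert[unfolded sets]
  note reverse = triangle_arrows_reverse[of "Tri ikl" "Edge i l" "Edge i k" "Edge l k" "Edge l i" "Edge k i" "Edge k l"]
    triangle_arrows_reverse[of "Tri jkl" "Edge k l" "Edge k j" "Edge l j" "Edge l k" "Edge j k" "Edge j l"]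
    triangle_arrows_reverse[of "Tri ijk" "Edge i j" "Edge i k" "Edge j k" "Edge j i" "Edge k i" "Edge k j"]
    triangle_arrows_reverse[of "Tri ijl" "Edge i l" "Edge i j" "Edge l j" "Edge l i" "Edge j i" "Edge j l"]
  have old: "triangle_quiver (triangles \<Delta>) u v = rest u v - old_part u v" for u v
  proof -
    have "triangle_quiver (triangles \<Delta>) u v = triangle_quiver (insert ikl (insert jkl (triangles \<Delta> - {ikl, jkl}))) u v"
      by (simp only: triangles_split(1) [symmetric])
    then show ?thesis
      unfolding insert(1)[OF triangles_split(3)] insert(2)[OF triangles_split(4)] rest_def old_part_def
      using reverse(1)[of u v] reverse(2)[of u v] reverse(3)[of u v] reverse(4)[of u v]
      by linarith
  qed
  have new: "triangle_quiver (triangles (flip_triangulation i j k l \<Delta>)) u v = rest u v - new_part u v" for u v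
    unfolding triangles_split(2) insert(3)[OF triangles_split(5)] insert(4)[OF triangles_split(6)] rest_def new_part_def
    using reverse(1)[of u v] reverse(2)[of u v] reverse(3)[of u v] reverse(4)[of u v]
    by linarith
  show "quiver \<Delta> = (\<lambda>u v. rest u v - old_part u v)"
    "quiver (flip_triangulation i j k l \<Delta>) = (\<lambda>u v. rest u v - new_part u v)"
    unfolding quiver_eq_triangle_quiver by (intro ext, rule old, intro ext, rule new)
qed

text \<open>The variables after the four mutations, at the labels that they have before the renaming.\<close>

definition flip_values :: "(node \<Rightarrow> 'a::field) \<Rightarrow> node \<Rightarrow> 'a" where
  "flip_values x =
     (let y\<^sub>k = (x (Edge k i) * x (Tri jkl) + x (Tri ikl) * x (Edge k j)) / x (Edge k l);
          y\<^sub>l = (x (Tri ikl) * x (Edge l j) + x (Edge l i) * x (Tri jkl)) / x (Edge l k);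
          y\<^sub>i = (x (Edge i k) * y\<^sub>l + x (Edge i l) * y\<^sub>k) / x (Tri ikl);
          y\<^sub>j = (x (Edge j l) * y\<^sub>k + x (Edge j k) * y\<^sub>l) / x (Tri jkl)
      in x(Edge k l := y\<^sub>k, Edge l k := y\<^sub>l, Tri ikl := y\<^sub>i, Tri jkl := y\<^sub>j))"

definition flip_mutations :: "'a::field seed \<Rightarrow> 'a seed" where
  "flip_mutations S = mutate (Tri jkl) (mutate (Tri ikl) (mutate (Edge l k) (mutate (Edge k l) S)))"

text \<open>The two new triangles with the labels that their nodes have before the renaming.\<close>

definition new_part_unlabelled :: "node \<Rightarrow> node \<Rightarrow> int" where
  "new_part_unlabelled u v =
     triangle_arrows (Edge k l) (Edge i k) (Tri ikl) (Edge k j) (Edge k i) (Tri jkl) (Edge j k) u v +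
     triangle_arrows (Edge l k) (Tri ikl) (Edge i l) (Edge j l) (Tri jkl) (Edge l i) (Edge l j) u v"

lemma new_part_relabel: "new_part_unlabelled (\<sigma> u) (\<sigma> v) = new_part u v"
proof -
  have neq: "i \<noteq> j" "i \<noteq> k" "i \<noteq> l" "j \<noteq> k" "j \<noteq> l" "k \<noteq> l"
    using dist by simp_all
  have fixed: "\<sigma> (Edge i k) = Edge i k" "\<sigma> (Edge k i) = Edge k i" "\<sigma> (Edge i l) = Edge i l"
    "\<sigma> (Edge l i) = Edge l i" "\<sigma> (Edge j k) = Edge j k" "\<sigma> (Edge k j) = Edge k j"
    "\<sigma> (Edge j l) = Edge j l" "\<sigma> (Edge l j) = Edge l j"
    by (rule relabel_simps(9), simp only: insert_iff empty_iff node.inject node.distinct neq neq [symmetric]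
        simp_thms)+
  show ?thesis
    unfolding new_part_unlabelled_def new_part_def triangle_arrows_def arrow_matrix_relabel
      relabel_simps(1-8) fixed ..
qed

lemma flip_mutations_quadrilateral:
  assumes R: "\<And>u v. u \<in> moved \<Longrightarrow> R u v = 0" "\<And>u v. u \<in> moved \<Longrightarrow> R v u = 0"
  shows "flip_mutations (\<lambda>u v. R u v + old_part u v, x) =
    (\<lambda>u v. R u v + new_part_unlabelled u v, flip_values x)"
proof -
  have neq: "i \<noteq> j" "i \<noteq> k" "i \<noteq> l" "j \<noteq> k" "j \<noteq> l" "k \<noteq> l" "ikl \<noteq> jkl"
    using dist triangles_distinct by simp_all
  have distinct: "distinct [Edge k l, Edge l k, Tri ikl, Tri jkl, Edge i k, Edge k i, Edge i l, Edge l i,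
      Edge j k, Edge k j, Edge j l, Edge l j]"
    by (simp only: distinct.simps list.set insert_iff empty_iff node.inject node.distinct neq
        neq [symmetric] simp_thms)
  have R': "R u v = 0" "R v u = 0" if "u \<in> {Edge k l, Edge l k, Tri ikl, Tri jkl}" for u v
    using that R[of u v] by blast+
  have old: "(\<lambda>u v. R u v + old_part u v) = (\<lambda>u v. R u v +
     triangle_arrows (Tri ikl) (Edge i k) (Edge i l) (Edge k l) (Edge k i) (Edge l i) (Edge l k) u v +
     triangle_arrows (Tri jkl) (Edge k j) (Edge k l) (Edge j l) (Edge j k) (Edge l k) (Edge l j) u v)"
    and new: "(\<lambda>u v. R u v + new_part_unlabelled u v) = (\<lambda>u v. R u v +
     triangle_arrows (Edge k l) (Edge i k) (Tri ikl) (Edge k j) (Edge k i) (Tri jkl) (Edge j k) u v +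
     triangle_arrows (Edge l k) (Tri ikl) (Edge i l) (Edge j l) (Tri jkl) (Edge l i) (Edge l j) u v)"
    unfolding old_part_def new_part_unlabelled_def add.assoc by (rule refl)+
  note step = mutate_quadrilateral[where R = R and x = x, OF distinct R' old]
  show ?thesis
    unfolding flip_mutations_def new flip_values_def Let_def
    by (simp only: step fun_upd_apply node.inject node.distinct neq neq [symmetric] simp_thms if_True if_False)
qed

text \<open>The renamed quiver equals the quiver of the flipped set of edges on the nose, arrows between frozen nodes included, so the
flips of all reachable seeds are covered by the same computation.\<close>

lemma flip_seed_quiver:
  "flip_seed i j k l (quiver \<Delta>, x) = (quiver (flip_triangulation i j k l \<Delta>), flip_values x \<circ> \<sigma>)"
proof -
  have seed: "flip_seed i j k l S = relabel \<sigma> (flip_mutations S)" for S :: "'a seed"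
    by (simp only: flip_seed_def flip_mutations_def)
  from opposite_sides consider "clockwise k l i" "clockwise k j l" | "clockwise k i l" "clockwise k l j"
    unfolding separates_def by blast
  then show ?thesis
  proof cases
    case 1
    have "flip_mutations (\<lambda>u v. rest u v + old_part u v, x) =
        (\<lambda>u v. rest u v + new_part_unlabelled u v, flip_values x)"
      by (rule flip_mutations_quadrilateral[of rest]) (rule rest_eq_0, assumption)+
    then show ?thesis
      unfolding seed quiver_positive[OF 1]
      by (simp only: relabel_def prod.case rest_relabel new_part_relabel o_def)
  next
    case 2
    let ?b = "\<lambda>u v. - rest u v + old_part u v"
    have b: "(\<lambda>u v. rest u v - old_part u v, x) = opposite_seed (?b, x)"
      by (simp add: opposite_seed_def)
    have "(\<lambda>u v. rest u v - old_part u v) = quiver \<Delta>"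
      using quiver_negative(1)[OF 2] by (rule sym)
    then have "skew (\<lambda>u v. rest u v - old_part u v)"
      by (simp only: quiver_eq_triangle_quiver skew_triangle_quiver)
    then have "skew (fst (?b, x))"
      unfolding skew_def fst_conv by (metis minus_diff_eq uminus_add_conv_diff)
    then have opp: "flip_mutations (opposite_seed (?b, x)) = opposite_seed (flip_mutations (?b, x))"
      unfolding flip_mutations_def by (simp only: mutate_opposite skew_mutate)
    have "flip_mutations (?b, x) = (\<lambda>u v. - rest u v + new_part_unlabelled u v, flip_values x)"
      by (rule flip_mutations_quadrilateral[of "\<lambda>u v. - rest u v"]) (simp_all only: rest_eq_0 neg_0_equal_iff_equal minus_zero)
    then have "flip_mutations (\<lambda>u v. rest u v - old_part u v, x) =
        (\<lambda>u v. rest u v - new_part_unlabelled u v, flip_values x)"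
      unfolding b opp by (simp add: opposite_seed_def)
    then show ?thesis
      unfolding seed quiver_negative[OF 2]
      by (simp only: relabel_def prod.case rest_relabel new_part_relabel o_def)
  qed
qed

lemma flip_values_relabel:
  fixes x :: "node \<Rightarrow> 'a::field"
  defines "x' \<equiv> flip_values x \<circ> \<sigma>"
  shows "x' (Tri ijk) = (x (Edge k i) * x (Tri jkl) + x (Tri ikl) * x (Edge k j)) / x (Edge k l)"
    "x' (Tri ijl) = (x (Tri ikl) * x (Edge l j) + x (Edge l i) * x (Tri jkl)) / x (Edge l k)"
    "x' (Edge i j) = (x (Edge i k) * x' (Tri ijl) + x (Edge i l) * x' (Tri ijk)) / x (Tri ikl)"
    "x' (Edge j i) = (x (Edge j l) * x' (Tri ijk) + x (Edge j k) * x' (Tri ijl)) / x (Tri jkl)"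
    "u \<notin> moved \<Longrightarrow> x' u = x u"
proof -
  have neq: "k \<noteq> l" "ikl \<noteq> jkl"
    using dist triangles_distinct by simp_all
  show "x' (Tri ijk) = (x (Edge k i) * x (Tri jkl) + x (Tri ikl) * x (Edge k j)) / x (Edge k l)"
    "x' (Tri ijl) = (x (Tri ikl) * x (Edge l j) + x (Edge l i) * x (Tri jkl)) / x (Edge l k)"
    "x' (Edge i j) = (x (Edge i k) * x' (Tri ijl) + x (Edge i l) * x' (Tri ijk)) / x (Tri ikl)"
    "x' (Edge j i) = (x (Edge j l) * x' (Tri ijk) + x (Edge j k) * x' (Tri ijl)) / x (Tri jkl)"
    unfolding x'_def o_apply relabel_simps(1-8) flip_values_def Let_def
    by (simp_all only: fun_upd_apply node.inject node.distinct neq neq [symmetric] simp_thms if_True if_False)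
  show "x' u = x u" if u: "u \<notin> moved"
    using u unfolding x'_def o_apply relabel_simps(9)[OF u] flip_values_def Let_def
    by (simp only: fun_upd_apply insert_iff empty_iff de_Morgan_disj simp_thms if_False)
qed

end

section \<open>Ptolemaic functions and configurations of affine flags\<close>

text \<open>One relation for each crossing pair of chords, read with \<open>a\<close> distinguished.  With \<open>a\<close> running through the four vertices
of a quadrilateral these are the four exchange relations of a flip.\<close>

definition ptolemaic :: "(node \<Rightarrow> 'a::field) \<Rightarrow> bool" where
  "ptolemaic F \<longleftrightarrow> (\<forall>a b c d. separates a c b d \<longrightarrow>
     F (Edge a c) * F (Tri {a, b, d}) = F (Edge a b) * F (Tri {a, c, d}) + F (Edge a d) * F (Tri {a, b, c}))"

lemma ptolemaicD:
  "ptolemaic F \<Longrightarrow> separates a c b d \<Longrightarrow>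
     F (Edge a c) * F (Tri {a, b, d}) = F (Edge a b) * F (Tri {a, c, d}) + F (Edge a d) * F (Tri {a, b, c})"
  unfolding ptolemaic_def by blast

context flippable
begin

lemma nodes_flip:
  assumes "u \<in> nodes (flip_triangulation i j k l \<Delta>)"
  shows "u \<in> {Tri ijk, Tri ijl, Edge i j, Edge j i} \<or> u \<in> nodes \<Delta> \<and> u \<notin> moved"
proof -
  have "i \<noteq> j" "k \<noteq> l" "i \<noteq> k" "i \<noteq> l" "j \<noteq> k" "j \<noteq> l"
    using dist by simp_all
  from assms consider p q where "u = Edge p q" "{p, q} \<in> flip_triangulation i j k l \<Delta>"
    | T where "u = Tri T" "T \<in> triangles (flip_triangulation i j k l \<Delta>)"
    unfolding nodes_def by blast
  then show ?thesis
  proof cases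
    case 1
    show ?thesis
    proof (cases "{p, q} = {i, j}")
      case True
      then show ?thesis using 1 by (auto simp: doubleton_eq_iff)
    next
      case False
      then have "{p, q} \<in> \<Delta>" "{p, q} \<noteq> {k, l}" using 1(2) by (auto simp: flip_iff)
      moreover from this False have "Edge p q \<notin> moved"
        by (auto simp: insert_commute)
      ultimately show ?thesis using 1 by (auto simp: nodes_def)
    qed
  next
    case 2
    show ?thesis
    proof (cases "T = ijk \<or> T = ijl")
      case False
      then have "T \<in> triangles \<Delta> - {ikl, jkl}" using 2(2) unfolding triangles_flip by blast
      then show ?thesis using 2 False by (auto simp: nodes_def)
    qed (use 2 in auto)
  qed
qed

lemma nodes_quadrilateral:
  "{Edge k l, Edge l k, Edge i k, Edge k i, Edge i l, Edge l i, Edge j k, Edge k j, Edge j l, Edge l j,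
    Tri ikl, Tri jkl} \<subseteq> nodes \<Delta>"
  using edges ikl jkl by (auto simp: nodes_def insert_commute)

lemma flip_ptolemaic:
  fixes F x :: "node \<Rightarrow> 'a::field"
  defines "x' \<equiv> flip_values x \<circ> \<sigma>"
  assumes F: "ptolemaic F" and x: "\<And>u. u \<in> nodes \<Delta> \<Longrightarrow> x u = F u"
    and nz: "\<And>u. u \<in> nodes \<Delta> \<Longrightarrow> x u \<noteq> 0"
    and u: "u \<in> nodes (flip_triangulation i j k l \<Delta>)"
  shows "x' u = F u"
proof -
  have nodes: "x v = F v" "F v \<noteq> 0"
    if "v \<in> {Edge k l, Edge l k, Edge i k, Edge k i, Edge i l, Edge l i, Edge j k, Edge k j, Edge j l, Edge l j,
      Tri ikl, Tri jkl}" for v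
    using nodes_quadrilateral that x[of v] nz[of v] by auto
  note new = flip_values_relabel[where x = x, folded x'_def]
  have sets: "{k, l, j} = jkl" "{k, i, j} = ijk" "{k, i, l} = ikl" "{l, k, j} = jkl" "{l, i, j} = ijl"
    "{l, i, k} = ikl" "{i, k, j} = ijk" "{i, l, j} = ijl" "{j, k, i} = ijk" "{j, l, i} = ijl"
    "{j, i, k} = ijk" "{j, i, l} = ijl" "{k, l, i} = ikl" "{l, k, i} = ikl" "{k, j, l} = jkl" "{l, j, k} = jkl"
    by auto
  have sep: "separates k l i j" "separates l k i j" "separates i j k l" "separates j i k l"
    using opposite_sides separates_swap separates_sym by blast+
  note rel = ptolemaicD[OF F sep(1)] ptolemaicD[OF F sep(2)] ptolemaicD[OF F sep(3)] ptolemaicD[OF F sep(4)]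
  have k: "x' (Tri ijk) = F (Tri ijk)"
    using rel(1) unfolding new(1) by (simp add: nodes sets field_simps)
  have l: "x' (Tri ijl) = F (Tri ijl)"
    using rel(2) unfolding new(2) by (simp add: nodes sets field_simps)
  have ij': "x' (Edge i j) = F (Edge i j)"
    using rel(3) unfolding new(3) k l by (simp add: nodes sets field_simps)
  have ji': "x' (Edge j i) = F (Edge j i)"
    using rel(4) unfolding new(4) k l by (simp add: nodes sets field_simps)
  show ?thesis
    using nodes_flip[OF u] k l ij' ji' new(5) x by auto
qed

lemma flip_positive:
  fixes x :: "node \<Rightarrow> 'a::field"
  defines "x' \<equiv> flip_values x \<circ> \<sigma>"
  assumes pos: "\<And>u. u \<in> nodes \<Delta> \<Longrightarrow> x u \<in> positive_values V x\<^sub>0"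
    and u: "u \<in> nodes (flip_triangulation i j k l \<Delta>)"
  shows "x' u \<in> positive_values V x\<^sub>0"
proof -
  note new = flip_values_relabel[where x = x, folded x'_def]
  have nodes: "x v \<in> positive_values V x\<^sub>0"
    if "v \<in> {Edge k l, Edge l k, Edge i k, Edge k i, Edge i l, Edge l i, Edge j k, Edge k j, Edge j l, Edge l j,
      Tri ikl, Tri jkl}" for v
    using nodes_quadrilateral that pos[of v] by blast
  note intros = positive_values.add positive_values.mult positive_values.divide nodes
  have k: "x' (Tri ijk) \<in> positive_values V x\<^sub>0"
    unfolding new(1) by (intro intros) simp_all
  have l: "x' (Tri ijl) \<in> positive_values V x\<^sub>0"
    unfolding new(2) by (intro intros) simp_all
  have ij': "x' (Edge i j) \<in> positive_values V x\<^sub>0"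
    unfolding new(3) by (intro intros k l) simp_all
  have ji': "x' (Edge j i) \<in> positive_values V x\<^sub>0"
    unfolding new(4) by (intro intros k l) simp_all
  show ?thesis
    using nodes_flip[OF u] k l ij' ji' new(5) pos by auto
qed

end

text \<open>A function that agrees with the initial seed and satisfies all exchange relations agrees with every reachable seed.  The
values are kept subtraction-free along the way, since an exchange relation determines the new variable only if the
old one is not zero.\<close>

lemma flip_reachable_ptolemaic:
  fixes F x\<^sub>0 :: "node \<Rightarrow> 'a::field_char_0"
  assumes "flip_reachable N \<Delta>\<^sub>0 x\<^sub>0 \<Delta> S"
    and noncrossing: "noncrossing \<Delta>\<^sub>0"
    and ind: "algebraically_independent_on (nodes \<Delta>\<^sub>0) x\<^sub>0"
    and F: "ptolemaic F" and x\<^sub>0: "\<And>u. u \<in> nodes \<Delta>\<^sub>0 \<Longrightarrow> x\<^sub>0 u = F u"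
  shows "noncrossing \<Delta> \<and> fst S = quiver \<Delta> \<and>
    (\<forall>u \<in> nodes \<Delta>. snd S u = F u \<and> snd S u \<in> positive_values (nodes \<Delta>\<^sub>0) x\<^sub>0)"
  using assms(1)
proof induction
  case initial
  then show ?case using noncrossing by (auto simp: x\<^sub>0 [symmetric] intro: positive_values.variable)
next
  case (flip \<Delta> S k l i j)
  then interpret flippable \<Delta> i j k l
    by unfold_locales auto
  obtain x where S: "S = (quiver \<Delta>, x)"
    using flip.IH by (cases S) auto
  have x: "x u = F u" "x u \<in> positive_values (nodes \<Delta>\<^sub>0) x\<^sub>0" if "u \<in> nodes \<Delta>" for u
    using flip.IH that by (auto simp: S)
  have nz: "x u \<noteq> 0" if "u \<in> nodes \<Delta>" for u
    using positive_values_nonzero[OF ind x(2)[OF that]] .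
  have "(flip_values x \<circ> \<sigma>) u = F u" "(flip_values x \<circ> \<sigma>) u \<in> positive_values (nodes \<Delta>\<^sub>0) x\<^sub>0"
    if "u \<in> nodes (flip_triangulation i j k l \<Delta>)" for u
    by (rule flip_ptolemaic[OF F x(1) nz that]; assumption) (rule flip_positive[OF x(2) that]; assumption)
  then show ?case
    unfolding S flip_seed_quiver fst_conv snd_conv
    using noncrossing_flip by blast
qed

lemma edge_variable_eqI:
  fixes F x :: "node \<Rightarrow> 'a::field_char_0"
  assumes "noncrossing \<Delta>\<^sub>0" "algebraically_independent_on (nodes \<Delta>\<^sub>0) x"
    and "ptolemaic F" "\<And>u. u \<in> nodes \<Delta>\<^sub>0 \<Longrightarrow> x u = F u"
    and "flip_reachable N \<Delta>\<^sub>0 x \<Delta> S" "{p, q} \<in> \<Delta>"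
  shows "edge_variable N \<Delta>\<^sub>0 x p q = F (Edge p q)"
proof -
  have F: "y (Edge p q) = F (Edge p q)" if "flip_reachable N \<Delta>\<^sub>0 x \<Delta>' (b, y)" "{p, q} \<in> \<Delta>'" for \<Delta>' b y
    using flip_reachable_ptolemaic[OF that(1) assms(1-4)] that(2) by (auto simp: nodes_def)
  show ?thesis
    unfolding edge_variable_def
  proof (rule the_equality)
    show "\<exists>\<Delta> b y. flip_reachable N \<Delta>\<^sub>0 x \<Delta> (b, y) \<and> {p, q} \<in> \<Delta> \<and> F (Edge p q) = y (Edge p q)"
      using F assms(5,6) by (cases S) fastforce
  qed (use F in fastforce)
qed

definition pairing :: "'a::field \<times> 'a \<times> 'a \<Rightarrow> 'a \<times> 'a \<times> 'a \<Rightarrow> 'a" where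
  "pairing f v = (case f of (f\<^sub>1, f\<^sub>2, f\<^sub>3) \<Rightarrow> case v of (v\<^sub>1, v\<^sub>2, v\<^sub>3) \<Rightarrow> f\<^sub>1 * v\<^sub>1 + f\<^sub>2 * v\<^sub>2 + f\<^sub>3 * v\<^sub>3)"

definition det3 :: "'a::field \<times> 'a \<times> 'a \<Rightarrow> 'a \<times> 'a \<times> 'a \<Rightarrow> 'a \<times> 'a \<times> 'a \<Rightarrow> 'a" where
  "det3 u v w = (case u of (u\<^sub>1, u\<^sub>2, u\<^sub>3) \<Rightarrow> case v of (v\<^sub>1, v\<^sub>2, v\<^sub>3) \<Rightarrow> case w of (w\<^sub>1, w\<^sub>2, w\<^sub>3) \<Rightarrow>
     u\<^sub>1 * (v\<^sub>2 * w\<^sub>3 - v\<^sub>3 * w\<^sub>2) + u\<^sub>2 * (v\<^sub>3 * w\<^sub>1 - v\<^sub>1 * w\<^sub>3) + u\<^sub>3 * (v\<^sub>1 * w\<^sub>2 - v\<^sub>2 * w\<^sub>1))"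

lemma det3_rotate: "det3 u v w = det3 v w u"
  by (cases u; cases v; cases w) (simp add: det3_def algebra_simps)

text \<open>Cramer's rule: the linear relation between four vectors of a three-dimensional space, paired with \<open>f\<close>.\<close>

lemma pairing_four_vectors:
  "pairing f c * det3 a b d =
     pairing f b * det3 a c d + pairing f d * det3 a b c - pairing f a * det3 b c d"
  by (cases f; cases a; cases b; cases c; cases d) (simp add: det3_def pairing_def algebra_simps)

text \<open>The coordinates of a configuration of affine flags.  The determinant is invariant under rotation of its arguments, so it
does not matter which clockwise enumeration of \<open>T\<close> the choice operator returns.\<close>

fun flag_function :: "(nat \<Rightarrow> 'a::field \<times> 'a \<times> 'a) \<Rightarrow> (nat \<Rightarrow> 'a \<times> 'a \<times> 'a) \<Rightarrow> node \<Rightarrow> 'a" where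
  "flag_function f v (Edge p q) = pairing (f p) (v q)"
| "flag_function f v (Tri T) =
     (case SOME (p, q, r). T = {p, q, r} \<and> clockwise p q r of (p, q, r) \<Rightarrow> det3 (v p) (v q) (v r))"

lemma flag_function_Tri:
  assumes "clockwise p q r"
  shows "flag_function f v (Tri {p, q, r}) = det3 (v p) (v q) (v r)"
proof -
  define t where "t = (SOME (p', q', r'). {p, q, r} = {p', q', r'} \<and> clockwise p' q' r')"
  obtain p' q' r' where t: "t = (p', q', r')" by (cases t)
  have "case t of (p', q', r') \<Rightarrow> {p, q, r} = {p', q', r'} \<and> clockwise p' q' r'"
    unfolding t_def by (rule someI[of _ "(p, q, r)"]) (simp add: assms)
  then have "(p', q', r') \<in> {(p, q, r), (q, r, p), (r, p, q)}"
    unfolding t prod.case using clockwise_triple[OF _ assms, of p' q' r'] by blast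
  then have "det3 (v p') (v q') (v r') = det3 (v p) (v q) (v r)"
    using det3_rotate[of "v p" "v q" "v r"] det3_rotate[of "v q" "v r" "v p"]
    by (elim insertE emptyE) simp_all
  then show ?thesis
    unfolding flag_function.simps t_def [symmetric] t by simp
qed

text \<open>In Cramer's rule the term with \<open>f\<^sub>a(v\<^sub>a)\<close> vanishes, and the other three signs come out positive when all
determinants are taken clockwise.\<close>

lemma flag_function_ptolemaic:
  assumes flag: "\<And>p. pairing (f p) (v p) = 0"
  shows "ptolemaic (flag_function f v)"
  unfolding ptolemaic_def
proof (intro allI impI)
  let ?F = "flag_function f v"
  fix a b c d
  have *: "?F (Edge a c) * ?F (Tri {a, b, d}) = ?F (Edge a b) * ?F (Tri {a, c, d}) + ?F (Edge a d) * ?F (Tri {a, b, c})"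
    if cw: "clockwise a b c" "clockwise a c d" for b d
  proof -
    have "clockwise a b d" using clockwise_quadrilateral[OF cw] by blast
    then show ?thesis
      using cw pairing_four_vectors[of "f a" "v c" "v a" "v b" "v d"]
      by (simp add: flag_function_Tri flag del: flag_function.simps(2))
  qed
  assume "separates a c b d"
  then consider "clockwise a b c" "clockwise a c d" | "clockwise a d c" "clockwise a c b"
    unfolding separates_def by blast
  then show "?F (Edge a c) * ?F (Tri {a, b, d}) = ?F (Edge a b) * ?F (Tri {a, c, d}) + ?F (Edge a d) * ?F (Tri {a, b, c})"
  proof cases
    case 1
    then show ?thesis by (rule *)
  next
    case 2
    have sets: "{a, d, b} = {a, b, d}" "{a, c, b} = {a, b, c}" "{a, d, c} = {a, c, d}" by auto
    show ?thesis
      using *[OF 2] unfolding sets by (simp only: add.commute)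
  qed
qed

section \<open>The fan triangulation\<close>

text \<open>The numbers \<open>0, \<dots>, N - 1\<close> below are positions, counted clockwise from the fan vertex: \<open>vertex 0\<close> is \<open>k\<close>, \<open>vertex 1\<close>
is \<open>j\<close>, and \<open>vertex (n + 2)\<close> is \<open>i\<close>.\<close>

locale fan =
  fixes n N k :: nat
  assumes n: "n \<ge> 1" and N: "N = n + 3" and k: "k < N"
begin

lemma N_bounds: "n + 3 \<le> N" "N \<le> n + 3" "4 \<le> N"
  using n N by simp_all

definition vertex :: "nat \<Rightarrow> nat" where
  "vertex m = (k + m) mod N"

definition position :: "nat \<Rightarrow> nat" where
  "position p = (p + N - k) mod N"

abbreviation "\<Delta> \<equiv> fan_triangulation N k"

lemma vertex_eq: "m < N \<Longrightarrow> vertex m = (if k + m < N then k + m else k + m - N)"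
  using k by (simp add: vertex_def mod_if)

lemma position_eq: "p < N \<Longrightarrow> position p = (if k \<le> p then p - k else p + N - k)"
  using k by (auto simp: position_def mod_if)

lemma vertex_less: "vertex m < N"
  using k by (simp add: vertex_def)

lemma position_less: "position p < N"
  using k by (simp add: position_def)

lemma position_vertex: "m < N \<Longrightarrow> position (vertex m) = m"
  using k unfolding position_eq[OF vertex_less] by (auto simp: vertex_eq)

lemma vertex_position: "p < N \<Longrightarrow> vertex (position p) = p"
  using k unfolding vertex_eq[OF position_less] by (auto simp: position_eq)

lemma vertex_eq_iff: "a < N \<Longrightarrow> b < N \<Longrightarrow> vertex a = vertex b \<longleftrightarrow> a = b"
  using position_vertex by metis

lemma vertex_0 [simp]: "vertex 0 = k"
  using k by (simp add: vertex_def)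

lemma vertex_eq_k: "m < N \<Longrightarrow> vertex m = k \<longleftrightarrow> m = 0"
  using vertex_eq_iff[of m 0] k by simp

lemma cw_eq: "p < N \<Longrightarrow> cw N p = (if p + 1 < N then p + 1 else 0)"
  by (cases "p + 1 = N") (simp_all add: cw_def)

lemma cw_vertex:
  assumes "m < N"
  shows "cw N (vertex m) = vertex (if m + 1 = N then 0 else m + 1)"
proof (cases "m + 1 = N")
  case True
  then show ?thesis
    using k assms cw_eq[OF vertex_less, of m] vertex_eq[of m] by (simp; linarith)
next
  case False
  then show ?thesis
    using k assms cw_eq[OF vertex_less, of m] vertex_eq[of m] vertex_eq[of "m + 1"]
    by (simp split: if_splits; linarith)
qed

lemma cw_vertex_inner: "m + 1 < N \<Longrightarrow> cw N (vertex m) = vertex (m + 1)"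
  using cw_vertex[of m] by simp

lemma ccw_eq:
  assumes "p < N"
  shows "ccw N p = (if p = 0 then N - 1 else p - 1)"
proof (cases p)
  case (Suc q)
  then have "p + N - 1 = q + N" by simp
  then show ?thesis using assms Suc by (simp add: ccw_def)
qed (use assms in \<open>simp add: ccw_def\<close>)

lemma ccw_vertex:
  assumes "m + 1 < N"
  shows "ccw N (vertex (m + 1)) = vertex m"
proof -
  have "ccw N (cw N (vertex m)) = vertex m"
    using vertex_less[of m] cw_eq[of "vertex m"] ccw_eq[of "vertex m + 1"] ccw_eq[of 0] by auto
  then show ?thesis using cw_vertex_inner[OF assms] by simp
qed

lemma ccw_k: "ccw N k = vertex (n + 2)"
  using k N_bounds vertex_eq[of "n + 2"] ccw_eq[OF k] by auto

lemma cw_k: "cw N k = vertex 1"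
  using cw_vertex_inner[of 0] N_bounds by simp

lemma polygon_edge_iff:
  assumes "a < N" "b < N"
  shows "{vertex a, vertex b} \<in> polygon_edges N \<longleftrightarrow>
    b = a + 1 \<or> a = b + 1 \<or> a = 0 \<and> b = N - 1 \<or> b = 0 \<and> a = N - 1"
proof -
  have "{vertex a, vertex b} \<in> polygon_edges N \<longleftrightarrow> (\<exists>m<N. {vertex a, vertex b} = {vertex m, cw N (vertex m)})"
  proof
    assume "{vertex a, vertex b} \<in> polygon_edges N"
    then obtain p where p: "p < N" "{vertex a, vertex b} = {p, cw N p}"
      by (auto simp: polygon_edges_def)
    then show "\<exists>m<N. {vertex a, vertex b} = {vertex m, cw N (vertex m)}"
      by (intro exI[of _ "position p"]) (simp add: position_less vertex_position)
  qed (auto simp: polygon_edges_def vertex_less)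
  also have "\<dots> \<longleftrightarrow> (\<exists>m<N. {vertex a, vertex b} = {vertex m, vertex (if m + 1 = N then 0 else m + 1)})"
    by (intro ex_cong1 conj_cong refl) (simp only: cw_vertex)
  also have "\<dots> \<longleftrightarrow> (\<exists>m<N. {a, b} = {m, if m + 1 = N then 0 else m + 1})"
  proof -
    have "{vertex a, vertex b} = {vertex m, vertex c} \<longleftrightarrow> {a, b} = {m, c}" if "m < N" "c < N" for m c
      using assms that by (simp add: doubleton_eq_iff vertex_eq_iff)
    note pair = this
    have "{vertex a, vertex b} = {vertex m, vertex (if m + 1 = N then 0 else m + 1)} \<longleftrightarrow>
        {a, b} = {m, if m + 1 = N then 0 else m + 1}" if "m < N" for m
      by (rule pair) (use that in auto)
    then show ?thesis by (intro ex_cong1 conj_cong refl)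
  qed
  also have "\<dots> \<longleftrightarrow> b = a + 1 \<or> a = b + 1 \<or> a = 0 \<and> b = N - 1 \<or> b = 0 \<and> a = N - 1"
  proof
    assume "\<exists>m<N. {a, b} = {m, if m + 1 = N then 0 else m + 1}"
    then show "b = a + 1 \<or> a = b + 1 \<or> a = 0 \<and> b = N - 1 \<or> b = 0 \<and> a = N - 1"
      by (auto simp: doubleton_eq_iff split: if_splits)
  next
    assume "b = a + 1 \<or> a = b + 1 \<or> a = 0 \<and> b = N - 1 \<or> b = 0 \<and> a = N - 1"
    then consider "b = a + 1" | "a = b + 1" | "a = 0" "b = N - 1" | "b = 0" "a = N - 1" by blast
    then show "\<exists>m<N. {a, b} = {m, if m + 1 = N then 0 else m + 1}"
    proof cases
      case 1 then show ?thesis using assms by (intro exI[of _ a]) auto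
    next
      case 2 then show ?thesis using assms by (intro exI[of _ b]) auto
    next
      case 3 then show ?thesis using assms by (intro exI[of _ b]) auto
    next
      case 4 then show ?thesis using assms by (intro exI[of _ a]) auto
    qed
  qed
  finally show ?thesis .
qed

lemma edge_iff:
  assumes "a < N" "b < N"
  shows "{vertex a, vertex b} \<in> \<Delta> \<longleftrightarrow> a \<noteq> b \<and> (a = 0 \<or> b = 0 \<or> b = a + 1 \<or> a = b + 1)"
proof -
  have "{vertex a, vertex b} \<in> {{k, m} | m. m < N \<and> m \<noteq> k} \<longleftrightarrow> a \<noteq> b \<and> (a = 0 \<or> b = 0)"
  proof
    assume "{vertex a, vertex b} \<in> {{k, m} | m. m < N \<and> m \<noteq> k}"
    then show "a \<noteq> b \<and> (a = 0 \<or> b = 0)"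
      using assms vertex_eq_k by (auto simp: doubleton_eq_iff)
  next
    assume "a \<noteq> b \<and> (a = 0 \<or> b = 0)"
    then consider "a = 0" "b \<noteq> 0" | "b = 0" "a \<noteq> 0" by auto
    then show "{vertex a, vertex b} \<in> {{k, m} | m. m < N \<and> m \<noteq> k}"
      using assms vertex_less vertex_eq_k by cases (auto simp: insert_commute)
  qed
  then show ?thesis
    unfolding fan_triangulation_def Un_iff polygon_edge_iff[OF assms] using N_bounds by auto
qed

lemma edge_less:
  assumes "{p, q} \<in> \<Delta>"
  shows "p < N" "q < N"
proof -
  have "cw N m < N" for m using k by (simp add: cw_def)
  then have "e \<subseteq> {..<N}" if "e \<in> \<Delta>" for e
    using that k by (auto simp: fan_triangulation_def polygon_edges_def)
  from this[OF assms] show "p < N" "q < N" by auto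
qed

lemma internal_diagonal_iff:
  assumes "a < N" "b < N"
  shows "{vertex a, vertex b} \<in> internal_diagonals N \<Delta> \<longleftrightarrow> a = 0 \<and> b \<in> {2..n+1} \<or> b = 0 \<and> a \<in> {2..n+1}"
  unfolding internal_diagonals_def Diff_iff edge_iff[OF assms] polygon_edge_iff[OF assms]
  using assms N_bounds by auto

lemma fan_triangle: "1 \<le> m \<Longrightarrow> m \<le> n + 1 \<Longrightarrow> {k, vertex m, vertex (m + 1)} \<in> triangles \<Delta>"
  using edge_iff[of 0 m] edge_iff[of 0 "m + 1"] edge_iff[of m "m + 1"] N_bounds
    vertex_eq_iff[of 0 m] vertex_eq_iff[of 0 "m + 1"] vertex_eq_iff[of m "m + 1"]
  by (simp add: triangle_iff)

lemma triangles_fan: "triangles \<Delta> = (\<lambda>m. {k, vertex m, vertex (m + 1)}) ` {1..n+1}"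
proof (intro equalityI subsetI)
  fix T assume T: "T \<in> triangles \<Delta>"
  then obtain p q r where T_eq: "T = {p, q, r}" and "{p, q} \<in> \<Delta>" "{q, r} \<in> \<Delta>" "{p, r} \<in> \<Delta>"
    by (auto simp: mem_triangles)
  moreover from this obtain a b c where abc: "p = vertex a" "q = vertex b" "r = vertex c" "a < N" "b < N" "c < N"
    using edge_less vertex_position position_less by metis
  ultimately have "{vertex a, vertex b} \<in> \<Delta>" "{vertex b, vertex c} \<in> \<Delta>" "{vertex a, vertex c} \<in> \<Delta>"
    by simp_all
  then have e: "a \<noteq> b \<and> (a = 0 \<or> b = 0 \<or> b = a + 1 \<or> a = b + 1)"
    "b \<noteq> c \<and> (b = 0 \<or> c = 0 \<or> c = b + 1 \<or> b = c + 1)"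
    "a \<noteq> c \<and> (a = 0 \<or> c = 0 \<or> c = a + 1 \<or> a = c + 1)"
    using edge_iff abc(4-6) by blast+
  have step: "\<exists>m. 1 \<le> m \<and> m + 1 < N \<and> {0, d, e} = {0, m, m + 1}"
    if "d < N" "e < N" "d \<noteq> 0" "e \<noteq> 0" "e = d + 1 \<or> d = e + 1" for d e
    using that by (intro exI[of _ "min d e"]) auto
  have "a = 0 \<or> b = 0 \<or> c = 0" using e by linarith
  then have "\<exists>m. 1 \<le> m \<and> m + 1 < N \<and> {a, b, c} = {0, m, m + 1}"
  proof (elim disjE)
    assume "a = 0" then show ?thesis using step[of b c] e abc by auto
  next
    assume "b = 0" then show ?thesis using step[of a c] e abc by (auto simp: insert_commute[of a 0])
  next
    assume "c = 0"
    moreover have "{a, b, 0} = {0, a, b}" by auto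
    ultimately show ?thesis using step[of a b] e abc by auto
  qed
  then obtain m where m: "1 \<le> m" "m + 1 < N" "{a, b, c} = {0, m, m + 1}" by blast
  have "T = vertex ` {a, b, c}" using T_eq abc(1-3) by simp
  then have "T = {k, vertex m, vertex (m + 1)}" unfolding m by simp
  then show "T \<in> (\<lambda>m. {k, vertex m, vertex (m + 1)}) ` {1..n+1}"
    using m N_bounds by (intro image_eqI[of _ _ m]) auto
qed (use fan_triangle in auto)

text \<open>Nothing lies strictly between two consecutive vertices, so a side of the polygon is never crossed; and two spokes share the
fan vertex.\<close>

lemma noncrossing_fan: "noncrossing \<Delta>"
  unfolding noncrossing_def
proof (intro allI impI notI)
  have polygon: "\<not> separates a c b d" if ac: "{a, c} \<in> polygon_edges N" and bd: "{b, d} \<in> \<Delta>" for a c b d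
  proof
    assume "separates a c b d"
    from ac obtain p where p: "p < N" "{a, c} = {p, cw N p}" by (auto simp: polygon_edges_def)
    then have "separates p (cw N p) b d"
      using \<open>separates a c b d\<close> separates_swap(1)[of a c b d] by (auto simp: doubleton_eq_iff)
    then have "clockwise p b (cw N p) \<or> clockwise p d (cw N p)"
      unfolding separates_def by blast
    moreover have "cw N p = p + 1 \<or> cw N p = 0 \<and> p + 1 = N"
      using cw_eq[OF p(1)] p(1) by (simp split: if_splits; linarith)
    ultimately show False
      using edge_less[OF bd] unfolding clockwise_def by linarith
  qed
  fix a c b d assume ac: "{a, c} \<in> \<Delta>" and bd: "{b, d} \<in> \<Delta>" and sep: "separates a c b d"
  have "{a, c} \<notin> polygon_edges N" "{b, d} \<notin> polygon_edges N"
    using polygon[OF _ bd] polygon[OF _ ac] sep separates_sym[of a c b d] by blast+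
  then have "k \<in> {a, c}" "k \<in> {b, d}"
    using ac bd unfolding fan_triangulation_def by blast+
  then show False
    using sep clockwise_distinct unfolding separates_def by blast
qed

end

section \<open>Flips leading to the longest edge\<close>

context fan
begin

text \<open>Flipping the spokes to the vertices \<open>2, 3, \<dots>, n + 1\<close> one after the other turns the edge from \<open>1\<close> to \<open>2\<close> into
the edge from \<open>1\<close> to \<open>n + 2\<close>.\<close>

lemma longest_edge_reachable:
  fixes x :: "node \<Rightarrow> 'a::field"
  shows "\<exists>\<Delta>' S. flip_reachable N \<Delta> x \<Delta>' S \<and> {vertex (n + 2), vertex 1} \<in> \<Delta>'"
proof -
  \<comment> \<open>After \<open>d\<close> flips the triangles at the fan vertex that remain are the one on the edge from \<open>1\<close> to \<open>d + 2\<close> and the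
original ones beyond it.\<close>
  have "\<exists>\<Delta>' S. flip_reachable N \<Delta> x \<Delta>' S \<and> {vertex 1, vertex (d + 2)} \<in> \<Delta>' \<and> {k, vertex 1} \<in> \<Delta>' \<and>
      (\<forall>m. d + 2 \<le> m \<and> m < N \<longrightarrow> {k, vertex m} \<in> \<Delta>') \<and>
      (\<forall>m. d + 2 \<le> m \<and> m + 1 < N \<longrightarrow> {vertex m, vertex (m + 1)} \<in> \<Delta>')"
    if "d \<le> n" for d
    using that
  proof (induction d)
    case 0
    have "{vertex 1, vertex 2} \<in> \<Delta>" "{k, vertex 1} \<in> \<Delta>"
      using edge_iff[of 1 2] edge_iff[of 0 1] N_bounds by auto
    moreover have "{k, vertex m} \<in> \<Delta>" if "2 \<le> m" "m < N" for m
      using edge_iff[of 0 m] that by auto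
    moreover have "{vertex m, vertex (m + 1)} \<in> \<Delta>" if "2 \<le> m" "m + 1 < N" for m
      using edge_iff[of m "m + 1"] that by auto
    ultimately show ?case
      using flip_reachable.initial[of N \<Delta> x] by (intro exI[of _ \<Delta>] exI[of _ "(quiver \<Delta>, x)"]) (auto simp: numeral_2_eq_2)
  next
    case (Suc d)
    define s where "s = d + 2"
    have s: "2 \<le> s" "s + 1 < N" using Suc.prems N_bounds by (auto simp: s_def)
    obtain \<Delta>' S where reach: "flip_reachable N \<Delta> x \<Delta>' S"
      and \<Delta>': "{vertex 1, vertex s} \<in> \<Delta>'" "{k, vertex 1} \<in> \<Delta>'"
        "\<And>m. s \<le> m \<Longrightarrow> m < N \<Longrightarrow> {k, vertex m} \<in> \<Delta>'"
        "\<And>m. s \<le> m \<Longrightarrow> m + 1 < N \<Longrightarrow> {vertex m, vertex (m + 1)} \<in> \<Delta>'"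
      using Suc.IH Suc.prems unfolding s_def by auto
    have neq: "vertex a \<noteq> vertex b" if "a < N" "b < N" "a \<noteq> b" for a b
      using vertex_eq_iff that by blast
    have neqs: "vertex 1 \<noteq> k" "vertex s \<noteq> k" "vertex (s + 1) \<noteq> k" "vertex 1 \<noteq> vertex s"
      "vertex s \<noteq> vertex (s + 1)" "vertex 1 \<noteq> vertex (s + 1)"
      using neq[of 1 0] neq[of s 0] neq[of "s + 1" 0] neq[of 1 s] neq[of s "s + 1"] neq[of 1 "s + 1"] s by auto
    have "{k, vertex s} \<notin> polygon_edges N"
      using polygon_edge_iff[of 0 s] s by auto
    then have diagonal: "{k, vertex s} \<in> internal_diagonals N \<Delta>'"
      using \<Delta>'(3)[of s] s by (simp add: internal_diagonals_def)
    have "{vertex 1, k, vertex s} \<in> triangles \<Delta>'" "{vertex (s + 1), k, vertex s} \<in> triangles \<Delta>'"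
      using \<Delta>'(1,2) \<Delta>'(3)[of s] \<Delta>'(3)[of "s + 1"] \<Delta>'(4)[of s] s neqs neqs [symmetric]
      by (simp_all add: triangle_iff insert_commute)
    then have step: "flip_reachable N \<Delta> x (flip_triangulation (vertex 1) (vertex (s + 1)) k (vertex s) \<Delta>')
        (flip_seed (vertex 1) (vertex (s + 1)) k (vertex s) S)"
      using flip_reachable.flip[OF reach diagonal] neqs(6) by blast
    have keep: "{p, q} \<in> flip_triangulation (vertex 1) (vertex (s + 1)) k (vertex s) \<Delta>'"
      if "{p, q} \<in> \<Delta>'" "p \<noteq> vertex s" "q \<noteq> vertex s" for p q
      using that by (auto simp: flip_triangulation_def doubleton_eq_iff)
    have "{k, vertex m} \<in> flip_triangulation (vertex 1) (vertex (s + 1)) k (vertex s) \<Delta>'"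
      if "s + 1 \<le> m" "m < N" for m
      using \<Delta>'(3)[of m] neq[of m s] neqs that by (intro keep) auto
    moreover have "{vertex m, vertex (m + 1)} \<in> flip_triangulation (vertex 1) (vertex (s + 1)) k (vertex s) \<Delta>'"
      if "s + 1 \<le> m" "m + 1 < N" for m
      using \<Delta>'(4)[of m] neq[of m s] neq[of "m + 1" s] that by (intro keep) auto
    moreover have "{k, vertex 1} \<in> flip_triangulation (vertex 1) (vertex (s + 1)) k (vertex s) \<Delta>'"
      using \<Delta>'(2) neqs by (intro keep) auto
    moreover have "{vertex 1, vertex (s + 1)} \<in> flip_triangulation (vertex 1) (vertex (s + 1)) k (vertex s) \<Delta>'"
      by (simp add: flip_triangulation_def)
    ultimately show ?case
      using step unfolding s_def
      by (intro exI[of _ "flip_triangulation (vertex 1) (vertex (s + 1)) k (vertex s) \<Delta>'"]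
          exI[of _ "flip_seed (vertex 1) (vertex (s + 1)) k (vertex s) S"]) (auto simp: s_def)
  qed
  from this[of n] show ?thesis by (auto simp: insert_commute)
qed

end

section \<open>A configuration of flags with prescribed fan coordinates\<close>

text \<open>Vectors and covectors for the positions \<open>0, \<dots>, M\<close> with prescribed values on the edges and triangles of the fan:
\<open>z\<close> and \<open>c\<close> on the spokes out of and into the fan vertex, \<open>A m\<close> on the triangle with vertices \<open>0\<close>, \<open>m\<close>, \<open>m + 1\<close>, and
\<open>r m\<close>, \<open>l m\<close> on the boundary edges from \<open>m\<close> to its successor and predecessor.\<close>

locale fan_vectors =
  fixes M :: nat and z c A r l :: "nat \<Rightarrow> 'a::field"
  assumes M: "M \<ge> 2"
    and nonzero: "\<And>m. 1 \<le> m \<Longrightarrow> m \<le> M \<Longrightarrow> z m \<noteq> 0 \<and> c m \<noteq> 0"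
      "\<And>m. 1 \<le> m \<Longrightarrow> m < M \<Longrightarrow> A m \<noteq> 0"
begin

text \<open>The difference of the heights (the ratios of second to third coordinate) of the vectors \<open>m\<close> and \<open>m + 1\<close>, as forced
by the determinant \<open>A m\<close>.\<close>

definition weight :: "nat \<Rightarrow> 'a" where
  "weight m = A m / (z m * z (m + 1))"

text \<open>Divide the difference of the scaled vectors \<open>m\<close> and \<open>m + 1\<close> by \<open>weight m\<close>: this is a vector \<open>(P, 1, 0)\<close>, where \<open>P\<close> is
\<open>total_shear m\<close>.  The values of the \<open>m\<close>-th covector on its two neighbours force \<open>P\<close> to drop by \<open>shear m\<close> from \<open>m - 1\<close>
to \<open>m\<close>.\<close>

definition shear :: "nat \<Rightarrow> 'a" where
  "shear m = z m / c m * (r m / A m + l m / A (m - 1))"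

definition total_shear :: "nat \<Rightarrow> 'a" where
  "total_shear m = - (\<Sum>s\<in>{2..<m+1}. shear s)"

definition height :: "nat \<Rightarrow> 'a" where
  "height m = - (\<Sum>s\<in>{1..<m}. weight s)"

definition offset :: "nat \<Rightarrow> 'a" where
  "offset m = - (\<Sum>s\<in>{1..<m}. total_shear s * weight s)"

text \<open>The second coordinate of the covector \<open>m\<close>, forced by its value on the preceding vector; the first vertex has no predecessor
on the boundary other than the fan vertex, so there the value on the following vector is used.\<close>

definition slope :: "nat \<Rightarrow> 'a" where
  "slope m = (if m = 1 then - r 1 * z 1 / A 1 else l m * z m / A (m - 1) - c m * total_shear (m - 1))"

definition vector :: "nat \<Rightarrow> 'a \<times> 'a \<times> 'a" where
  "vector m = (if m = 0 then (1, 0, 0) else (z m * offset m, z m * height m, z m))"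

definition covector :: "nat \<Rightarrow> 'a \<times> 'a \<times> 'a" where
  "covector m = (if m = 0 then (0, 0, 1) else (c m, slope m, - c m * offset m - slope m * height m))"

lemma height_Suc: "1 \<le> m \<Longrightarrow> height (m + 1) = height m - weight m"
  by (simp add: height_def)

lemma offset_Suc: "1 \<le> m \<Longrightarrow> offset (m + 1) = offset m - total_shear m * weight m"
  by (simp add: offset_def)

lemma total_shear_1 [simp]: "total_shear (Suc 0) = 0"
  by (simp add: total_shear_def)

lemma total_shear_Suc: "1 \<le> m \<Longrightarrow> total_shear (m + 1) = total_shear m - shear (m + 1)"
  by (simp add: total_shear_def)

lemma pairing_covector_vector:
  "1 \<le> p \<Longrightarrow> 1 \<le> q \<Longrightarrow> pairing (covector p) (vector q) =
     z q * (c p * (offset q - offset p) + slope p * (height q - height p))"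
  by (simp add: pairing_def vector_def covector_def algebra_simps)

lemma pairing_self: "pairing (covector m) (vector m) = 0"
  by (simp add: pairing_def vector_def covector_def algebra_simps)

lemma pairing_vertex: "1 \<le> m \<Longrightarrow> pairing (covector 0) (vector m) = z m" "1 \<le> m \<Longrightarrow> pairing (covector m) (vector 0) = c m"
  by (simp_all add: pairing_def vector_def covector_def)

lemma det3_triangle:
  assumes "1 \<le> m" "m < M"
  shows "det3 (vector 0) (vector m) (vector (m + 1)) = A m"
proof -
  have "z m \<noteq> 0" "z (m + 1) \<noteq> 0" using nonzero(1)[of m] nonzero(1)[of "m + 1"] assms by auto
  then have "z m * z (m + 1) * weight m = A m" by (simp add: weight_def)
  moreover have "det3 (vector 0) (vector m) (vector (m + 1)) = z m * z (m + 1) * (height m - height (m + 1))"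
    using assms by (simp add: det3_def vector_def algebra_simps)
  moreover have "height m - height (m + 1) = weight m"
    using height_Suc[of m] assms by simp
  ultimately show ?thesis by simp
qed

text \<open>The value on the following vector forces the same slope.  This is the equation that \<open>shear\<close> is made to solve.\<close>

lemma slope_alt:
  assumes "1 \<le> m" "m < M"
  shows "slope m = - c m * total_shear m - r m * z m / A m"
proof (cases "m = 1")
  case True
  then show ?thesis by (simp add: slope_def)
next
  case False
  define s where "s = m - 1"
  have m: "m = s + 1" "1 \<le> s" using False assms by (simp_all add: s_def)
  have "c m \<noteq> 0" using nonzero(1)[of m] assms by simp
  then have "c m * shear m = z m * (r m / A m + l m / A s)"
    by (simp add: shear_def m)
  then show ?thesis
    using m(2) unfolding m(1) total_shear_Suc[OF m(2)] by (simp add: slope_def algebra_simps)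
qed

lemma pairing_next:
  assumes "1 \<le> m" "m < M"
  shows "pairing (covector m) (vector (m + 1)) = r m"
proof -
  have nz: "z m \<noteq> 0" "z (m + 1) \<noteq> 0" "A m \<noteq> 0"
    using nonzero(1)[of m] nonzero(1)[of "m + 1"] nonzero(2)[of m] assms by auto
  have "pairing (covector m) (vector (m + 1)) = - (z (m + 1) * weight m * (c m * total_shear m + slope m))"
    using assms by (simp add: pairing_covector_vector offset_Suc[simplified] height_Suc[simplified] algebra_simps)
  also have "\<dots> = r m"
    using nz by (simp add: slope_alt[OF assms] weight_def)
  finally show ?thesis .
qed

lemma pairing_previous:
  assumes "1 \<le> m" "m < M"
  shows "pairing (covector (m + 1)) (vector m) = l (m + 1)"
proof -
  have nz: "z m \<noteq> 0" "z (m + 1) \<noteq> 0" "A m \<noteq> 0"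
    using nonzero(1)[of m] nonzero(1)[of "m + 1"] nonzero(2)[of m] assms by auto
  have "pairing (covector (m + 1)) (vector m) = z m * weight m * (c (m + 1) * total_shear m + slope (m + 1))"
    using assms by (simp add: pairing_covector_vector offset_Suc[simplified] height_Suc[simplified] algebra_simps)
  also have "\<dots> = l (m + 1)"
    using nz assms by (simp add: slope_def weight_def)
  finally show ?thesis .
qed

text \<open>The part of a term of the expansion that depends on the second lattice coordinate \<open>b\<close>: the boundary edges are passed in the
order \<open>l M\<close>, \<open>r (M - 1)\<close>, \<open>l (M - 1)\<close>, \<open>r (M - 2)\<close>, and so on.\<close>

definition term_factor :: "nat \<Rightarrow> 'a" where
  "term_factor b = (let s = M - (b + 1) div 2 in z s / c s * (if even b then l s / A (s - 1) else r s / A s))"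

text \<open>By induction on \<open>a\<close>: a step subtracts one shear from the total shear, which contributes two factors, one for each of the two
boundary edges that leave the vertex.\<close>

lemma sum_term_factor:
  assumes "a + 2 \<le> M"
  shows "c M * total_shear (M - 1 - a) + slope M = c M * (\<Sum>b\<le>2*a. term_factor b)"
  using assms
proof (induction a)
  case 0
  have "c M \<noteq> 0" using nonzero(1)[of M] M by simp
  then show ?case using M by (simp add: slope_def term_factor_def)
next
  case (Suc a)
  define m where "m = M - 2 - a"
  have m: "1 \<le> m" "M - Suc 0 - a = m + 1" "M - Suc (Suc a) = m" "M - 1 - a = m + 1" "M - 1 - Suc a = m"
    using Suc.prems by (auto simp: m_def)
  have factors: "term_factor (2 * a + 1) + term_factor (2 * a + 2) = shear (m + 1)"
  proof -
    have "M - (2 * a + 1 + 1) div 2 = m + 1" "M - (2 * a + 2 + 1) div 2 = m + 1"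
      using Suc.prems by (auto simp: m_def)
    then show ?thesis
      unfolding term_factor_def shear_def Let_def by (simp add: algebra_simps)
  qed
  have "(\<Sum>b\<le>2 * Suc a. term_factor b) = (\<Sum>b\<le>2 * a. term_factor b) + (term_factor (2 * a + 1) + term_factor (2 * a + 2))"
    by simp
  then have "c M * (\<Sum>b\<le>2 * Suc a. term_factor b) = c M * total_shear (m + 1) + slope M + c M * shear (m + 1)"
    using Suc unfolding factors by (simp only: m distrib_left)
  then show ?case
    unfolding m(5) total_shear_Suc[OF m(1)] by (simp add: algebra_simps)
qed

text \<open>The vector \<open>1\<close> is the sum of the differences of consecutive scaled vectors and of a multiple of the vector \<open>M\<close>, which
the covector \<open>M\<close> kills.\<close>

lemma pairing_longest:
  "pairing (covector M) (vector 1) =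
     (\<Sum>a\<le>M-2. \<Sum>b\<le>2*a. z 1 * c M * weight (M - 1 - a) * term_factor b)"
proof -
  have "pairing (covector M) (vector 1) = z 1 * (\<Sum>m\<in>{1..<M}. weight m * (c M * total_shear m + slope M))"
    using M by (simp add: pairing_covector_vector offset_def height_def sum_distrib_left sum.distrib algebra_simps)
  also have "(\<Sum>m\<in>{1..<M}. weight m * (c M * total_shear m + slope M)) =
      (\<Sum>a\<le>M-2. weight (M - 1 - a) * (c M * total_shear (M - 1 - a) + slope M))"
    using M by (intro sum.reindex_bij_witness[of _ "\<lambda>a. M - 1 - a" "\<lambda>m. M - 1 - m"]) auto
  also have "\<dots> = (\<Sum>a\<le>M-2. weight (M - 1 - a) * (c M * (\<Sum>b\<le>2*a. term_factor b)))"
    using M by (intro sum.cong refl) (subst sum_term_factor, auto)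
  finally show ?thesis
    by (simp add: sum_distrib_left mult.assoc mult.left_commute)
qed

end

section \<open>The Laurent expansion of the longest edge variable\<close>

context fan
begin

definition spoke_out :: "nat \<Rightarrow> node" where
  "spoke_out m = Edge k (vertex m)"

definition spoke_in :: "nat \<Rightarrow> node" where
  "spoke_in m = Edge (vertex m) k"

definition sector :: "nat \<Rightarrow> node" where
  "sector m = Tri {k, vertex m, vertex (m + 1)}"

definition rim_next :: "nat \<Rightarrow> node" where
  "rim_next m = Edge (vertex m) (vertex (m + 1))"

definition rim_prev :: "nat \<Rightarrow> node" where
  "rim_prev m = Edge (vertex m) (vertex (m - 1))"

lemmas fan_node_defs = spoke_out_def spoke_in_def sector_def rim_next_def rim_prev_def

lemma clockwise_vertex:
  assumes "a < b" "b < c" "c < N"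
  shows "clockwise (vertex a) (vertex b) (vertex c)"
  using assms vertex_eq[of a] vertex_eq[of b] vertex_eq[of c] k
  unfolding clockwise_def by (simp split: if_splits; linarith)

lemma clockwise_sector: "1 \<le> m \<Longrightarrow> m \<le> n + 1 \<Longrightarrow> clockwise k (vertex m) (vertex (m + 1))"
  using clockwise_vertex[of 0 m "m + 1"] N_bounds by simp

lemma flag_function_fan:
  "flag_function f v (spoke_out m) = pairing (f k) (v (vertex m))"
  "flag_function f v (spoke_in m) = pairing (f (vertex m)) (v k)"
  "flag_function f v (rim_next m) = pairing (f (vertex m)) (v (vertex (m + 1)))"
  "flag_function f v (rim_prev m) = pairing (f (vertex m)) (v (vertex (m - 1)))"
  "1 \<le> m \<Longrightarrow> m \<le> n + 1 \<Longrightarrow>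
     flag_function f v (sector m) = det3 (v k) (v (vertex m)) (v (vertex (m + 1)))"
  using flag_function_Tri[OF clockwise_sector[of m]] by (simp_all add: fan_node_defs del: flag_function.simps(2))

lemma fan_nodes:
  "1 \<le> m \<Longrightarrow> m \<le> n + 2 \<Longrightarrow> spoke_out m \<in> nodes \<Delta>"
  "1 \<le> m \<Longrightarrow> m \<le> n + 2 \<Longrightarrow> spoke_in m \<in> nodes \<Delta>"
  "1 \<le> m \<Longrightarrow> m \<le> n + 1 \<Longrightarrow> sector m \<in> nodes \<Delta>"
  "1 \<le> m \<Longrightarrow> m \<le> n + 1 \<Longrightarrow> rim_next m \<in> nodes \<Delta>"
  "2 \<le> m \<Longrightarrow> m \<le> n + 2 \<Longrightarrow> rim_prev m \<in> nodes \<Delta>"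
proof -
  show "1 \<le> m \<Longrightarrow> m \<le> n + 2 \<Longrightarrow> spoke_out m \<in> nodes \<Delta>"
    using edge_iff[of 0 m] N_bounds by (auto simp: nodes_def spoke_out_def)
  show "1 \<le> m \<Longrightarrow> m \<le> n + 2 \<Longrightarrow> spoke_in m \<in> nodes \<Delta>"
    using edge_iff[of m 0] N_bounds by (auto simp: nodes_def spoke_in_def)
  show "1 \<le> m \<Longrightarrow> m \<le> n + 1 \<Longrightarrow> sector m \<in> nodes \<Delta>"
    using fan_triangle[of m] by (auto simp: nodes_def sector_def)
  show "1 \<le> m \<Longrightarrow> m \<le> n + 1 \<Longrightarrow> rim_next m \<in> nodes \<Delta>"
    using edge_iff[of m "m + 1"] N_bounds by (auto simp: nodes_def rim_next_def)
  show "2 \<le> m \<Longrightarrow> m \<le> n + 2 \<Longrightarrow> rim_prev m \<in> nodes \<Delta>"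
    using edge_iff[of m "m - 1"] N_bounds by (auto simp: nodes_def rim_prev_def)
qed

lemma fan_node_cases:
  assumes "u \<in> nodes \<Delta>"
  obtains (spoke_out) m where "1 \<le> m" "m \<le> n + 2" "u = spoke_out m"
    | (spoke_in) m where "1 \<le> m" "m \<le> n + 2" "u = spoke_in m"
    | (sector) m where "1 \<le> m" "m \<le> n + 1" "u = sector m"
    | (rim_next) m where "1 \<le> m" "m \<le> n + 1" "u = rim_next m"
    | (rim_prev) m where "2 \<le> m" "m \<le> n + 2" "u = rim_prev m"
proof -
  from assms consider p q where "u = Edge p q" "{p, q} \<in> \<Delta>" | T where "u = Tri T" "T \<in> triangles \<Delta>"
    unfolding nodes_def by blast
  then show ?thesis
  proof cases
    case 1
    obtain a b where ab: "p = vertex a" "q = vertex b" "a < N" "b < N"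
      using edge_less[OF 1(2)] vertex_position position_less by metis
    then have "a \<noteq> b" "a = 0 \<or> b = 0 \<or> b = a + 1 \<or> a = b + 1"
      using edge_iff[of a b] 1(2) by simp_all
    then consider "a = 0" "1 \<le> b" | "b = 0" "1 \<le> a" | "1 \<le> a" "b = a + 1" | "1 \<le> b" "a = b + 1"
      by linarith
    then show ?thesis
    proof cases
      case 1 then show ?thesis using that(1)[of b] ab N_bounds \<open>u = Edge p q\<close> by (simp add: spoke_out_def)
    next
      case 2 then show ?thesis using that(2)[of a] ab N_bounds \<open>u = Edge p q\<close> by (simp add: spoke_in_def)
    next
      case 3 then show ?thesis using that(4)[of a] ab N_bounds \<open>u = Edge p q\<close> by (simp add: rim_next_def)
    next
      case 4 then show ?thesis using that(5)[of a] ab N_bounds \<open>u = Edge p q\<close> by (simp add: rim_prev_def)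
    qed
  next
    case 2
    then show ?thesis using that(3) unfolding triangles_fan sector_def by auto
  qed
qed

text \<open>The Laurent monomial at the lattice point \<open>(a, b)\<close>, with \<open>m\<close> and \<open>s\<close> as in the expansion.  The constraint
\<open>b \<le> 2a\<close> is \<open>m < s\<close>.  An odd \<open>b\<close> is positive, so \<open>s\<close> is then not the last vertex, which has no following boundary edge.\<close>

definition fan_monomial :: "nat \<Rightarrow> nat \<Rightarrow> monomial" where
  "fan_monomial a b =
     (let X = \<lambda>v. Poly_Mapping.single v 1; m = n + 1 - a; s = n + 2 - (b + 1) div 2
      in X (spoke_out 1) + X (spoke_in (n + 2)) + (X (sector m) - (X (spoke_out m) + X (spoke_out (m + 1))))
         + (X (spoke_out s) - X (spoke_in s))
         + (if even b then X (rim_prev s) - X (sector (s - 1)) else X (rim_next s) - X (sector s)))"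

end

lemma keys_add_subset: "Poly_Mapping.keys m \<subseteq> V \<Longrightarrow> Poly_Mapping.keys m' \<subseteq> V \<Longrightarrow> Poly_Mapping.keys (m + m') \<subseteq> V"
  using Poly_Mapping.keys_add[of m m'] by blast

lemma keys_diff_subset:
  fixes m m' :: monomial
  shows "Poly_Mapping.keys m \<subseteq> V \<Longrightarrow> Poly_Mapping.keys m' \<subseteq> V \<Longrightarrow> Poly_Mapping.keys (m - m') \<subseteq> V"
  using Poly_Mapping.keys_diff[of m m'] by blast

locale fan_seed = fan +
  fixes x :: "node \<Rightarrow> 'a::field_char_0"
  assumes independent: "algebraically_independent_on (nodes (fan_triangulation N k)) x"
begin

lemma initial_nonzero: "u \<in> nodes \<Delta> \<Longrightarrow> x u \<noteq> 0"
  using algebraically_independent_nonzero[OF independent] .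

sublocale fan_vectors "n + 2" "\<lambda>m. x (spoke_out m)" "\<lambda>m. x (spoke_in m)" "\<lambda>m. x (sector m)"
    "\<lambda>m. x (rim_next m)" "\<lambda>m. x (rim_prev m)"
proof
  show "2 \<le> n + 2" by simp
  show "x (spoke_out m) \<noteq> 0 \<and> x (spoke_in m) \<noteq> 0" if "1 \<le> m" "m \<le> n + 2" for m
    using fan_nodes(1,2)[OF that] initial_nonzero by blast
  show "x (sector m) \<noteq> 0" if "1 \<le> m" "m < n + 2" for m
    using fan_nodes(3)[of m] that initial_nonzero by simp
qed

lemma edge_variable_longest:
  "edge_variable N \<Delta> x (vertex (n + 2)) (vertex 1) = pairing (covector (n + 2)) (vector 1)"
proof -
  let ?F = "flag_function (\<lambda>p. covector (position p)) (\<lambda>p. vector (position p))"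
  have pos: "position (vertex m) = m" if "m \<le> n + 2" for m
    using position_vertex[of m] that N_bounds by simp
  have pos_k: "position k = 0"
    using pos[of 0] by simp
  obtain \<Delta>' S where \<Delta>': "flip_reachable N \<Delta> x \<Delta>' S" "{vertex (n + 2), vertex 1} \<in> \<Delta>'"
    using longest_edge_reachable by blast
  have "x u = ?F u" if "u \<in> nodes \<Delta>" for u
    using that
  proof (cases rule: fan_node_cases)
    case (spoke_out m)
    then show ?thesis
      using pairing_vertex(1)[of m] pos[of m] pos_k by (simp add: flag_function_fan del: flag_function.simps)
  next
    case (spoke_in m)
    then show ?thesis
      using pairing_vertex(2)[of m] pos[of m] pos_k by (simp add: flag_function_fan del: flag_function.simps)
  next
    case (sector m)
    then show ?thesis
      using det3_triangle[of m] pos[of m] pos[of "m + 1"] pos_k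
      by (simp add: flag_function_fan del: flag_function.simps)
  next
    case (rim_next m)
    then show ?thesis
      using pairing_next[of m] pos[of m] pos[of "m + 1"] by (simp add: flag_function_fan del: flag_function.simps)
  next
    case (rim_prev m)
    then show ?thesis
      using pairing_previous[of "m - 1"] pos[of m] pos[of "m - 1"]
      by (simp add: flag_function_fan del: flag_function.simps)
  qed
  then have "edge_variable N \<Delta> x (vertex (n + 2)) (vertex 1) = ?F (Edge (vertex (n + 2)) (vertex 1))"
    by (intro edge_variable_eqI[OF noncrossing_fan independent flag_function_ptolemaic _ \<Delta>'])
      (simp_all add: pairing_self)
  then show ?thesis
    using pos[of "n + 2"] pos[of 1] by simp
qed

lemma fan_monomial_keys_value:
  assumes "a \<le> n" "b \<le> 2 * a"
  shows "Poly_Mapping.keys (fan_monomial a b) \<subseteq> nodes \<Delta>"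
    "monomial_value x (fan_monomial a b) = x (spoke_out 1) * x (spoke_in (n + 2)) * weight (n + 1 - a) * term_factor b"
proof -
  define m where "m = n + 1 - a"
  define s where "s = n + 2 - (b + 1) div 2"
  define P :: "monomial \<Rightarrow> 'a \<Rightarrow> bool" where
    "P \<mu> y \<longleftrightarrow> Poly_Mapping.keys \<mu> \<subseteq> nodes \<Delta> \<and> monomial_value x \<mu> = y" for \<mu> y
  have single: "P (Poly_Mapping.single v 1) (x v)" if "v \<in> nodes \<Delta>" for v
    using that by (simp add: P_def)
  have add: "P (\<mu> + \<nu>) (y * w)" and diff: "P (\<mu> - \<nu>) (y / w)" if "P \<mu> y" "P \<nu> w" for \<mu> \<nu> y w
  proof -
    have keys: "Poly_Mapping.keys \<mu> \<subseteq> nodes \<Delta>" "Poly_Mapping.keys \<nu> \<subseteq> nodes \<Delta>"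
      and eval: "monomial_value x \<mu> = y" "monomial_value x \<nu> = w"
      using that by (simp_all add: P_def)
    then have nz: "x v \<noteq> 0" if "v \<in> Poly_Mapping.keys \<mu> \<union> Poly_Mapping.keys \<nu>" for v
      using initial_nonzero that by blast
    have "monomial_value x (\<mu> + \<nu>) = y * w" "monomial_value x (\<mu> - \<nu>) = y / w"
      unfolding eval [symmetric] by (rule monomial_value_add monomial_value_diff; rule nz; assumption)+
    then show "P (\<mu> + \<nu>) (y * w)" "P (\<mu> - \<nu>) (y / w)"
      unfolding P_def using keys_add_subset[OF keys] keys_diff_subset[OF keys] by simp_all
  qed
  have m: "1 \<le> m" "m \<le> n + 1" and s: "2 \<le> s" "s \<le> n + 2"
    using assms by (auto simp: m_def s_def)
  have last: "P (if even b then Poly_Mapping.single (rim_prev s) 1 - Poly_Mapping.single (sector (s - 1)) 1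
        else Poly_Mapping.single (rim_next s) 1 - Poly_Mapping.single (sector s) 1)
      (if even b then x (rim_prev s) / x (sector (s - 1)) else x (rim_next s) / x (sector s))"
  proof (cases "even b")
    case True
    then show ?thesis using s by (simp add: diff single fan_nodes)
  next
    case False
    then have "s \<le> n + 1" by (auto simp: s_def elim: oddE)
    then show ?thesis using False s by (simp add: diff single fan_nodes)
  qed
  have "P (fan_monomial a b) (x (spoke_out 1) * x (spoke_in (n + 2)) *
      (x (sector m) / (x (spoke_out m) * x (spoke_out (m + 1)))) * (x (spoke_out s) / x (spoke_in s)) *
      (if even b then x (rim_prev s) / x (sector (s - 1)) else x (rim_next s) / x (sector s)))"
    unfolding fan_monomial_def Let_def m_def [symmetric] s_def [symmetric]
    by (intro add diff single last fan_nodes) (use m s in auto)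
  moreover have "x (spoke_out 1) * x (spoke_in (n + 2)) *
      (x (sector m) / (x (spoke_out m) * x (spoke_out (m + 1)))) * (x (spoke_out s) / x (spoke_in s)) *
      (if even b then x (rim_prev s) / x (sector (s - 1)) else x (rim_next s) / x (sector s)) =
      x (spoke_out 1) * x (spoke_in (n + 2)) * weight m * term_factor b"
    unfolding weight_def term_factor_def Let_def s_def [symmetric] by (simp only: mult.assoc)
  ultimately show "Poly_Mapping.keys (fan_monomial a b) \<subseteq> nodes \<Delta>"
    "monomial_value x (fan_monomial a b) = x (spoke_out 1) * x (spoke_in (n + 2)) * weight (n + 1 - a) * term_factor b"
    unfolding P_def m_def by simp_all
qed

end

context fan
begin

definition fan_index :: "(nat \<times> nat) set" where
  "fan_index = (SIGMA a:{..n}. {..2 * a})"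

text \<open>A grading of the group of Laurent monomials.\<close>

definition weighted_degree :: "(node \<Rightarrow> int) \<Rightarrow> monomial \<Rightarrow> int" where
  "weighted_degree w \<mu> = (\<Sum>v \<in> Poly_Mapping.keys \<mu>. Poly_Mapping.lookup \<mu> v * w v)"

lemma weighted_degree_add: "weighted_degree w (\<mu> + \<nu>) = weighted_degree w \<mu> + weighted_degree w \<nu>"
  unfolding weighted_degree_def by (rule setsum_keys_plus_distrib) (auto simp: algebra_simps)

lemma weighted_degree_diff: "weighted_degree w (\<mu> - \<nu>) = weighted_degree w \<mu> - weighted_degree w \<nu>"
  using weighted_degree_add[of w "\<mu> - \<nu>" \<nu>] by simp

lemma weighted_degree_single [simp]: "weighted_degree w (Poly_Mapping.single v 1) = w v"
  by (simp add: weighted_degree_def)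

lemmas weighted_degree_simps = weighted_degree_add weighted_degree_diff weighted_degree_single

text \<open>This grading reads off \<open>b\<close>: a term contains exactly one boundary edge that is not incident to the fan vertex, and the
weights number these edges in the order in which \<open>term_factor\<close> passes them.\<close>

fun rim_degree :: "node \<Rightarrow> int" where
  "rim_degree (Edge p q) =
     (if p = k \<or> q = k then 0
      else if position q = position p + 1 then 2 * (int n + 2 - int (position p)) - 1
      else if position p = position q + 1 then 2 * (int n + 2 - int (position p))
      else 0)"
| "rim_degree (Tri T) = 0"

text \<open>Once \<open>b\<close> is known, this grading determines \<open>a\<close>.\<close>

fun spoke_degree :: "node \<Rightarrow> int" where
  "spoke_degree (Edge p q) = (if p = k then int (position q) else 0)"
| "spoke_degree (Tri T) = 0"

lemma degrees:
  "rim_degree (spoke_out m) = 0" "rim_degree (spoke_in m) = 0" "rim_degree (sector m) = 0"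
  "1 \<le> m \<Longrightarrow> m \<le> n + 1 \<Longrightarrow> rim_degree (rim_next m) = 2 * (int n + 2 - int m) - 1"
  "2 \<le> m \<Longrightarrow> m \<le> n + 2 \<Longrightarrow> rim_degree (rim_prev m) = 2 * (int n + 2 - int m)"
  "m \<le> n + 2 \<Longrightarrow> spoke_degree (spoke_out m) = int m"
  "1 \<le> m \<Longrightarrow> m \<le> n + 2 \<Longrightarrow> spoke_degree (spoke_in m) = 0"
  "spoke_degree (sector m) = 0"
  "1 \<le> m \<Longrightarrow> m \<le> n + 1 \<Longrightarrow> spoke_degree (rim_next m) = 0"
  "2 \<le> m \<Longrightarrow> m \<le> n + 2 \<Longrightarrow> spoke_degree (rim_prev m) = 0"
proof -
  have pos: "position (vertex m) = m" "vertex m = k \<longleftrightarrow> m = 0" if "m \<le> n + 2" for m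
    using position_vertex[of m] vertex_eq_k[of m] that N_bounds by simp_all
  show "rim_degree (spoke_out m) = 0" "rim_degree (spoke_in m) = 0" "rim_degree (sector m) = 0"
    "spoke_degree (sector m) = 0"
    by (simp_all add: fan_node_defs)
  show "1 \<le> m \<Longrightarrow> m \<le> n + 1 \<Longrightarrow> rim_degree (rim_next m) = 2 * (int n + 2 - int m) - 1"
    "1 \<le> m \<Longrightarrow> m \<le> n + 1 \<Longrightarrow> spoke_degree (rim_next m) = 0"
    using pos[of m] pos[of "m + 1"] by (simp_all add: rim_next_def)
  show "2 \<le> m \<Longrightarrow> m \<le> n + 2 \<Longrightarrow> rim_degree (rim_prev m) = 2 * (int n + 2 - int m)"
    "2 \<le> m \<Longrightarrow> m \<le> n + 2 \<Longrightarrow> spoke_degree (rim_prev m) = 0"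
    using pos[of m] pos[of "m - 1"] by (simp_all add: rim_prev_def)
  show "m \<le> n + 2 \<Longrightarrow> spoke_degree (spoke_out m) = int m"
    "1 \<le> m \<Longrightarrow> m \<le> n + 2 \<Longrightarrow> spoke_degree (spoke_in m) = 0"
    using pos[of m] by (simp_all add: spoke_out_def spoke_in_def)
qed

lemma fan_monomial_degrees:
  assumes "a \<le> n" "b \<le> 2 * a"
  shows "weighted_degree rim_degree (fan_monomial a b) = int b"
    "weighted_degree spoke_degree (fan_monomial a b) = 2 * int a - int n - int ((b + 1) div 2)"
proof -
  define m where "m = n + 1 - a"
  define s where "s = n + 2 - (b + 1) div 2"
  have m: "1 \<le> m" "m \<le> n + 1" "int m = int n + 1 - int a" and s: "2 \<le> s" "s \<le> n + 2" "odd b \<Longrightarrow> s \<le> n + 1"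
    "int s = int n + 2 - int ((b + 1) div 2)"
    using assms by (auto simp: m_def s_def elim: oddE)
  show "weighted_degree rim_degree (fan_monomial a b) = int b"
  proof (cases "even b")
    case True
    then show ?thesis
      using m s unfolding fan_monomial_def Let_def m_def [symmetric] s_def [symmetric]
      by (simp add: weighted_degree_simps degrees) presburger
  next
    case False
    then show ?thesis
      using m s unfolding fan_monomial_def Let_def m_def [symmetric] s_def [symmetric]
      by (simp add: weighted_degree_simps degrees) presburger
  qed
  show "weighted_degree spoke_degree (fan_monomial a b) = 2 * int a - int n - int ((b + 1) div 2)"
    using m s unfolding fan_monomial_def Let_def m_def [symmetric] s_def [symmetric]
    by (simp add: weighted_degree_simps degrees)
qed

lemma inj_fan_monomial: "inj_on (case_prod fan_monomial) fan_index"
proof (rule inj_onI)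
  fix p q assume p: "p \<in> fan_index" and q: "q \<in> fan_index" and eq: "case_prod fan_monomial p = case_prod fan_monomial q"
  obtain a b a' b' where ab: "p = (a, b)" "q = (a', b')" by (cases p; cases q)
  then have "a \<le> n" "b \<le> 2 * a" "a' \<le> n" "b' \<le> 2 * a'" "fan_monomial a b = fan_monomial a' b'"
    using p q eq by (auto simp: fan_index_def)
  then have "int b = int b'" "2 * int a - int n - int ((b + 1) div 2) = 2 * int a' - int n - int ((b' + 1) div 2)"
    using fan_monomial_degrees by metis+
  then show "p = q" unfolding ab by auto
qed

end

context fan_seed
begin

text \<open>All coefficients are \<open>1\<close>, because distinct lattice points give distinct monomials.\<close>

lemma expansion_monomials_fan:
  "expansion_monomials N \<Delta> x (vertex (n + 2)) (vertex 1) = case_prod fan_monomial ` fan_index"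
proof -
  define P :: "monomial \<Rightarrow>\<^sub>0 int" where
    "P = (\<Sum>p\<in>fan_index. Poly_Mapping.single (case_prod fan_monomial p) 1)"
  have fin: "finite fan_index" by (simp add: fan_index_def)
  have keys: "Poly_Mapping.keys P = case_prod fan_monomial ` fan_index"
  proof
    show "Poly_Mapping.keys P \<subseteq> case_prod fan_monomial ` fan_index"
      unfolding P_def by (rule order.trans[OF Poly_Mapping.keys_sum]) auto
    show "case_prod fan_monomial ` fan_index \<subseteq> Poly_Mapping.keys P"
    proof
      fix \<mu> assume "\<mu> \<in> case_prod fan_monomial ` fan_index"
      then obtain p where p: "p \<in> fan_index" "\<mu> = case_prod fan_monomial p" by blast
      have "Poly_Mapping.lookup P \<mu> = (\<Sum>q\<in>fan_index. if q = p then 1 else 0)"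
        unfolding P_def lookup_sum lookup_single when_def
        by (rule sum.cong) (use inj_fan_monomial p in \<open>auto simp: inj_on_def\<close>)
      then show "\<mu> \<in> Poly_Mapping.keys P"
        using fin p by (simp add: in_keys_iff)
    qed
  qed
  have "eval_laurent x P = (\<Sum>p\<in>fan_index. monomial_value x (case_prod fan_monomial p))"
    by (simp add: P_def eval_laurent_sum)
  also have "\<dots> = (\<Sum>(a, b)\<in>fan_index. x (spoke_out 1) * x (spoke_in (n + 2)) * weight (n + 1 - a) * term_factor b)"
    by (rule sum.cong) (auto simp: fan_index_def fan_monomial_keys_value(2))
  also have "\<dots> = pairing (covector (n + 2)) (vector 1)"
    unfolding pairing_longest fan_index_def by (subst sum.Sigma) auto
  finally have "eval_laurent x P = edge_variable N \<Delta> x (vertex (n + 2)) (vertex 1)"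
    by (simp only: edge_variable_longest)
  moreover have "Poly_Mapping.keys \<mu> \<subseteq> nodes \<Delta>" if "\<mu> \<in> Poly_Mapping.keys P" for \<mu>
    using that fan_monomial_keys_value(1) unfolding keys by (auto simp: fan_index_def)
  ultimately show ?thesis
    unfolding expansion_monomials_def using laurent_expansion_eqI[OF independent] keys by metis
qed

end

section \<open>The covering relations\<close>

context fan
begin

text \<open>The contribution of the arrow \<open>p \<rightarrow> q\<close> to the monomial \<open>y_hat\<close> of the node \<open>v\<close>.\<close>

definition arrow_column :: "node \<Rightarrow> node \<Rightarrow> node \<Rightarrow> monomial" where
  "arrow_column p q v = (if v = q then Poly_Mapping.single p 1 else 0) - (if v = p then Poly_Mapping.single q 1 else 0)"

lemma sum_arrow_matrix:
  assumes "finite V" "p \<in> V" "q \<in> V"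
  shows "(\<Sum>u\<in>V. Poly_Mapping.single u (arrow_matrix p q u v)) = arrow_column p q v"
proof -
  have ind: "(\<Sum>u\<in>V. Poly_Mapping.single u (of_bool (u = p \<and> C))) = (if C then Poly_Mapping.single p (1::int) else 0)"
    if "p \<in> V" for p C
    using that assms(1) by (cases C) (simp_all add: of_bool_def if_distrib [of "Poly_Mapping.single _"] sum.delta cong: if_cong)
  have "(\<Sum>u\<in>V. Poly_Mapping.single u (arrow_matrix p q u v)) =
      (\<Sum>u\<in>V. Poly_Mapping.single u (of_bool (u = p \<and> v = q))) - (\<Sum>u\<in>V. Poly_Mapping.single u (of_bool (u = q \<and> v = p)))"
    unfolding arrow_matrix_def single_diff by (rule sum_subtractf)
  then show ?thesis
    by (simp only: ind assms arrow_column_def)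
qed

definition sector_column :: "nat \<Rightarrow> node \<Rightarrow> monomial" where
  "sector_column m v =
     arrow_column (spoke_out m) (sector m) v + arrow_column (sector m) (spoke_out (m + 1)) v
     + arrow_column (spoke_out (m + 1)) (spoke_out m) v
     + arrow_column (rim_next m) (sector m) v + arrow_column (sector m) (spoke_in m) v
     + arrow_column (spoke_in m) (rim_next m) v
     + arrow_column (spoke_in (m + 1)) (sector m) v + arrow_column (sector m) (rim_prev (m + 1)) v
     + arrow_column (rim_prev (m + 1)) (spoke_in (m + 1)) v"

lemma finite_nodes: "finite (nodes \<Delta>)"
proof -
  have "nodes \<Delta> \<subseteq> case_prod Edge ` ({..<N} \<times> {..<N}) \<union> Tri ` triangles \<Delta>"
    unfolding nodes_def using edge_less by force
  moreover have "finite (triangles \<Delta>)" unfolding triangles_fan by simp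
  ultimately show ?thesis using finite_subset by blast
qed

abbreviation "sector_set m \<equiv> {k, vertex m, vertex (m + 1)}"

lemma sum_sector_arrows:
  assumes "1 \<le> m" "m \<le> n + 1"
  shows "(\<Sum>u\<in>nodes \<Delta>. Poly_Mapping.single u (triangle_arrows (sector m) (spoke_out m) (spoke_out (m + 1))
     (rim_next m) (spoke_in m) (spoke_in (m + 1)) (rim_prev (m + 1)) u v)) = sector_column m v"
proof -
  note nodes = fan_nodes(1)[of m] fan_nodes(1)[of "m + 1"] fan_nodes(2)[of m] fan_nodes(2)[of "m + 1"]
    fan_nodes(3)[of m] fan_nodes(4)[of m] fan_nodes(5)[of "m + 1"]
  show ?thesis
    unfolding triangle_arrows_def single_add sum.distrib sector_column_def
    by (intro arg_cong2[where f = "(+)"] sum_arrow_matrix finite_nodes nodes) (use assms in auto)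
qed

lemma sector_set_subset_iff: "1 \<le> m \<Longrightarrow> m \<le> n + 2 \<Longrightarrow> 1 \<le> s \<Longrightarrow> s \<le> n + 1 \<Longrightarrow> vertex m \<in> sector_set s \<longleftrightarrow> m = s \<or> m = s + 1"
  using vertex_eq_iff[of m s] vertex_eq_iff[of m "s + 1"] vertex_eq_k[of m] N_bounds by auto

lemma inj_sector_set: "inj_on sector_set {1..n+1}"
proof (rule inj_onI)
  fix m s assume ms: "m \<in> {1..n+1}" "s \<in> {1..n+1}" "sector_set m = sector_set s"
  then have "vertex m \<in> sector_set s" "vertex (m + 1) \<in> sector_set s" by auto
  then show "m = s"
    using sector_set_subset_iff[of m s] sector_set_subset_iff[of "m + 1" s] ms by auto
qed

lemma y_hat_insert:
  assumes "1 \<le> m" "m \<le> n + 1" "sector_set m \<notin> S"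
  shows "(\<Sum>u\<in>nodes \<Delta>. Poly_Mapping.single u (triangle_quiver (insert (sector_set m) S) u v)) =
    (\<Sum>u\<in>nodes \<Delta>. Poly_Mapping.single u (triangle_quiver S u v)) + sector_column m v"
proof -
  have "triangle_quiver (insert (sector_set m) S) u v = triangle_quiver S u v +
     triangle_arrows (sector m) (spoke_out m) (spoke_out (m + 1))
     (rim_next m) (spoke_in m) (spoke_in (m + 1)) (rim_prev (m + 1)) u v" for u
    using triangle_quiver_insert[OF clockwise_sector[OF assms(1,2)] assms(3), of u v]
    by (simp add: fan_node_defs)
  then show ?thesis
    by (simp only: single_add sum.distrib sum_sector_arrows[OF assms(1,2)])
qed

lemma y_hat_sum: "y_hat \<Delta> v = (\<Sum>u\<in>nodes \<Delta>. Poly_Mapping.single u (triangle_quiver (triangles \<Delta>) u v))"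
  by (simp only: y_hat_def quiver_eq_triangle_quiver)

lemma y_hat_sector_column:
  assumes m: "1 \<le> m" "m \<le> n + 1"
  shows "y_hat \<Delta> (sector m) = sector_column m (sector m)"
proof -
  have zero: "triangle_quiver (triangles \<Delta> - {sector_set m}) u (sector m) = 0" for u
    unfolding sector_def by (rule triangle_quiver_Tri_eq_0) simp
  have "triangles \<Delta> = insert (sector_set m) (triangles \<Delta> - {sector_set m})"
    using fan_triangle[OF m] by blast
  then have "y_hat \<Delta> (sector m) = (\<Sum>u\<in>nodes \<Delta>. Poly_Mapping.single u
      (triangle_quiver (insert (sector_set m) (triangles \<Delta> - {sector_set m})) u (sector m)))"
    using y_hat_sum by simp
  also have "\<dots> = (\<Sum>u\<in>nodes \<Delta>. Poly_Mapping.single u (triangle_quiver (triangles \<Delta> - {sector_set m}) u (sector m)))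
      + sector_column m (sector m)"
    by (rule y_hat_insert[OF m]) simp
  finally show ?thesis by (simp only: zero single_zero sum.neutral_const add_0)
qed

text \<open>A diagonal belongs to the two triangles next to it.\<close>

lemma y_hat_spoke_column:
  assumes m: "2 \<le> m" "m \<le> n + 1" and v: "v = spoke_out m \<or> v = spoke_in m"
  shows "y_hat \<Delta> v = sector_column m v + sector_column (m - 1) v"
proof -
  let ?S = "triangles \<Delta> - {sector_set m, sector_set (m - 1)}"
  have neq: "sector_set m \<noteq> sector_set (m - 1)"
  proof -
    have "m \<in> {1..n+1}" "m - 1 \<in> {1..n+1}" "m \<noteq> m - 1" using m by auto
    then show ?thesis using inj_on_eq_iff[OF inj_sector_set] by blast
  qed
  have zero: "triangle_quiver ?S u v = 0" for u
  proof -
    have "vertex m \<notin> T" if T: "T \<in> ?S" for T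
    proof
      assume "vertex m \<in> T"
      have "T \<in> sector_set ` {1..n+1}"
        using T unfolding triangles_fan by (rule DiffD1)
      then obtain s where "T = sector_set s" "s \<in> {1..n+1}"
        by (rule imageE)
      then have s: "T = sector_set s" "1 \<le> s" "s \<le> n + 1" by simp_all
      then have "m = s \<or> m = s + 1"
        using sector_set_subset_iff[of m s] m \<open>vertex m \<in> T\<close> by simp
      then have "s = m \<or> s = m - 1" by auto
      then show False using T s(1) by blast
    qed
    then show ?thesis
      using v triangle_quiver_Edge_eq_0(2)[of ?S k "vertex m" u] triangle_quiver_Edge_eq_0(2)[of ?S "vertex m" k u]
      unfolding spoke_out_def spoke_in_def by blast
  qed
  have "triangles \<Delta> = insert (sector_set (m - 1)) (insert (sector_set m) ?S)"
    using fan_triangle[of m] fan_triangle[of "m - 1"] m by auto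
  then have "y_hat \<Delta> v = (\<Sum>u\<in>nodes \<Delta>. Poly_Mapping.single u
      (triangle_quiver (insert (sector_set (m - 1)) (insert (sector_set m) ?S)) u v))"
    using y_hat_sum by simp
  also have "\<dots> = (\<Sum>u\<in>nodes \<Delta>. Poly_Mapping.single u (triangle_quiver (insert (sector_set m) ?S) u v))
      + sector_column (m - 1) v"
    by (rule y_hat_insert) (use m neq in auto)
  also have "(\<Sum>u\<in>nodes \<Delta>. Poly_Mapping.single u (triangle_quiver (insert (sector_set m) ?S) u v)) =
      (\<Sum>u\<in>nodes \<Delta>. Poly_Mapping.single u (triangle_quiver ?S u v)) + sector_column m v"
    by (rule y_hat_insert) (use m in auto)
  finally show ?thesis by (simp only: zero single_zero sum.neutral_const add_0)
qed

lemma fan_nodes_eq_iff: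
  assumes "1 \<le> m" "m \<le> n + 2" "1 \<le> s" "s \<le> n + 2"
  shows "spoke_out m = spoke_out s \<longleftrightarrow> m = s" "spoke_in m = spoke_in s \<longleftrightarrow> m = s"
    "spoke_out m \<noteq> spoke_in s" "spoke_in m \<noteq> spoke_out s"
    "m \<le> n + 1 \<Longrightarrow> s \<le> n + 1 \<Longrightarrow> sector m = sector s \<longleftrightarrow> m = s"
    "spoke_out m \<noteq> sector s" "sector s \<noteq> spoke_out m" "spoke_in m \<noteq> sector s" "sector s \<noteq> spoke_in m"
    "s \<le> n + 1 \<Longrightarrow> spoke_out m \<noteq> rim_next s" "s \<le> n + 1 \<Longrightarrow> spoke_in m \<noteq> rim_next s" "sector m \<noteq> rim_next s"
    "2 \<le> s \<Longrightarrow> spoke_out m \<noteq> rim_prev s" "2 \<le> s \<Longrightarrow> spoke_in m \<noteq> rim_prev s" "sector m \<noteq> rim_prev s"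
proof -
  have vk: "vertex a \<noteq> k" if "1 \<le> a" "a \<le> n + 2" for a
    using vertex_eq_k[of a] that N_bounds by simp
  have v: "vertex m = vertex s \<longleftrightarrow> m = s"
    using vertex_eq_iff[of m s] assms N_bounds by simp
  have ks: "k \<noteq> vertex m" "k \<noteq> vertex s" using vk[of m] vk[of s] assms by auto
  show "spoke_out m = spoke_out s \<longleftrightarrow> m = s" "spoke_in m = spoke_in s \<longleftrightarrow> m = s"
    "spoke_out m \<noteq> spoke_in s" "spoke_in m \<noteq> spoke_out s"
    "spoke_out m \<noteq> sector s" "sector s \<noteq> spoke_out m" "spoke_in m \<noteq> sector s" "sector s \<noteq> spoke_in m"
    "sector m \<noteq> rim_next s" "sector m \<noteq> rim_prev s"
    using v ks by (simp_all add: fan_node_defs)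
  show "m \<le> n + 1 \<Longrightarrow> s \<le> n + 1 \<Longrightarrow> sector m = sector s \<longleftrightarrow> m = s"
    using inj_on_eq_iff[OF inj_sector_set, of m s] assms by (simp add: sector_def)
  show "s \<le> n + 1 \<Longrightarrow> spoke_out m \<noteq> rim_next s" "s \<le> n + 1 \<Longrightarrow> spoke_in m \<noteq> rim_next s"
    using ks vk[of "s + 1"] by (auto simp: fan_node_defs)
  show "2 \<le> s \<Longrightarrow> spoke_out m \<noteq> rim_prev s" "2 \<le> s \<Longrightarrow> spoke_in m \<noteq> rim_prev s"
  proof -
    have "vertex (s - 1) \<noteq> k" if "2 \<le> s"
      using vk[of "s - 1"] that assms by simp
    then show "2 \<le> s \<Longrightarrow> spoke_out m \<noteq> rim_prev s" "2 \<le> s \<Longrightarrow> spoke_in m \<noteq> rim_prev s"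
      using ks by (auto simp: fan_node_defs)
  qed
qed

abbreviation X :: "node \<Rightarrow> monomial" where
  "X v \<equiv> Poly_Mapping.single v 1"

lemma y_hat_sector:
  assumes "1 \<le> m" "m \<le> n + 1"
  shows "y_hat \<Delta> (sector m) = X (spoke_out m) + X (rim_next m) + X (spoke_in (m + 1))
    - X (spoke_out (m + 1)) - X (spoke_in m) - X (rim_prev (m + 1))"
  unfolding y_hat_sector_column[OF assms] sector_column_def arrow_column_def
  using assms by (simp add: fan_nodes_eq_iff)

lemma y_hat_spoke_out:
  assumes "1 \<le> m" "m \<le> n"
  shows "y_hat \<Delta> (spoke_out (m + 1)) = X (sector m) + X (spoke_out (m + 2)) - X (sector (m + 1)) - X (spoke_out m)"
  using assms y_hat_spoke_column[of "m + 1" "spoke_out (m + 1)"]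
  unfolding sector_column_def arrow_column_def
  by (simp add: fan_nodes_eq_iff)

lemma y_hat_spoke_in:
  assumes "1 \<le> m" "m \<le> n"
  shows "y_hat \<Delta> (spoke_in (m + 1)) = X (sector (m + 1)) + X (rim_prev (m + 1)) - X (rim_next (m + 1)) - X (sector m)"
  using assms y_hat_spoke_column[of "m + 1" "spoke_in (m + 1)"]
  unfolding sector_column_def arrow_column_def
  by (simp add: fan_nodes_eq_iff)

lemma fan_monomial_Suc_left:
  assumes "a + 1 \<le> n"
  shows "fan_monomial (a + 1) b = y_hat \<Delta> (spoke_out (n + 1 - a)) + fan_monomial a b"
proof -
  define m where "m = n - a"
  have m: "1 \<le> m" "m \<le> n" "n + 1 - (a + 1) = m" "n + 1 - a = m + 1"
    using assms by (auto simp: m_def)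
  show ?thesis
    unfolding fan_monomial_def Let_def m(3,4) y_hat_spoke_out[OF m(1,2)]
    by (simp add: algebra_simps)
qed

lemma fan_monomial_Suc_right:
  assumes "a \<le> n" "b + 1 \<le> 2 * a"
  shows "fan_monomial a (b + 1) =
    y_hat \<Delta> (if even b then sector (n + 1 - b div 2) else spoke_in (n + 1 - b div 2)) + fan_monomial a b"
proof -
  define m where "m = n - b div 2"
  show ?thesis
  proof (cases "even b")
    case True
    then have m: "1 \<le> m + 1" "m + 1 \<le> n + 1" "n + 1 - b div 2 = m + 1"
      "n + 2 - (b + 1 + 1) div 2 = m + 1" "n + 2 - (b + 1) div 2 = m + 2" "even (b + 1) = False" "even b = True"
      using assms by (auto simp: m_def)
    show ?thesis
      unfolding fan_monomial_def Let_def m(3-7) if_True if_False y_hat_sector[OF m(1,2)]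
      by (simp add: algebra_simps)
  next
    case False
    then have m: "1 \<le> m" "m \<le> n" "n + 1 - b div 2 = m + 1"
      "n + 2 - (b + 1 + 1) div 2 = m + 1" "n + 2 - (b + 1) div 2 = m + 1" "even (b + 1) = True" "even b = False"
      using assms by (auto simp: m_def elim!: oddE)
    show ?thesis
      unfolding fan_monomial_def Let_def m(3-7) if_True if_False y_hat_spoke_in[OF m(1,2)]
      by (simp add: algebra_simps)
  qed
qed

lemma mutable_node_cases:
  assumes "v \<in> mutable_nodes N \<Delta>"
  obtains (spoke_out) m where "1 \<le> m" "m \<le> n" "v = spoke_out (m + 1)"
    | (spoke_in) m where "1 \<le> m" "m \<le> n" "v = spoke_in (m + 1)"
    | (sector) m where "1 \<le> m" "m \<le> n + 1" "v = sector m"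
proof -
  from assms consider p q where "v = Edge p q" "{p, q} \<in> internal_diagonals N \<Delta>" | T where "v = Tri T" "T \<in> triangles \<Delta>"
    unfolding mutable_nodes_def by blast
  then show ?thesis
  proof cases
    case 1
    then have "{p, q} \<in> \<Delta>" by (simp add: internal_diagonals_def)
    then obtain a b where ab: "p = vertex a" "q = vertex b" "a < N" "b < N"
      using edge_less vertex_position position_less by metis
    then consider "a = 0" "b \<in> {2..n+1}" | "b = 0" "a \<in> {2..n+1}"
      using internal_diagonal_iff[of a b] 1(2) by blast
    then show ?thesis
    proof cases
      case 1
      then have "1 \<le> b - 1" "b - 1 \<le> n" "b - 1 + 1 = b" by auto
      then show ?thesis using that(1)[of "b - 1"] ab 1(1) \<open>v = Edge p q\<close> by (simp add: spoke_out_def)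
    next
      case 2
      then have "1 \<le> a - 1" "a - 1 \<le> n" "a - 1 + 1 = a" by auto
      then show ?thesis using that(2)[of "a - 1"] ab 2(1) \<open>v = Edge p q\<close> by (simp add: spoke_in_def)
    qed
  next
    case 2
    then show ?thesis using that(3) unfolding triangles_fan sector_def by auto
  qed
qed

lemma mutable_nodes_fan:
  "1 \<le> m \<Longrightarrow> m \<le> n \<Longrightarrow> spoke_out (m + 1) \<in> mutable_nodes N \<Delta>"
  "1 \<le> m \<Longrightarrow> m \<le> n \<Longrightarrow> spoke_in (m + 1) \<in> mutable_nodes N \<Delta>"
  "1 \<le> m \<Longrightarrow> m \<le> n + 1 \<Longrightarrow> sector m \<in> mutable_nodes N \<Delta>"
proof -
  show "1 \<le> m \<Longrightarrow> m \<le> n \<Longrightarrow> spoke_out (m + 1) \<in> mutable_nodes N \<Delta>"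
    using internal_diagonal_iff[of 0 "m + 1"] N_bounds by (auto simp: mutable_nodes_def spoke_out_def)
  show "1 \<le> m \<Longrightarrow> m \<le> n \<Longrightarrow> spoke_in (m + 1) \<in> mutable_nodes N \<Delta>"
    using internal_diagonal_iff[of "m + 1" 0] N_bounds by (auto simp: mutable_nodes_def spoke_in_def)
  show "1 \<le> m \<Longrightarrow> m \<le> n + 1 \<Longrightarrow> sector m \<in> mutable_nodes N \<Delta>"
    using fan_triangle[of m] by (auto simp: mutable_nodes_def sector_def)
qed

text \<open>The degrees of the monomials \<open>y_hat\<close> in the two gradings are \<open>(0, 2)\<close> for spokes out of the fan vertex, \<open>(1, 0)\<close> for
spokes into it, and \<open>(1, -1)\<close> for triangles.  Since the degrees determine the lattice point, they leave only the covers of the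
lattice.\<close>

lemma fan_monomial_cover_iff:
  assumes ab: "a \<le> n" "b \<le> 2 * a" and ab': "a' \<le> n" "b' \<le> 2 * a'"
  shows "(\<exists>v \<in> mutable_nodes N \<Delta>. fan_monomial a' b' = y_hat \<Delta> v + fan_monomial a b) \<longleftrightarrow>
    a' = a + 1 \<and> b' = b \<or> b' = b + 1 \<and> a' = a"
proof
  assume "\<exists>v \<in> mutable_nodes N \<Delta>. fan_monomial a' b' = y_hat \<Delta> v + fan_monomial a b"
  then obtain v where v: "v \<in> mutable_nodes N \<Delta>" "fan_monomial a' b' = y_hat \<Delta> v + fan_monomial a b" by blast
  have rim: "int b' = weighted_degree rim_degree (y_hat \<Delta> v) + int b"
    using fan_monomial_degrees(1)[OF ab] fan_monomial_degrees(1)[OF ab'] v(2) by (simp add: weighted_degree_add)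
  have spoke: "2 * int a' - int n - int ((b' + 1) div 2) =
      weighted_degree spoke_degree (y_hat \<Delta> v) + (2 * int a - int n - int ((b + 1) div 2))"
    using fan_monomial_degrees(2)[OF ab] fan_monomial_degrees(2)[OF ab'] v(2) by (simp only: weighted_degree_add)
  \<comment> \<open>A step from an even to an odd \<open>b\<close> passes to the next boundary vertex \<open>s\<close>; a step from odd to even does not.\<close>
  have half: "int ((b + 1 + 1) div 2) = int ((b + 1) div 2) + (if even b then 1 else 0)"
    by (cases "even b") (auto elim!: evenE oddE)
  from v(1) show "a' = a + 1 \<and> b' = b \<or> b' = b + 1 \<and> a' = a"
  proof (cases rule: mutable_node_cases)
    case (spoke_out m)
    then have "weighted_degree rim_degree (y_hat \<Delta> v) = 0" "weighted_degree spoke_degree (y_hat \<Delta> v) = 2"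
      unfolding spoke_out(3) y_hat_spoke_out[OF spoke_out(1,2)] weighted_degree_simps by (simp_all add: degrees)
    then show ?thesis using rim spoke by auto
  next
    case (spoke_in m)
    then have "weighted_degree rim_degree (y_hat \<Delta> v) = 1" "weighted_degree spoke_degree (y_hat \<Delta> v) = 0"
      unfolding spoke_in(3) y_hat_spoke_in[OF spoke_in(1,2)] weighted_degree_simps by (simp_all add: degrees)
    then have "b' = b + 1" using rim by simp
    then show ?thesis
      using spoke \<open>weighted_degree spoke_degree (y_hat \<Delta> v) = 0\<close>
      by (simp only: half) (simp split: if_splits; presburger)
  next
    case (sector m)
    then have "weighted_degree rim_degree (y_hat \<Delta> v) = 1" "weighted_degree spoke_degree (y_hat \<Delta> v) = - 1"
      unfolding sector(3) y_hat_sector[OF sector(1,2)] weighted_degree_simps by (simp_all add: degrees)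
    then have "b' = b + 1" using rim by simp
    then show ?thesis
      using spoke \<open>weighted_degree spoke_degree (y_hat \<Delta> v) = - 1\<close>
      by (simp only: half) (simp split: if_splits; presburger)
  qed
next
  assume "a' = a + 1 \<and> b' = b \<or> b' = b + 1 \<and> a' = a"
  then show "\<exists>v \<in> mutable_nodes N \<Delta>. fan_monomial a' b' = y_hat \<Delta> v + fan_monomial a b"
  proof (elim disjE conjE)
    assume "a' = a + 1" "b' = b"
    then show ?thesis
      using fan_monomial_Suc_left[of a b] mutable_nodes_fan(1)[of "n - a"] ab'
      by (intro bexI[of _ "spoke_out (n + 1 - a)"]) (simp_all add: Suc_diff_le)
  next
    assume *: "b' = b + 1" "a' = a"
    let ?v = "if even b then sector (n + 1 - b div 2) else spoke_in (n + 1 - b div 2)"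
    have "?v \<in> mutable_nodes N \<Delta>"
    proof (cases "even b")
      case True
      then show ?thesis using mutable_nodes_fan(3)[of "n + 1 - b div 2"] ab' * by simp
    next
      case False
      then have "1 \<le> n - b div 2" using ab' * by (auto elim!: oddE)
      then show ?thesis using False mutable_nodes_fan(2)[of "n - b div 2"] by (simp add: Suc_diff_le)
    qed
    then show ?thesis
      using fan_monomial_Suc_right[of a b] ab' * by (intro bexI[of _ ?v]) auto
  qed
qed

lemma fan_monomial_least: "fan_monomial 0 0 = tpath3 (vertex (n + 2)) (vertex (n + 1)) k (vertex 1)"
  unfolding fan_monomial_def tpath3_def fan_node_defs Let_def by (simp add: algebra_simps)

lemma fan_monomial_greatest: "fan_monomial n (2 * n) = tpath3 (vertex (n + 2)) k (vertex 2) (vertex 1)"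
proof -
  have index: "n + 1 - n = 1" "n + 2 - (2 * n + 1) div 2 = 2" "even (2 * n) = True" "(1::nat) + 1 = 2" "(2::nat) - 1 = 1"
    by auto
  show ?thesis
    unfolding fan_monomial_def tpath3_def fan_node_defs Let_def index if_True by (simp add: algebra_simps)
qed

end

section \<open>The lattice path poset\<close>

text \<open>An injection that matches covers matches the generated orders, as chains of covers stay inside the image.\<close>

lemma order_generated_image:
  assumes inj: "inj_on f A"
    and cover: "\<And>p q. p \<in> A \<Longrightarrow> q \<in> A \<Longrightarrow> (f p, f q) \<in> C' \<longleftrightarrow> (p, q) \<in> C"
    and p: "p \<in> A" and q: "q \<in> A"
  shows "(f p, f q) \<in> order_generated (f ` A) C' \<longleftrightarrow> (p, q) \<in> order_generated A C"
proof
  let ?D' = "C' \<inter> f ` A \<times> f ` A" and ?D = "C \<inter> A \<times> A"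
  assume "(f p, f q) \<in> order_generated (f ` A) C'"
  then have "(f p, f q) \<in> ?D'\<^sup>*" by (simp add: order_generated_def)
  then have "\<exists>s \<in> A. f q = f s \<and> (p, s) \<in> ?D\<^sup>*"
  proof (induction rule: rtrancl_induct)
    case base
    show ?case using p by blast
  next
    case (step y w)
    then obtain s t where st: "s \<in> A" "y = f s" "(p, s) \<in> ?D\<^sup>*" "t \<in> A" "w = f t" "(y, w) \<in> C'"
      by blast
    then have "(s, t) \<in> ?D" using cover by blast
    with st(3) have "(p, t) \<in> ?D\<^sup>*" by (rule rtrancl_into_rtrancl)
    then show ?case using st(4,5) by blast
  qed
  then have "(p, q) \<in> ?D\<^sup>*" using inj q by (auto simp: inj_on_def)
  then show "(p, q) \<in> order_generated A C" using p q by (simp add: order_generated_def)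
next
  let ?D' = "C' \<inter> f ` A \<times> f ` A" and ?D = "C \<inter> A \<times> A"
  assume "(p, q) \<in> order_generated A C"
  then have "(p, q) \<in> ?D\<^sup>*" by (simp add: order_generated_def)
  then have "(f p, f q) \<in> ?D'\<^sup>*"
  proof (induction rule: rtrancl_induct)
    case (step y w)
    then have "(f y, f w) \<in> ?D'" using cover by blast
    then show ?case using step.IH by (rule rtrancl.rtrancl_into_rtrancl[rotated])
  qed simp
  then show "(f p, f q) \<in> order_generated (f ` A) C'" using p q by (simp add: order_generated_def)
qed

text \<open>The path stays on or below the line of slope \<open>2\<close> through its starting point, and \<open>path_points_corner\<close> shows that it touches
the line at each integral abscissa.\<close>

lemma path_points_staircase:
  "(a, c) \<in> path_points (p, q) (concat (replicate n [Right_Step, Up_Step, Up_Step])) \<Longrightarrow>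
     c - q \<le> 2 * (a - p)"
proof (induction n arbitrary: p q)
  case (Suc n)
  then consider "(a, c) = (p, q)" | "(a, c) = (p + 1, q)" | "(a, c) = (p + 1, q + 1)"
    | "(a, c) \<in> path_points (p + 1, q + 1 + 1) (concat (replicate n [Right_Step, Up_Step, Up_Step]))"
    by auto
  then show ?case
  proof cases
    case 4
    then show ?thesis using Suc.IH by fastforce
  qed auto
qed simp

lemma path_points_corner:
  "a \<le> n \<Longrightarrow> (p + int a, q + 2 * int a) \<in> path_points (p, q) (concat (replicate n [Right_Step, Up_Step, Up_Step]))"
proof (induction n arbitrary: p q a)
  case (Suc n)
  show ?case
  proof (cases a)
    case 0
    then show ?thesis by simp
  next
    case (Suc a')
    then have "(p + 1 + int a', q + 1 + 1 + 2 * int a') \<in>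
        path_points (p + 1, q + 1 + 1) (concat (replicate n [Right_Step, Up_Step, Up_Step]))"
      using Suc.IH[of a' "p + 1" "q + 1 + 1"] Suc.prems by simp
    then show ?thesis using Suc by (simp add: algebra_simps)
  qed
qed simp

lemma lattice_set_eq: "lattice_set n = {(a, b). 0 \<le> a \<and> a \<le> int n \<and> 0 \<le> b \<and> b \<le> 2 * a}"
proof -
  have "(\<exists>c\<ge>b. (a, c) \<in> path_points (0, 0) (concat (replicate n [Right_Step, Up_Step, Up_Step]))) \<longleftrightarrow> b \<le> 2 * a"
    if "0 \<le> a" "a \<le> int n" for a b
  proof
    show "b \<le> 2 * a" if "\<exists>c\<ge>b. (a, c) \<in> path_points (0, 0) (concat (replicate n [Right_Step, Up_Step, Up_Step]))"
      using that path_points_staircase by fastforce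
    show "\<exists>c\<ge>b. (a, c) \<in> path_points (0, 0) (concat (replicate n [Right_Step, Up_Step, Up_Step]))" if "b \<le> 2 * a"
      using that path_points_corner[of "nat a" n 0 0] \<open>0 \<le> a\<close> \<open>a \<le> int n\<close> by (intro exI[of _ "2 * a"]) auto
  qed
  then show ?thesis unfolding lattice_set_def by auto
qed

lemma extremal_elements_image:
  assumes inj: "inj_on f A"
    and iff: "\<And>p q. p \<in> A \<Longrightarrow> q \<in> A \<Longrightarrow> (f p, f q) \<in> r' \<longleftrightarrow> (p, q) \<in> r"
  shows "minimal_elements (f ` A) r' = f ` minimal_elements A r"
    "maximal_elements (f ` A) r' = f ` maximal_elements A r"
proof -
  have eq: "f p = f q \<longleftrightarrow> p = q" if "p \<in> A" "q \<in> A" for p q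
    using inj_on_eq_iff[OF inj that] .
  show "minimal_elements (f ` A) r' = f ` minimal_elements A r"
    unfolding minimal_elements_def using iff eq by auto
  show "maximal_elements (f ` A) r' = f ` maximal_elements A r"
    unfolding maximal_elements_def using iff eq by auto
qed

lemma lattice_order_mono:
  assumes "(p, q) \<in> lattice_order n"
  shows "fst p \<le> fst q \<and> snd p \<le> snd q"
proof -
  have "(p, q) \<in> ({((a, b), (c, d)). (c = a + 1 \<and> d = b) \<or> (d = b + 1 \<and> c = a)} \<inter> lattice_set n \<times> lattice_set n)\<^sup>*"
    using assms by (simp add: lattice_order_def order_generated_def)
  then show ?thesis
    by (induction rule: rtrancl_induct) auto
qed

lemma lattice_order_cover:
  assumes "(a, b) \<in> lattice_set n" "(c, d) \<in> lattice_set n" "(c = a + 1 \<and> d = b) \<or> (d = b + 1 \<and> c = a)"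
  shows "((a, b), (c, d)) \<in> lattice_order n"
  using assms unfolding lattice_order_def order_generated_def by auto

lemma minimal_lattice: "minimal_elements (lattice_set n) (lattice_order n) = {(0, 0)}"
proof (intro equalityI subsetI)
  fix p assume p: "p \<in> minimal_elements (lattice_set n) (lattice_order n)"
  obtain a b where ab: "p = (a, b)" by (cases p)
  have mem: "(a, b) \<in> lattice_set n" and least: "\<And>q. q \<in> lattice_set n \<Longrightarrow> (q, (a, b)) \<in> lattice_order n \<Longrightarrow> q = (a, b)"
    using p unfolding minimal_elements_def ab by auto
  have "b = 0"
  proof (rule ccontr)
    assume "b \<noteq> 0"
    then have "(a, b - 1) \<in> lattice_set n" using mem by (auto simp: lattice_set_eq)
    then show False using least[of "(a, b - 1)"] lattice_order_cover[of a "b - 1" n a b] mem by simp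
  qed
  moreover have "a = 0"
  proof (rule ccontr)
    assume "a \<noteq> 0"
    then have "(a - 1, b) \<in> lattice_set n" using mem \<open>b = 0\<close> by (auto simp: lattice_set_eq)
    then show False using least[of "(a - 1, b)"] lattice_order_cover[of "a - 1" b n a b] mem by simp
  qed
  ultimately show "p \<in> {(0, 0)}" using ab by simp
next
  fix p :: "int \<times> int" assume "p \<in> {(0, 0)}"
  moreover have "q = (0, 0)" if "q \<in> lattice_set n" "(q, (0, 0)) \<in> lattice_order n" for q
    using lattice_order_mono[OF that(2)] that(1) by (cases q) (auto simp: lattice_set_eq)
  ultimately show "p \<in> minimal_elements (lattice_set n) (lattice_order n)"
    by (auto simp: minimal_elements_def lattice_set_eq)
qed

lemma maximal_lattice: "maximal_elements (lattice_set n) (lattice_order n) = {(int n, 2 * int n)}"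
proof (intro equalityI subsetI)
  fix p assume p: "p \<in> maximal_elements (lattice_set n) (lattice_order n)"
  obtain a b where ab: "p = (a, b)" by (cases p)
  have mem: "(a, b) \<in> lattice_set n" and greatest: "\<And>q. q \<in> lattice_set n \<Longrightarrow> ((a, b), q) \<in> lattice_order n \<Longrightarrow> q = (a, b)"
    using p unfolding maximal_elements_def ab by auto
  have "b = 2 * a"
  proof (rule ccontr)
    assume "b \<noteq> 2 * a"
    then have "(a, b + 1) \<in> lattice_set n" using mem by (auto simp: lattice_set_eq)
    then show False using greatest[of "(a, b + 1)"] lattice_order_cover[of a b n a "b + 1"] mem by simp
  qed
  moreover have "a = int n"
  proof (rule ccontr)
    assume "a \<noteq> int n"
    then have "(a + 1, b) \<in> lattice_set n" using mem by (auto simp: lattice_set_eq)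
    then show False using greatest[of "(a + 1, b)"] lattice_order_cover[of a b n "a + 1" b] mem by simp
  qed
  ultimately show "p \<in> {(int n, 2 * int n)}" using ab by simp
next
  fix p :: "int \<times> int" assume "p \<in> {(int n, 2 * int n)}"
  moreover have "q = (int n, 2 * int n)" if "q \<in> lattice_set n" "((int n, 2 * int n), q) \<in> lattice_order n" for q
    using lattice_order_mono[OF that(2)] that(1) by (cases q) (auto simp: lattice_set_eq)
  ultimately show "p \<in> maximal_elements (lattice_set n) (lattice_order n)"
    by (auto simp: maximal_elements_def lattice_set_eq)
qed

context fan
begin

definition lattice_monomial :: "int \<times> int \<Rightarrow> monomial" where
  "lattice_monomial p = fan_monomial (nat (fst p)) (nat (snd p))"

lemma fan_index_lattice: "bij_betw (map_prod nat nat) (lattice_set n) fan_index"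
  by (rule bij_betw_byWitness[where f' = "map_prod int int"]) (auto simp: lattice_set_eq fan_index_def)

lemma lattice_monomial_bij: "bij_betw lattice_monomial (lattice_set n) (case_prod fan_monomial ` fan_index)"
proof -
  have "bij_betw (case_prod fan_monomial \<circ> map_prod nat nat) (lattice_set n) (case_prod fan_monomial ` fan_index)"
    using fan_index_lattice inj_on_imp_bij_betw[OF inj_fan_monomial] by (rule bij_betw_trans)
  moreover have "case_prod fan_monomial \<circ> map_prod nat nat = lattice_monomial"
    by (auto simp: lattice_monomial_def fun_eq_iff)
  ultimately show ?thesis by simp
qed

lemma lattice_monomial_cover_iff:
  assumes "p \<in> lattice_set n" "q \<in> lattice_set n"
  shows "(lattice_monomial p, lattice_monomial q) \<in> {(m, m'). \<exists>v \<in> mutable_nodes N \<Delta>. m' = y_hat \<Delta> v + m} \<longleftrightarrow>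
    (p, q) \<in> {((a, b), (c, d)). (c = a + 1 \<and> d = b) \<or> (d = b + 1 \<and> c = a)}"
proof -
  obtain a b c d where pq: "p = (int a, int b)" "q = (int c, int d)"
  proof -
    have "p = (int (nat (fst p)), int (nat (snd p)))" "q = (int (nat (fst q)), int (nat (snd q)))"
      using assms by (auto simp: lattice_set_eq)
    then show ?thesis using that by blast
  qed
  then have "a \<le> n" "b \<le> 2 * a" "c \<le> n" "d \<le> 2 * c"
    using assms by (auto simp: lattice_set_eq)
  then show ?thesis
    using fan_monomial_cover_iff[of a b c d] by (auto simp: pq lattice_monomial_def)
qed

lemma card_fan_index: "card fan_index = (n + 1)\<^sup>2"
proof -
  have "card fan_index = (\<Sum>a\<le>n. 2 * a + 1)"
    by (simp add: fan_index_def)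
  also have "\<dots> = (n + 1)\<^sup>2"
    by (induction n) (auto simp: power2_eq_square)
  finally show ?thesis .
qed

end

section \<open>The expansion poset of the longest edge\<close>

theorem proposition11p25:
  fixes n N k i j :: nat
    and \<Delta> :: "nat set set"
    and x :: "node \<Rightarrow> 'a::field_char_0"
  assumes "n \<ge> 1" and "N = n + 3" and "k < N"
    and "\<Delta> = fan_triangulation N k"
    and "i = ccw N k" and "j = cw N k"
    and "algebraically_independent_on (nodes \<Delta>) x"
  shows "card (expansion_monomials N \<Delta> x i j) = (n + 1)\<^sup>2 \<and>
    minimal_elements (expansion_monomials N \<Delta> x i j) (expansion_order N \<Delta> x i j)
      = {tpath3 i (ccw N i) k j} \<and>
    maximal_elements (expansion_monomials N \<Delta> x i j) (expansion_order N \<Delta> x i j)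
      = {tpath3 i k (cw N j) j} \<and>
    (\<exists>f. bij_betw f (expansion_monomials N \<Delta> x i j) (lattice_set n) \<and>
      (\<forall>m \<in> expansion_monomials N \<Delta> x i j. \<forall>m' \<in> expansion_monomials N \<Delta> x i j.
        (m, m') \<in> expansion_order N \<Delta> x i j \<longleftrightarrow> (f m, f m') \<in> lattice_order n))"
proof -
  interpret fan n N k
    using assms(1-3) by unfold_locales
  interpret fan_seed n N k x
    using assms(4,7) by unfold_locales simp
  have ij: "i = vertex (n + 2)" "j = vertex 1" "ccw N i = vertex (n + 1)" "cw N j = vertex 2"
    using assms(5,6) ccw_k cw_k ccw_vertex[of "n + 1"] cw_vertex_inner[of 1] N_bounds
    by (simp_all add: numeral_2_eq_2)
  let ?T = "expansion_monomials N \<Delta> x i j" and ?L = "lattice_set n" and ?f = lattice_monomial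
  have T: "?T = case_prod fan_monomial ` fan_index"
    unfolding ij(1,2) assms(4) by (rule expansion_monomials_fan)
  then have image: "?T = ?f ` ?L" and inj: "inj_on ?f ?L"
    using lattice_monomial_bij unfolding bij_betw_def by simp_all
  have order: "(?f p, ?f q) \<in> expansion_order N \<Delta> x i j \<longleftrightarrow> (p, q) \<in> lattice_order n"
    if "p \<in> ?L" "q \<in> ?L" for p q
    unfolding expansion_order_def lattice_order_def image
    by (rule order_generated_image[OF inj _ that]) (simp only: assms(4) lattice_monomial_cover_iff)
  have "card ?T = (n + 1)\<^sup>2"
    unfolding T card_image[OF inj_fan_monomial] card_fan_index ..
  moreover have "minimal_elements ?T (expansion_order N \<Delta> x i j) = {tpath3 i (ccw N i) k j}"
  proof -
    have "minimal_elements ?T (expansion_order N \<Delta> x i j) = ?f ` {(0, 0)}"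
      using extremal_elements_image(1)[OF inj order] by (simp only: image minimal_lattice)
    moreover have "tpath3 i (ccw N i) k j = fan_monomial 0 0"
      unfolding ij(3) unfolding ij(1,2) by (rule fan_monomial_least [symmetric])
    ultimately show ?thesis by (simp add: lattice_monomial_def)
  qed
  moreover have "maximal_elements ?T (expansion_order N \<Delta> x i j) = {tpath3 i k (cw N j) j}"
  proof -
    have "maximal_elements ?T (expansion_order N \<Delta> x i j) = ?f ` {(int n, 2 * int n)}"
      using extremal_elements_image(2)[OF inj order] by (simp only: image maximal_lattice)
    moreover have "tpath3 i k (cw N j) j = fan_monomial n (2 * n)"
      unfolding ij(4) unfolding ij(1,2) by (rule fan_monomial_greatest [symmetric])
    ultimately show ?thesis by (simp add: lattice_monomial_def nat_mult_distrib)
  qed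
  moreover have "bij_betw (inv_into ?L ?f) ?T ?L"
    unfolding image by (rule bij_betw_inv_into[OF inj_on_imp_bij_betw[OF inj]])
  moreover have "(m, m') \<in> expansion_order N \<Delta> x i j \<longleftrightarrow>
      (inv_into ?L ?f m, inv_into ?L ?f m') \<in> lattice_order n" if "m \<in> ?T" "m' \<in> ?T" for m m'
    using that order inv_into_f_f[OF inj] unfolding image by auto
  ultimately show ?thesis by blast
qed

end
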